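(* Let $n\ge 2$ and $0\le l<k\le n$ be integers. Suppose $\psi:(0,\infty)\times(0,\infty)\to(0,\infty)$ is a $C^1$ function with $\partial_1\psi\ge 0$, $\partial_2\psi\ge 0$ and at least one of these inequalities is strict. Then any smooth strictly convex solution $M$ to $$\left(\frac{P_k(W)}{P_l(W)}\right)^{\frac{1}{k-l}}=\psi(u,r)\quad\text{on }\mathbb{S}^n$$ must be an origin-centred sphere.
   Context: $(\mathbb{S}^n,g_0,\nabla)$ is the unit sphere in $\mathbb{R}^{n+1}$ with its standard metric and Levi-Civita connection. A smooth strictly convex solution $M$ means a smooth closed hypersurface $M\subset\mathbb{R}^{n+1}$ with strictly positive Gauss curvature that bounds a convex body $K$ containing the origin in its interior, and such that the equation holds with the following notation. $u:\mathbb{S}^n\to(0,\infty)$ is the support function of $K$; $X(z)=u(z)z+\nabla u(z)$ is the point of $M$ with unit outer normal $z$; $r(z)=|X(z)|=\sqrt{u^2+|\nabla u|^2}$ is the radial function viewed on $\mathbb{S}^n$ via the Gauss map; $W=\nabla^2u+u g_0$. $P_i(W)$ is the normalized $i$-th elementary symmetric function of the eigenvalues $\lambda_1,\dots,\lambda_n$ of $W$ with respect to $g_0$, $P_i(W)=\binom{n}{i}^{-1}\sum_{j_1<\cdots<j_i}\lambda_{j_1}\cdots\lambda_{j_i}$, with $P_0=1$. $\partial_1\psi,\partial_2\psi$ are the partial derivatives of $\psi$ in its first and second argument. *)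

theory Defs
  imports "HOL-Analysis.Analysis"
begin

section \<open>Differentiability classes\<close>

text \<open>Intended for open \<^term>\<open>S\<close> in a finite-dimensional space, where continuity of all iterated
  directional derivatives is the usual \<open>C\<^sup>m\<close> condition.\<close>

primrec Ck_on :: "nat \<Rightarrow> 'a::real_normed_vector set \<Rightarrow> ('a \<Rightarrow> 'b::real_normed_vector) \<Rightarrow> bool" where
  "Ck_on 0 S f \<longleftrightarrow> continuous_on S f"
| "Ck_on (Suc m) S f \<longleftrightarrow>
     (\<forall>x\<in>S. f differentiable (at x)) \<and> (\<forall>v. Ck_on m S (\<lambda>x. frechet_derivative f (at x) v))"

definition smooth_on :: "'a::real_normed_vector set \<Rightarrow> ('a \<Rightarrow> 'b::real_normed_vector) \<Rightarrow> bool" where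
  "smooth_on S f \<longleftrightarrow> (\<forall>m. Ck_on m S f)"

section \<open>Eigenvalues of a symmetric bilinear form on a subspace\<close>

text \<open>The eigenvalues, with respect to the inner product, of a symmetric bilinear form \<^term>\<open>B\<close> on the
  subspace \<^term>\<open>T\<close>, in nondecreasing order. Each eigenvalue is repeated according to the dimension of
  its eigenspace; as \<^term>\<open>B\<close> is symmetric, the list has length \<^term>\<open>dim T\<close>.\<close>

definition eigenvalues_on :: "'a::euclidean_space set \<Rightarrow> ('a \<Rightarrow> 'a \<Rightarrow> real) \<Rightarrow> real list" where
  "eigenvalues_on T B = (THE ls. sorted ls \<and>
     (\<forall>c. count_list ls c = dim {v \<in> T. \<forall>w\<in>T. B v w = c * (v \<bullet> w)}))"

definition normalized_esym :: "nat \<Rightarrow> real list \<Rightarrow> real" where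
  "normalized_esym i ls =
     (\<Sum>J | J \<subseteq> {..<length ls} \<and> card J = i. \<Prod>j\<in>J. ls ! j) / real (length ls choose i)"

section \<open>Hypersurfaces bounding convex bodies\<close>

definition smooth_closed_hypersurface :: "'a::euclidean_space set \<Rightarrow> bool" where
  "smooth_closed_hypersurface M \<longleftrightarrow> compact M \<and>
     (\<forall>p\<in>M. \<exists>U (f :: 'a \<Rightarrow> real). open U \<and> p \<in> U \<and> smooth_on U f \<and>
        (\<forall>x\<in>U. frechet_derivative f (at x) \<noteq> (\<lambda>v. 0)) \<and> M \<inter> U = {x \<in> U. f x = 0})"

text \<open>Used only at boundary points where the supporting hyperplane of \<^term>\<open>K\<close> is unique.\<close>

definition outer_unit_normal :: "'a::euclidean_space set \<Rightarrow> 'a \<Rightarrow> 'a" where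
  "outer_unit_normal K p = (THE \<nu>. norm \<nu> = 1 \<and> (\<forall>x\<in>K. \<nu> \<bullet> (x - p) \<le> 0))"

text \<open>A derivative relative to \<^term>\<open>at p within M\<close> is determined by the function only on vectors
  tangent to \<^term>\<open>M\<close>. Here and for the sphere below it is applied to tangent vectors only, where it
  is the differential of the restriction to the submanifold.\<close>

definition second_fundamental_form :: "'a::euclidean_space set \<Rightarrow> ('a \<Rightarrow> 'a) \<Rightarrow> 'a \<Rightarrow> 'a \<Rightarrow> 'a \<Rightarrow> real" where
  "second_fundamental_form M \<nu> p v w = frechet_derivative \<nu> (at p within M) v \<bullet> w"

text \<open>The product of the principal curvatures; with the outer normal, the unit sphere has principal
  curvatures \<open>+1\<close>.\<close>

definition gauss_curvature :: "'a::euclidean_space set \<Rightarrow> ('a \<Rightarrow> 'a) \<Rightarrow> 'a \<Rightarrow> real" where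
  "gauss_curvature M \<nu> p =
     prod_list (eigenvalues_on {v. v \<bullet> \<nu> p = 0} (second_fundamental_form M \<nu> p))"

definition smooth_strictly_convex :: "'a::euclidean_space set \<Rightarrow> 'a set \<Rightarrow> bool" where
  "smooth_strictly_convex M K \<longleftrightarrow>
     convex K \<and> compact K \<and> 0 \<in> interior K \<and> M = frontier K \<and>
     smooth_closed_hypersurface M \<and>
     (\<forall>p\<in>M. gauss_curvature M (outer_unit_normal K) p > 0)"

definition support_fun :: "'a::euclidean_space set \<Rightarrow> 'a \<Rightarrow> real" where
  "support_fun K z = (SUP x\<in>K. x \<bullet> z)"

section \<open>Calculus on the unit sphere\<close>

definition sph_tangent :: "'a::euclidean_space \<Rightarrow> 'a set" where
  "sph_tangent z = {v. v \<bullet> z = 0}"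

definition sph_grad :: "('a::euclidean_space \<Rightarrow> real) \<Rightarrow> 'a \<Rightarrow> 'a" where
  "sph_grad u z = (THE g. g \<in> sph_tangent z \<and>
     (\<forall>v\<in>sph_tangent z. g \<bullet> v = frechet_derivative u (at z within sphere 0 1) v))"

text \<open>The Levi-Civita connection of the standard metric: the tangential part of the Euclidean
  derivative of the tangent field \<^term>\<open>Y\<close> in the tangent direction \<^term>\<open>v\<close>.\<close>

definition sph_connection :: "('a::euclidean_space \<Rightarrow> 'a) \<Rightarrow> 'a \<Rightarrow> 'a \<Rightarrow> 'a" where
  "sph_connection Y z v =
     (let D = frechet_derivative Y (at z within sphere 0 1) v in D - (D \<bullet> z) *\<^sub>R z)"

definition sph_hessian :: "('a::euclidean_space \<Rightarrow> real) \<Rightarrow> 'a \<Rightarrow> 'a \<Rightarrow> 'a \<Rightarrow> real" where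
  "sph_hessian u z v w = sph_connection (sph_grad u) z v \<bullet> w"

definition W_form :: "('a::euclidean_space \<Rightarrow> real) \<Rightarrow> 'a \<Rightarrow> 'a \<Rightarrow> 'a \<Rightarrow> real" where
  "W_form u z v w = sph_hessian u z v w + u z * (v \<bullet> w)"

definition P_W :: "nat \<Rightarrow> ('a::euclidean_space \<Rightarrow> real) \<Rightarrow> 'a \<Rightarrow> real" where
  "P_W i u z = normalized_esym i (eigenvalues_on (sph_tangent z) (W_form u z))"

definition boundary_point :: "('a::euclidean_space \<Rightarrow> real) \<Rightarrow> 'a \<Rightarrow> 'a" where
  "boundary_point u z = u z *\<^sub>R z + sph_grad u z"

definition radial_fun :: "('a::euclidean_space \<Rightarrow> real) \<Rightarrow> 'a \<Rightarrow> real" where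
  "radial_fun u z = norm (boundary_point u z)"

end

theory Submission
  imports Defs
begin

text \<open>Let \<open>h\<close> be the 1-homogeneous extension of the support function, \<open>X = \<nabla>h\<close>, \<open>A = D\<^sup>2h\<close> and
  \<open>Y = X - (h / |x|\<^sup>2) x\<close>. Newton transformations of the Hessian \<open>A\<close> are divergence free, so integrating
  the divergence of \<open>f T\<^sub>l(A) Y\<close> for \<open>f = |x|\<^bsup>k-l\<^esup> P\<^sub>k / P\<^sub>l = \<psi>\<^bsup>k-l\<^esup>\<close> against a radial cutoff gives a weighted Minkowski
  formula. By monotonicity of \<open>\<psi>\<close> its gradient term is nonnegative, so \<open>P\<^sub>k (h / |x|\<^sup>2 - P\<^bsub>l+1\<^esub> / P\<^sub>l)\<close> has
  nonnegative integral. For \<open>k < n\<close>, Newton's inequality \<open>P\<^bsub>k+1\<^esub> / P\<^sub>k \<le> P\<^bsub>l+1\<^esub> / P\<^sub>l\<close> bounds this integral by that of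
  \<open>P\<^sub>k h / |x|\<^sup>2 - P\<^bsub>k+1\<^esub>\<close>, which is zero by the classical Minkowski formula. For \<open>k = n\<close>, the
  Heintze--Karcher inequality takes the place of that formula; it is obtained as in Montiel--Ros by
  sweeping out the body with inner normal parallels. Hence the gradient term vanishes, and as one
  partial derivative of \<open>\<psi>\<close> is positive and \<open>T\<^sub>l(A)\<close> and \<open>A\<close> are positive on the tangent space, \<open>Y = 0\<close>, so \<open>h / |x|\<close>
  is constant. To integrate over the sphere without a measure on it, everything is homogeneous and
  integrated over Euclidean space.\<close>

section \<open>Newton's inequalities\<close>

text \<open>Operator and weight are matched: \<open>f * P l\<close> is
  \<open>norm x ^ (k - l) * P k\<close>, so the divergence leaves \<open>P k\<close> times a
  difference of quotients of means, which Newton's inequality compares with a known identity. Both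
  arguments of \<psi> have gradients governed by \<open>Y\<close>: that of
  \<open>h x / norm x\<close> is a multiple of \<open>Y\<close>, that of \<open>norm (X x)\<close> a
  multiple of \<open>A Y\<close>, because \<open>A\<close> kills the radial direction. So the
  gradient term pairs the Newton transformation of \<open>Y\<close> with \<open>Y\<close> and with
  \<open>A Y\<close>. At \<open>k = n\<close> the comparison identity would need the mean of order
  \<open>n + 1\<close>, which is zero; the comparison then uses \<open>P n / P (n - 1)\<close>, the
  harmonic mean of the principal radii, which a volume estimate controls. The hypotheses speak of
  local defining functions and of derivatives within a hypersurface, where a chosen derivative is
  meaningful on tangent vectors only. A C^2 inverse Gauss map with positive differential therefore
  has to be recovered from them; second derivatives are needed because the divergence differentiates
  the Hessian of \<open>h\<close>.\<close>

definition esym :: "'i set \<Rightarrow> ('i \<Rightarrow> real) \<Rightarrow> nat \<Rightarrow> real" where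
  "esym I \<mu> m = (\<Sum>J | J \<subseteq> I \<and> card J = m. \<Prod>j\<in>J. \<mu> j)"

definition esym_mean :: "'i set \<Rightarrow> ('i \<Rightarrow> real) \<Rightarrow> nat \<Rightarrow> real" where
  "esym_mean I \<mu> m = esym I \<mu> m / real (card I choose m)"

lemma esym_0: "finite I \<Longrightarrow> esym I \<mu> 0 = 1"
proof -
  assume "finite I"
  then have "{J. J \<subseteq> I \<and> card J = 0} = {{}}" by (auto dest: finite_subset)
  then show ?thesis by (simp add: esym_def)
qed

lemma esym_eq_0: "finite I \<Longrightarrow> card I < m \<Longrightarrow> esym I \<mu> m = 0"
proof -
  assume "finite I" "card I < m"
  then have "\<not> (J \<subseteq> I \<and> card J = m)" for J using card_mono[of I J] by linarith
  then have "{J. J \<subseteq> I \<and> card J = m} = {}" by blast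
  then show ?thesis unfolding esym_def by (simp only: sum.empty)
qed

lemma esym_insert:
  assumes "finite I" "a \<notin> I"
  shows "esym (insert a I) \<mu> (Suc m) = esym I \<mu> (Suc m) + \<mu> a * esym I \<mu> m"
proof -
  have *: "{J. J \<subseteq> insert a I \<and> card J = Suc m} =
      {J. J \<subseteq> I \<and> card J = Suc m} \<union> insert a ` {J. J \<subseteq> I \<and> card J = m}" (is "?L = ?A \<union> ?B")
  proof
    show "?L \<subseteq> ?A \<union> ?B"
    proof
      fix J assume J: "J \<in> ?L"
      then have fin: "finite J" using assms(1) finite_subset by blast
      show "J \<in> ?A \<union> ?B"
      proof (cases "a \<in> J")
        case True
        then have "J = insert a (J - {a})" "J - {a} \<subseteq> I" "card (J - {a}) = m"
          using J fin by auto
        then show ?thesis by blast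
      qed (use J in auto)
    qed
    show "?A \<union> ?B \<subseteq> ?L"
      using assms by (auto simp: card_insert_if finite_subset)
  qed
  have fin: "finite {J. J \<subseteq> I \<and> P J}" for P using assms(1) by simp
  have inj: "inj_on (insert a) {J. J \<subseteq> I \<and> card J = m}"
    using assms(2) by (intro inj_onI) (metis (lifting) insert_ident mem_Collect_eq subsetD)
  have "(\<Sum>J\<in>?B. \<Prod>j\<in>J. \<mu> j) = (\<Sum>J | J \<subseteq> I \<and> card J = m. \<Prod>j\<in>insert a J. \<mu> j)"
    by (subst sum.reindex[OF inj]) simp
  also have "\<dots> = (\<Sum>J | J \<subseteq> I \<and> card J = m. \<mu> a * (\<Prod>j\<in>J. \<mu> j))"
    by (rule sum.cong[OF refl], subst prod.insert) (use assms finite_subset in auto)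
  finally have B: "(\<Sum>J\<in>?B. \<Prod>j\<in>J. \<mu> j) = \<mu> a * esym I \<mu> m"
    by (simp add: esym_def sum_distrib_left)
  have "?A \<inter> ?B = {}" using assms(2) by blast
  then have "(\<Sum>J\<in>?A \<union> ?B. \<Prod>j\<in>J. \<mu> j) = (\<Sum>J\<in>?A. \<Prod>j\<in>J. \<mu> j) + (\<Sum>J\<in>?B. \<Prod>j\<in>J. \<mu> j)"
    by (intro sum.union_disjoint) (simp_all only: fin finite_imageI)
  then show ?thesis unfolding B unfolding esym_def * .
qed

lemma esym_remove:
  assumes "finite I" "a \<in> I"
  shows "esym I \<mu> (Suc m) = esym (I - {a}) \<mu> (Suc m) + \<mu> a * esym (I - {a}) \<mu> m"
  using esym_insert[of "I - {a}" a \<mu> m] assms by (simp add: insert_absorb)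

lemma esym_pos:
  assumes "finite I" "\<And>i. i \<in> I \<Longrightarrow> \<mu> i > 0" "m \<le> card I"
  shows "esym I \<mu> m > 0"
proof -
  obtain J where "J \<subseteq> I" "card J = m" using assms(3) obtain_subset_with_card_n by metis
  then have ne: "{J. J \<subseteq> I \<and> card J = m} \<noteq> {}" by blast
  have "finite {J. J \<subseteq> I \<and> card J = m}" using assms(1) by simp
  then show ?thesis unfolding esym_def
    by (rule sum_pos[OF _ ne]) (use assms in \<open>auto intro!: prod_pos\<close>)
qed

lemma esym_top: "finite I \<Longrightarrow> esym I \<mu> (card I) = (\<Prod>i\<in>I. \<mu> i)"
proof -
  assume "finite I"
  then have "{J. J \<subseteq> I \<and> card J = card I} = {I}" by (auto dest: card_subset_eq)
  then show ?thesis by (simp add: esym_def)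
qed

text \<open>Every product of \<open>Suc m\<close> factors arises \<open>Suc m\<close> times, once
  for each factor singled out. Traces of Newton transformations are evaluated by this
  identity.\<close>

lemma sum_esym_remove:
  assumes "finite I"
  shows "(\<Sum>i\<in>I. \<mu> i * esym (I - {i}) \<mu> m) = real (Suc m) * esym I \<mu> (Suc m)"
  using assms
proof (induction I arbitrary: m)
  case empty
  then show ?case by (simp add: esym_eq_0)
next
  case (insert a I)
  have rem: "insert a I - {i} = insert a (I - {i})" "a \<notin> I - {i}" if "i \<in> I" for i
    using insert that by auto
  have "(\<Sum>i\<in>insert a I. \<mu> i * esym (insert a I - {i}) \<mu> m) =
     \<mu> a * esym I \<mu> m + (\<Sum>i\<in>I. \<mu> i * esym (insert a (I - {i})) \<mu> m)"
    using insert rem by (simp cong: sum.cong)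
  also have "\<dots> = real (Suc m) * esym (insert a I) \<mu> (Suc m)"
  proof (cases m)
    case 0
    then show ?thesis using insert insert.IH[of 0]
      by (simp add: esym_0 esym_insert)
  next
    case (Suc k)
    have "(\<Sum>i\<in>I. \<mu> i * esym (insert a (I - {i})) \<mu> m) =
       (\<Sum>i\<in>I. \<mu> i * esym (I - {i}) \<mu> m + \<mu> a * (\<mu> i * esym (I - {i}) \<mu> k))"
      unfolding Suc using insert rem by (intro sum.cong) (auto simp: esym_insert algebra_simps)
    also have "\<dots> = real (Suc m) * esym I \<mu> (Suc m) + \<mu> a * (real m * esym I \<mu> m)"
      using insert.IH[of m] insert.IH[of k] Suc by (simp only: sum.distrib sum_distrib_left[symmetric])
    finally show ?thesis using insert by (simp add: esym_insert algebra_simps)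
  qed
  finally show ?case .
qed

lemma esym_cong: "(\<And>i. i \<in> I \<Longrightarrow> \<mu> i = \<nu> i) \<Longrightarrow> esym I \<mu> m = esym I \<nu> m"
  unfolding esym_def by (intro sum.cong prod.cong) auto

lemma esym_reindex:
  assumes "bij_betw f I J"
  shows "esym J \<mu> m = esym I (\<mu> \<circ> f) m"
proof -
  have inj: "inj_on f I" and im: "f ` I = J" using assms by (auto simp: bij_betw_def)
  have b: "bij_betw (image f) {A. A \<subseteq> I \<and> card A = m} {B. B \<subseteq> J \<and> card B = m}"
  proof (rule bij_betw_imageI)
    show "inj_on ((`) f) {A. A \<subseteq> I \<and> card A = m}"
      using inj by (intro inj_onI) (metis (lifting) inj_on_image_eq_iff mem_Collect_eq)
    show "(`) f ` {A. A \<subseteq> I \<and> card A = m} = {B. B \<subseteq> J \<and> card B = m}"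
    proof (intro set_eqI iffI)
      fix B assume "B \<in> (`) f ` {A. A \<subseteq> I \<and> card A = m}"
      then show "B \<in> {B. B \<subseteq> J \<and> card B = m}"
        using im inj by (auto simp: card_image inj_on_subset)
    next
      fix B assume "B \<in> {B. B \<subseteq> J \<and> card B = m}"
      then have "B \<subseteq> f ` I" "card B = m" using im by auto
      then obtain A where "A \<subseteq> I" "B = f ` A" by (meson subset_imageE)
      then show "B \<in> (`) f ` {A. A \<subseteq> I \<and> card A = m}"
        using \<open>card B = m\<close> inj by (auto simp: card_image inj_on_subset)
    qed
  qed
  have "esym J \<mu> m = (\<Sum>A | A \<subseteq> I \<and> card A = m. \<Prod>j\<in>f ` A. \<mu> j)"
    unfolding esym_def using sum.reindex_bij_betw[OF b, of "prod \<mu>"] by simp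
  also have "\<dots> = esym I (\<mu> \<circ> f) m"
    unfolding esym_def
  proof (rule sum.cong[OF refl])
    fix A assume "A \<in> {A. A \<subseteq> I \<and> card A = m}"
    then have "inj_on f A" using inj inj_on_subset by blast
    then show "(\<Prod>j\<in>f ` A. \<mu> j) = (\<Prod>j\<in>A. (\<mu> \<circ> f) j)" by (simp add: prod.reindex)
  qed
  finally show ?thesis .
qed

lemma esym_mean_0: "finite I \<Longrightarrow> esym_mean I \<mu> 0 = 1"
  by (simp add: esym_mean_def esym_0)

lemma esym_mean_eq_0: "finite I \<Longrightarrow> card I < m \<Longrightarrow> esym_mean I \<mu> m = 0"
  by (simp add: esym_mean_def esym_eq_0)

lemma esym_mean_pos:
  "finite I \<Longrightarrow> (\<And>i. i \<in> I \<Longrightarrow> \<mu> i > 0) \<Longrightarrow> m \<le> card I \<Longrightarrow> esym_mean I \<mu> m > 0"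
  by (simp add: esym_mean_def esym_pos)

lemma esym_mean_nonneg:
  "finite I \<Longrightarrow> (\<And>i. i \<in> I \<Longrightarrow> \<mu> i > 0) \<Longrightarrow> esym_mean I \<mu> m \<ge> 0"
  using esym_mean_pos[of I \<mu> m] esym_mean_eq_0[of I m \<mu>] by (cases "m \<le> card I") (force simp: less_imp_le)+

lemma esym_eq_mean: "finite I \<Longrightarrow> esym I \<mu> m = real (card I choose m) * esym_mean I \<mu> m"
  by (cases "m \<le> card I") (auto simp: esym_mean_def esym_eq_0)

text \<open>Pascal's recursion for means: the weights \<open>n - m\<close> and \<open>m + 1\<close>
  over \<open>n + 1\<close> come from the quotients of binomial coefficients. Denominators are
  cleared, so the case \<open>m = card I\<close>, where the first weight is zero, is
  included.\<close>

lemma esym_mean_insert: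
  assumes "finite I" "a \<notin> I" "Suc m \<le> Suc (card I)"
  shows "real (Suc (card I)) * esym_mean (insert a I) \<mu> (Suc m) =
    (real (card I) - real m) * esym_mean I \<mu> (Suc m) + real (Suc m) * \<mu> a * esym_mean I \<mu> m"
proof -
  let ?n = "card I"
  let ?c = "real (Suc ?n choose Suc m)"
  have c: "?c > 0" using assms(3) by (metis of_nat_0_less_iff zero_less_binomial)
  have 1: "real (Suc ?n) * real (?n choose m) = ?c * real (Suc m)"
    using Suc_times_binomial_eq[of ?n m] by (metis of_nat_mult)
  have 2: "real (Suc ?n) * real (?n choose Suc m) = ?c * (real ?n - real m)"
  proof -
    have "real (?n choose Suc m) = ?c - real (?n choose m)" by simp
    then show ?thesis using 1 by (simp add: algebra_simps)
  qed
  have "?c * (real (Suc ?n) * esym_mean (insert a I) \<mu> (Suc m)) = real (Suc ?n) * esym (insert a I) \<mu> (Suc m)"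
    using esym_eq_mean[of "insert a I" \<mu> "Suc m"] assms by simp
  also have "\<dots> = real (Suc ?n) * real (?n choose Suc m) * esym_mean I \<mu> (Suc m)
      + \<mu> a * (real (Suc ?n) * real (?n choose m)) * esym_mean I \<mu> m"
    unfolding esym_insert[OF assms(1,2)] esym_eq_mean[OF assms(1)] by (simp only: ring_distribs mult_ac)
  also have "\<dots> = ?c * ((real ?n - real m) * esym_mean I \<mu> (Suc m) + real (Suc m) * \<mu> a * esym_mean I \<mu> m)"
    unfolding 1 2 by (simp add: algebra_simps)
  finally show ?thesis using c by simp
qed

text \<open>The difference of the sides combines the last three hypotheses with coefficients
  \<open>d\<^sup>2 - 1\<close>, \<open>x (k - 1) (d - 1)\<close> and
  \<open>x\<^sup>2 (k\<^sup>2 - 1)\<close>, plus the square of \<open>r - x q\<close>. In the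
  induction over the variables, p, q, r, s are consecutive means, x is the new variable, d is
  \<open>n - m\<close> and k is \<open>m + 1\<close>.\<close>

lemma newton_step:
  fixes d k p q r s x :: real
  assumes "d \<ge> 1" "k \<ge> 1" "x \<ge> 0" "q * s \<le> r\<^sup>2" "p * r \<le> q\<^sup>2" "p * s \<le> q * r"
  shows "((d + 1) * q + (k - 1) * x * p) * ((d - 1) * s + (k + 1) * x * r) \<le> (d * r + k * x * q)\<^sup>2"
proof -
  have "(d\<^sup>2 - 1) * (r\<^sup>2 - q * s) \<ge> 0" using assms by simp
  moreover have "x * ((k - 1) * (d - 1) * (q * r - p * s)) \<ge> 0" using assms by simp
  moreover have "x\<^sup>2 * ((k\<^sup>2 - 1) * (q\<^sup>2 - p * r)) \<ge> 0" using assms by simp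
  moreover have "(r - x * q)\<^sup>2 \<ge> 0" by simp
  ultimately have "0 \<le> (d\<^sup>2 - 1) * (r\<^sup>2 - q * s) + x * ((k - 1) * (d - 1) * (q * r - p * s)) +
     x\<^sup>2 * ((k\<^sup>2 - 1) * (q\<^sup>2 - p * r)) + (r - x * q)\<^sup>2" by linarith
  also have "\<dots> = (d * r + k * x * q)\<^sup>2 - ((d + 1) * q + (k - 1) * x * p) * ((d - 1) * s + (k + 1) * x * r)"
    by (simp add: power2_eq_square algebra_simps)
  finally show ?thesis by simp
qed

lemma newton_inequality:
  assumes "finite I" "\<And>i. i \<in> I \<Longrightarrow> \<mu> i > 0"
  shows "esym_mean I \<mu> m * esym_mean I \<mu> (Suc (Suc m)) \<le> (esym_mean I \<mu> (Suc m))\<^sup>2"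
  using assms
proof (induction I arbitrary: m)
  case empty
  then show ?case by (simp add: esym_mean_eq_0)
next
  case (insert a I)
  let ?n = "card I" and ?P = "esym_mean I \<mu>" and ?Q = "esym_mean (insert a I) \<mu>"
  have nn: "?P j \<ge> 0" for j using insert by (intro esym_mean_nonneg) auto
  have IH: "?P j * ?P (Suc (Suc j)) \<le> (?P (Suc j))\<^sup>2" for j using insert by auto
  show ?case
  proof (cases "Suc (Suc m) \<le> Suc ?n")
    case False
    then show ?thesis using insert by (simp add: esym_mean_eq_0)
  next
    case True
    \<comment> \<open>There is no mean of order \<open>m - 1\<close> for \<open>m = 0\<close>; the
      value 0 is harmless because p enters the recursion with the factor m.\<close>
    define p where "p = (if m = 0 then 0 else ?P (m - 1))"
    have P1: "real (Suc ?n) * ?Q (Suc m) = (real ?n - real m) * ?P (Suc m) + real (Suc m) * \<mu> a * ?P m"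
      and P2: "real (Suc ?n) * ?Q (Suc (Suc m)) =
         (real ?n - real (Suc m)) * ?P (Suc (Suc m)) + real (Suc (Suc m)) * \<mu> a * ?P (Suc m)"
      using insert True by (intro esym_mean_insert; simp)+
    have P0: "real (Suc ?n) * ?Q m = (real ?n - real m + 1) * ?P m + real m * \<mu> a * p"
    proof (cases m)
      case 0
      then show ?thesis using insert by (simp add: esym_mean_0)
    next
      case (Suc j)
      then show ?thesis using esym_mean_insert[of I a j \<mu>] insert True by (simp add: p_def)
    qed
    have pr: "p * ?P (Suc m) \<le> (?P m)\<^sup>2"
      using IH[of "m - 1"] by (cases m) (auto simp: p_def)
    have pp: "p \<ge> 0" by (simp add: p_def nn)
    have ps: "p * ?P (Suc (Suc m)) \<le> ?P m * ?P (Suc m)"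
    proof (cases "?P (Suc (Suc m)) = 0")
      case True
      then show ?thesis using nn by simp
    next
      case False
      then have "Suc (Suc m) \<le> ?n" using insert esym_mean_eq_0 not_le by metis
      then have pos: "?P m > 0" "?P (Suc m) > 0" using insert by (auto intro!: esym_mean_pos)
      \<comment> \<open>Two neighbouring Newton inequalities are multiplied, and the common positive
        factor is cancelled.\<close>
      have "(p * ?P (Suc m)) * (?P m * ?P (Suc (Suc m))) \<le> (?P m)\<^sup>2 * (?P (Suc m))\<^sup>2"
        by (intro mult_mono pr IH) (auto simp: nn)
      then have "(p * ?P (Suc (Suc m))) * (?P m * ?P (Suc m)) \<le> (?P m * ?P (Suc m)) * (?P m * ?P (Suc m))"
        by (simp add: power2_eq_square algebra_simps)
      then show ?thesis using pos by (meson mult_le_cancel_right_pos mult_pos_pos)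
    qed
    have "((real ?n - real m + 1) * ?P m + (real (Suc m) - 1) * \<mu> a * p) *
        ((real ?n - real m - 1) * ?P (Suc (Suc m)) + (real (Suc m) + 1) * \<mu> a * ?P (Suc m)) \<le>
        ((real ?n - real m) * ?P (Suc m) + real (Suc m) * \<mu> a * ?P m)\<^sup>2"
      by (rule newton_step) (use True insert.prems[of a] IH pr ps in \<open>auto simp: less_imp_le\<close>)
    then have "(real (Suc ?n) * ?Q m) * (real (Suc ?n) * ?Q (Suc (Suc m))) \<le> (real (Suc ?n) * ?Q (Suc m))\<^sup>2"
      unfolding P0 P1 P2 by (simp add: algebra_simps)
    then have "(real (Suc ?n))\<^sup>2 * (?Q m * ?Q (Suc (Suc m))) \<le> (real (Suc ?n))\<^sup>2 * (?Q (Suc m))\<^sup>2"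
      by (simp add: power2_eq_square algebra_simps)
    then show ?thesis by (meson mult_le_cancel_left_pos of_nat_0_less_iff zero_less_Suc zero_less_power)
  qed
qed

text \<open>Newton's inequality makes successive quotients of means decrease. The cross-multiplied
  form remains valid beyond the number of variables, where the denominators vanish.\<close>

lemma esym_mean_ratio_antimono:
  assumes "finite I" "\<And>i. i \<in> I \<Longrightarrow> \<mu> i > 0" "l \<le> k"
  shows "esym_mean I \<mu> (Suc k) * esym_mean I \<mu> l \<le> esym_mean I \<mu> k * esym_mean I \<mu> (Suc l)"
  using assms(3)
proof (induction k rule: dec_induct)
  case base
  then show ?case by simp
next
  case (step k)
  let ?P = "esym_mean I \<mu>"
  have nn: "?P j \<ge> 0" for j using assms by (intro esym_mean_nonneg) auto
  show ?case
  proof (cases "k \<le> card I")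
    case False
    then show ?thesis using assms nn by (simp add: esym_mean_eq_0)
  next
    case True
    then have pos: "?P k > 0" using assms by (intro esym_mean_pos) auto
    have "?P k * (?P (Suc (Suc k)) * ?P l) = (?P k * ?P (Suc (Suc k))) * ?P l" by simp
    also have "\<dots> \<le> (?P (Suc k))\<^sup>2 * ?P l"
      by (rule mult_right_mono[OF newton_inequality]) (use assms nn in auto)
    also have "\<dots> = ?P (Suc k) * (?P (Suc k) * ?P l)" by (simp add: power2_eq_square)
    also have "\<dots> \<le> ?P (Suc k) * (?P k * ?P (Suc l))"
      by (rule mult_left_mono[OF step.IH nn])
    finally show ?thesis using pos by (simp add: mult.left_commute)
  qed
qed

text \<open>Omitting the index i from the full product divides it by \<open>\<mu> i\<close>. For
  principal radii the right-hand side is the mean curvature.\<close>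

lemma esym_mean_ratio_top:
  assumes "finite I" "I \<noteq> {}" "\<And>i. i \<in> I \<Longrightarrow> \<mu> i > 0"
  shows "esym_mean I \<mu> (card I - 1) / esym_mean I \<mu> (card I) = (\<Sum>i\<in>I. 1 / \<mu> i) / card I"
proof -
  let ?n = "card I"
  have n: "?n > 0" using assms(1,2) by (simp add: card_gt_0_iff)
  have top: "esym_mean I \<mu> ?n = (\<Prod>i\<in>I. \<mu> i)" using assms(1) by (simp add: esym_mean_def esym_top)
  have P0: "(\<Prod>i\<in>I. \<mu> i) > 0" using assms(3) by (intro prod_pos) auto
  have rem: "esym (I - {i}) \<mu> (?n - 1) = (\<Prod>i\<in>I. \<mu> i) / \<mu> i" if "i \<in> I" for i
  proof -
    have "esym (I - {i}) \<mu> (?n - 1) = (\<Prod>j\<in>I - {i}. \<mu> j)"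
      using esym_top[of "I - {i}" \<mu>] assms(1) that by simp
    then show ?thesis using assms(3)[OF that] by (simp add: prod.remove[OF assms(1) that])
  qed
  have "esym I \<mu> (?n - 1) = (\<Sum>i\<in>I. (\<Prod>j\<in>I. \<mu> j) / \<mu> i)"
  proof -
    have "(\<Sum>i\<in>I. esym (I - {i}) \<mu> (?n - 1)) = esym I \<mu> (?n - 1)" if n2: "?n \<ge> 2"
    proof -
      obtain k where k: "?n = Suc (Suc k)" using n2 by (metis add_2_eq_Suc le_Suc_ex)
      have "(\<Sum>i\<in>I. esym (I - {i}) \<mu> (Suc k)) = (\<Sum>i\<in>I. esym I \<mu> (Suc k) - \<mu> i * esym (I - {i}) \<mu> k)"
        using esym_remove[OF assms(1)] by (intro sum.cong) auto
      also have "\<dots> = real ?n * esym I \<mu> (Suc k) - real (Suc k) * esym I \<mu> (Suc k)"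
        by (simp only: sum_subtractf sum_esym_remove[OF assms(1)] sum_constant of_nat_id)
      finally show ?thesis by (simp add: k algebra_simps)
    qed
    moreover have "(\<Sum>i\<in>I. esym (I - {i}) \<mu> (?n - 1)) = esym I \<mu> (?n - 1)" if "?n = 1"
      using that assms(1) by (simp add: esym_0)
    ultimately have "(\<Sum>i\<in>I. esym (I - {i}) \<mu> (?n - 1)) = esym I \<mu> (?n - 1)" using n by linarith
    then show ?thesis using rem by (simp cong: sum.cong)
  qed
  also have "\<dots> = (\<Prod>j\<in>I. \<mu> j) * (\<Sum>i\<in>I. 1 / \<mu> i)" by (simp add: sum_distrib_left)
  finally have e: "esym I \<mu> (?n - 1) = (\<Prod>j\<in>I. \<mu> j) * (\<Sum>i\<in>I. 1 / \<mu> i)" .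
  have choose: "?n choose (?n - Suc 0) = ?n" using n binomial_symmetric[of 1 ?n] by simp
  from e show ?thesis
    unfolding top using n P0 choose by (simp add: esym_mean_def)
qed

lemma esym_mean_ratio_top_le:
  assumes "finite I" "I \<noteq> {}" "\<And>i. i \<in> I \<Longrightarrow> \<mu> i > 0" "\<And>i. i \<in> I \<Longrightarrow> s \<le> \<mu> i"
  shows "s * (esym_mean I \<mu> (card I - 1) / esym_mean I \<mu> (card I)) \<le> 1"
proof -
  have "s * (\<Sum>i\<in>I. 1 / \<mu> i) \<le> (\<Sum>i\<in>I. 1)"
    unfolding sum_distrib_left using assms(3,4) by (intro sum_mono) (simp add: divide_le_eq_1)
  moreover have "card I > 0" using assms(1,2) by (simp add: card_gt_0_iff)
  ultimately have "s * ((\<Sum>i\<in>I. 1 / \<mu> i) / card I) \<le> 1" by (simp add: divide_le_eq_1)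
  then show ?thesis using esym_mean_ratio_top[of I \<mu>] assms(1-3) by metis
qed

text \<open>The arithmetic-geometric mean inequality for the nonnegative factors
  \<open>1 - s / \<mu> i\<close>. It bounds the Jacobian of a normal parallel by the Gauss and mean
  curvatures.\<close>

lemma prod_diff_le:
  assumes "finite I" "I \<noteq> {}" "\<And>i. i \<in> I \<Longrightarrow> \<mu> i > 0" "\<And>i. i \<in> I \<Longrightarrow> s \<le> \<mu> i"
  shows "(\<Prod>i\<in>I. \<mu> i - s) \<le> (\<Prod>i\<in>I. \<mu> i) * (1 - s * (esym_mean I \<mu> (card I - 1) / esym_mean I \<mu> (card I))) ^ card I"
proof -
  let ?n = "card I"
  have n: "?n > 0" using assms(1,2) by (simp add: card_gt_0_iff)
  have P0: "(\<Prod>i\<in>I. \<mu> i) > 0" using assms(3) by (intro prod_pos) auto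
  have H: "esym_mean I \<mu> (?n - 1) / esym_mean I \<mu> ?n = (\<Sum>i\<in>I. 1 / \<mu> i) / ?n"
    by (rule esym_mean_ratio_top[OF assms(1-3)])
  have nn: "1 - s / \<mu> i \<ge> 0" if "i \<in> I" for i using assms(3,4)[OF that] by (simp add: divide_le_eq_1)
  have le: "(\<Prod>i\<in>I. 1 - s / \<mu> i) \<le> ((\<Sum>i\<in>I. 1 - s / \<mu> i) / ?n) ^ ?n"
  proof -
    let ?p = "\<Prod>i\<in>I. 1 - s / \<mu> i"
    have amgm: "?p powr (1 / ?n) \<le> (\<Sum>i\<in>I. (1 - s / \<mu> i) / ?n)"
      using arith_geom_mean[of I "\<lambda>i. 1 - s / \<mu> i"] assms(1,2) nn by blast
    have p: "?p \<ge> 0" using nn by (rule prod_nonneg)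
    have "?p = (?p powr (1 / ?n)) ^ ?n"
      using n p by (simp add: powr_realpow' powr_powr flip: powr_realpow')
    also have "\<dots> \<le> ((\<Sum>i\<in>I. 1 - s / \<mu> i) / ?n) ^ ?n"
      using amgm by (intro power_mono) (simp_all add: sum_divide_distrib)
    finally show ?thesis .
  qed
  have "(\<Sum>i\<in>I. 1 - s / \<mu> i) / ?n = 1 - s * ((\<Sum>i\<in>I. 1 / \<mu> i) / ?n)"
  proof -
    have "(\<Sum>i\<in>I. 1 - s / \<mu> i) = ?n - s * (\<Sum>i\<in>I. 1 / \<mu> i)"
      by (simp add: sum_subtractf sum_distrib_left)
    then show ?thesis using n by (simp add: diff_divide_distrib)
  qed
  moreover have "(\<Prod>i\<in>I. \<mu> i - s) = (\<Prod>i\<in>I. \<mu> i) * (\<Prod>i\<in>I. 1 - s / \<mu> i)"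
    unfolding prod.distrib[symmetric]
    using assms(3) by (intro prod.cong[OF refl]) (simp add: right_diff_distrib less_imp_neq[symmetric])
  ultimately show ?thesis unfolding H using le P0 by simp
qed

section \<open>Eigenvalues of symmetric bilinear forms\<close>

definition orthonormal_set :: "'a::euclidean_space set \<Rightarrow> bool" where
  "orthonormal_set E \<longleftrightarrow> pairwise orthogonal E \<and> (\<forall>e\<in>E. norm e = 1)"

lemma orthonormal_set_inner:
  "orthonormal_set E \<Longrightarrow> e \<in> E \<Longrightarrow> f \<in> E \<Longrightarrow> e \<bullet> f = (if e = f then 1 else 0)"
  by (auto simp: orthonormal_set_def pairwise_def orthogonal_def dot_square_norm)

lemma orthonormal_set_independent: "orthonormal_set E \<Longrightarrow> independent E"
  by (rule pairwise_orthogonal_independent) (auto simp: orthonormal_set_def)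

lemma orthonormal_set_finite: "orthonormal_set E \<Longrightarrow> finite E"
  using orthonormal_set_independent independent_imp_finite by blast

lemma orthonormal_expansion:
  assumes E: "orthonormal_set E" and v: "v \<in> span E"
  shows "v = (\<Sum>e\<in>E. (v \<bullet> e) *\<^sub>R e)"
proof -
  obtain u where u: "v = (\<Sum>e\<in>E. u e *\<^sub>R e)"
    using v span_finite[OF orthonormal_set_finite[OF E]] by auto
  have "v \<bullet> f = u f" if "f \<in> E" for f
  proof -
    have "v \<bullet> f = (\<Sum>e\<in>E. if e = f then u e else 0)"
      unfolding u inner_sum_left using that
      by (intro sum.cong) (auto simp: orthonormal_set_inner[OF E])
    then show ?thesis using that orthonormal_set_finite[OF E] by simp
  qed
  then show ?thesis by (metis (no_types, lifting) u sum.cong)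
qed

text \<open>A maximizer of the Rayleigh quotient on the unit sphere of T works: its first variation
  vanishes in all directions orthogonal to it.\<close>

lemma symmetric_eigenvector:
  fixes A :: "'a::euclidean_space \<Rightarrow> 'a"
  assumes T: "subspace T" "T \<noteq> {0}" and A: "linear A" "\<And>v. v \<in> T \<Longrightarrow> A v \<in> T"
    and sym: "\<And>v w. v \<in> T \<Longrightarrow> w \<in> T \<Longrightarrow> A v \<bullet> w = v \<bullet> A w"
  obtains e c where "e \<in> T" "norm e = 1" "A e = c *\<^sub>R e"
proof -
  let ?S = "sphere 0 1 \<inter> T"
  have comp: "compact ?S" by (intro compact_Int_closed closed_subspace T(1)) simp
  obtain x where x: "x \<in> T" "x \<noteq> 0" using T subspace_0 by blast
  then have "x /\<^sub>R norm x \<in> ?S" using T by (auto simp: subspace_scale)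
  then have ne: "?S \<noteq> {}" by blast
  have "continuous_on ?S (\<lambda>v. A v \<bullet> v)"
    using A(1) by (intro continuous_intros linear_continuous_on linear_conv_bounded_linear[THEN iffD1])
  then obtain e where e: "e \<in> ?S" and max: "\<And>v. v \<in> ?S \<Longrightarrow> A v \<bullet> v \<le> A e \<bullet> e"
    using continuous_attains_sup[OF comp ne] by blast
  have eT: "e \<in> T" and e1: "e \<bullet> e = 1" using e by (auto simp: dot_square_norm)
  define c where "c = A e \<bullet> e"
  have le: "A v \<bullet> v \<le> c * (v \<bullet> v)" if "v \<in> T" for v
  proof (cases "v = 0")
    case True
    then show ?thesis by simp
  next
    case False
    then have "v /\<^sub>R norm v \<in> ?S" using T that by (auto simp: subspace_scale)
    from max[OF this] have "(A v \<bullet> v) / (norm v)\<^sup>2 \<le> c"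
      using A(1) by (simp add: linear_scale c_def power2_eq_square field_simps)
    then show ?thesis using False by (simp add: divide_le_eq dot_square_norm)
  qed
  have orth: "A e \<bullet> w = 0" if w: "w \<in> T" "w \<bullet> e = 0" for w
  proof (rule ccontr)
    assume ne0: "A e \<bullet> w \<noteq> 0"
    define a where "a = A e \<bullet> w"
    define d where "d = c * (w \<bullet> w) - A w \<bullet> w"
    have q: "2 * t * a \<le> t\<^sup>2 * d" for t
    proof -
      have "A (e + t *\<^sub>R w) \<bullet> (e + t *\<^sub>R w) \<le> c * ((e + t *\<^sub>R w) \<bullet> (e + t *\<^sub>R w))"
        using T eT w by (intro le) (simp add: subspace_add subspace_scale)
      moreover have "A w \<bullet> e = a" using sym[OF w(1) eT] by (simp add: a_def inner_commute)
      ultimately show ?thesis using A(1) e1 w(2)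
        by (simp add: linear_add linear_scale inner_add_left inner_add_right inner_commute[of e w]
            a_def[symmetric] c_def[symmetric] d_def power2_eq_square algebra_simps)
    qed
    have d0: "d \<ge> 0" using le[OF w(1)] by (simp add: d_def)
    \<comment> \<open>With this t the left side of \<open>q\<close> is
      \<open>2 (d + 1) t\<^sup>2\<close>, more than \<open>d t\<^sup>2\<close>; the summand 1 covers
      the case \<open>d = 0\<close>.\<close>
    define t where "t = a / (d + 1)"
    have "a = t * (d + 1)" using d0 by (simp add: t_def)
    then have "2 * t * a = t\<^sup>2 * (2 * (d + 1))" by (simp add: power2_eq_square)
    then have "t\<^sup>2 * (2 * (d + 1)) \<le> t\<^sup>2 * d" using q[of t] by simp
    moreover have "t\<^sup>2 > 0" using ne0 d0 by (simp add: t_def a_def)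
    ultimately show False using d0 by simp
  qed
  define w where "w = A e - c *\<^sub>R e"
  have "w \<in> T" "w \<bullet> e = 0"
    using T eT A e1 by (auto simp: w_def subspace_diff subspace_scale inner_diff_left c_def)
  then have "A e \<bullet> w = 0" "e \<bullet> w = 0" using orth by (auto simp: inner_commute)
  then have "w \<bullet> w = 0" by (simp add: w_def inner_diff_left)
  then have "A e = c *\<^sub>R e" by (simp add: w_def)
  then show ?thesis using that eT e by auto
qed

lemma spectral_theorem:
  fixes A :: "'a::euclidean_space \<Rightarrow> 'a"
  assumes "subspace T" "linear A" "\<And>v. v \<in> T \<Longrightarrow> A v \<in> T"
    and "\<And>v w. v \<in> T \<Longrightarrow> w \<in> T \<Longrightarrow> A v \<bullet> w = v \<bullet> A w"
  obtains E \<mu> where "orthonormal_set E" "E \<subseteq> T" "span E = T" "card E = dim T"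
    "\<And>e. e \<in> E \<Longrightarrow> A e = \<mu> e *\<^sub>R e"
proof -
  have "\<exists>E \<mu>. orthonormal_set E \<and> E \<subseteq> T \<and> span E = T \<and> (\<forall>e\<in>E. A e = \<mu> e *\<^sub>R e)"
    using assms
  proof (induction "dim T" arbitrary: T rule: less_induct)
    case less
    show ?case
    proof (cases "T = {0}")
      case True
      then show ?thesis by (intro exI[of _ "{}"]) (auto simp: orthonormal_set_def)
    next
      case False
      obtain e c where e: "e \<in> T" "norm e = 1" "A e = c *\<^sub>R e"
        using symmetric_eigenvector[OF less.prems(1) False less.prems(2-4)] by blast
      have ee: "e \<bullet> e = 1" using e by (simp add: dot_square_norm)
      let ?T = "T \<inter> {v. v \<bullet> e = 0}"
      have sub: "subspace ?T"
        using less.prems(1) by (auto intro!: subspace_inter simp: subspace_def inner_add_left)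
      have "e \<notin> ?T" using ee by simp
      then have "?T \<subset> T" using e(1) by blast
      then have "span ?T \<subset> span T" using less.prems(1) sub by (metis span_eq_iff)
      then have dlt: "dim ?T < dim T" by (rule dim_psubset)
      have inv: "A v \<in> ?T" if "v \<in> ?T" for v
        using that less.prems e by auto
      obtain E \<mu> where E: "orthonormal_set E" "E \<subseteq> ?T" "span E = ?T" "\<forall>f\<in>E. A f = \<mu> f *\<^sub>R f"
        using less.hyps[OF dlt sub less.prems(2) inv] less.prems(4) by blast
      have eE: "e \<notin> E" using E(2) ee by auto
      have 1: "orthonormal_set (insert e E)"
        using E(1,2) e(2) eE by (auto simp: orthonormal_set_def pairwise_insert orthogonal_def inner_commute)
      have 2: "T \<subseteq> span (insert e E)"
      proof
        fix v assume v: "v \<in> T"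
        have "v - (v \<bullet> e) *\<^sub>R e \<in> ?T"
          using v e ee less.prems(1) by (auto simp: subspace_diff subspace_scale inner_diff_left)
        then show "v \<in> span (insert e E)" unfolding span_insert using E(3) by auto
      qed
      have 3: "span (insert e E) \<subseteq> T"
        using E(2) e less.prems(1) by (intro span_minimal) auto
      show ?thesis
        by (rule exI[of _ "insert e E"], rule exI[of _ "\<mu>(e := c)"])
          (use 1 2 3 E e eE in auto)
    qed
  qed
  then obtain E \<mu> where E: "orthonormal_set E" "E \<subseteq> T" "span E = T" "\<forall>e\<in>E. A e = \<mu> e *\<^sub>R e" by blast
  then have "card E = dim T" using orthonormal_set_independent[OF E(1)] by (metis dim_span dim_eq_card_independent)
  then show ?thesis using that E by blast
qed

text \<open>The eigenspace for c is spanned by the members of E with eigenvalue c, so its dimension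
  is a multiplicity, and a sorted list is determined by its multiplicities. Both
  \<open>gauss_curvature\<close> and \<open>P_W\<close> are evaluated through this lemma.\<close>

lemma eigenvalues_on_eq:
  fixes A :: "'a::euclidean_space \<Rightarrow> 'a"
  assumes "subspace T" "linear A"
    and E: "orthonormal_set E" "span E = T" "\<And>e. e \<in> E \<Longrightarrow> A e = \<mu> e *\<^sub>R e"
    and B: "\<And>v w. v \<in> T \<Longrightarrow> w \<in> T \<Longrightarrow> B v w = A v \<bullet> w"
  shows "eigenvalues_on T B = sorted_list_of_multiset (image_mset \<mu> (mset_set E))"
proof -
  let ?L = "sorted_list_of_multiset (image_mset \<mu> (mset_set E))"
  have fin: "finite E" by (rule orthonormal_set_finite[OF E(1)])
  have ET: "E \<subseteq> T" using E(2) span_superset by blast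
  have A_exp: "A v = (\<Sum>e\<in>E. (v \<bullet> e) *\<^sub>R (\<mu> e *\<^sub>R e))" if "v \<in> T" for v
  proof -
    have "A v = A (\<Sum>e\<in>E. (v \<bullet> e) *\<^sub>R e)" using orthonormal_expansion[OF E(1)] that E(2) by metis
    then show ?thesis using E(3) by (simp add: linear_sum[OF assms(2)] linear_scale[OF assms(2)] cong: sum.cong)
  qed
  have A_in: "A v \<bullet> f = \<mu> f * (v \<bullet> f)" if "v \<in> T" "f \<in> E" for v f
  proof -
    have "A v \<bullet> f = (\<Sum>e\<in>E. if e = f then \<mu> e * (v \<bullet> e) else 0)"
      unfolding A_exp[OF that(1)] inner_sum_left using that(2)
      by (intro sum.cong) (auto simp: orthonormal_set_inner[OF E(1)])
    then show ?thesis using that fin by simp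
  qed
  have space: "{v \<in> T. \<forall>w\<in>T. B v w = c * (v \<bullet> w)} = span {e \<in> E. \<mu> e = c}" (is "?V = span ?Ec") for c
  proof
    have Ec: "orthonormal_set ?Ec" using E(1) by (auto simp: orthonormal_set_def pairwise_def)
    show "?V \<subseteq> span ?Ec"
    proof
      fix v assume v: "v \<in> ?V"
      then have vT: "v \<in> T" by simp
      have eq: "\<mu> f * (v \<bullet> f) = c * (v \<bullet> f)" if "f \<in> E" for f
        using v B[of v f] A_in[OF vT that] ET that by auto
      have z: "v \<bullet> f = 0" if "f \<in> E" "\<mu> f \<noteq> c" for f using eq[OF that(1)] that(2) by simp
      have "v = (\<Sum>e\<in>E. (v \<bullet> e) *\<^sub>R e)" using orthonormal_expansion[OF E(1)] vT E(2) by blast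
      also have "\<dots> = (\<Sum>e\<in>?Ec. (v \<bullet> e) *\<^sub>R e)"
        using fin z by (intro sum.mono_neutral_right) auto
      also have "\<dots> \<in> span ?Ec" by (intro span_sum span_scale span_base)
      finally show "v \<in> span ?Ec" .
    qed
    show "span ?Ec \<subseteq> ?V"
    proof
      fix v assume v: "v \<in> span ?Ec"
      then have vT: "v \<in> T" using E(2) span_mono[of ?Ec E] by auto
      have "A v = c *\<^sub>R v"
        using v
      proof (induction rule: span_induct_alt)
        case base
        then show ?case using assms(2) by (simp add: linear_0)
      next
        case (step a x y)
        then show ?case using E(3) by (simp add: linear_add[OF assms(2)] linear_scale[OF assms(2)] scaleR_add_right)
      qed
      then show "v \<in> ?V" using vT B by simp
    qed
  qed
  have count: "count_list ?L c = dim {v \<in> T. \<forall>w\<in>T. B v w = c * (v \<bullet> w)}" for c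
  proof -
    have "independent {e \<in> E. \<mu> e = c}"
      by (rule independent_mono[OF orthonormal_set_independent[OF E(1)]]) auto
    then have "dim (span {e \<in> E. \<mu> e = c}) = card {e \<in> E. \<mu> e = c}"
      by (metis dim_span dim_eq_card_independent)
    moreover have "count_list ?L c = card {e \<in> E. \<mu> e = c}"
    proof -
      have "count_list ?L c = count (image_mset \<mu> (mset_set E)) c"
        by (metis count_mset mset_sorted_list_of_multiset)
      also have "\<dots> = (\<Sum>x | x \<in># mset_set E \<and> c = \<mu> x. count (mset_set E) x)"
        by (rule count_image_mset')
      also have "\<dots> = (\<Sum>x\<in>{e \<in> E. \<mu> e = c}. 1)"
        by (rule sum.cong) (auto simp: fin)
      also have "\<dots> = card {e \<in> E. \<mu> e = c}" by simp
      finally show ?thesis .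
    qed
    ultimately show ?thesis unfolding space by simp
  qed
  show ?thesis unfolding eigenvalues_on_def
  proof (rule the_equality)
    show "sorted ?L \<and> (\<forall>c. count_list ?L c = dim {v \<in> T. \<forall>w\<in>T. B v w = c * (v \<bullet> w)})"
      using count by simp
    fix ls assume ls: "sorted ls \<and> (\<forall>c. count_list ls c = dim {v \<in> T. \<forall>w\<in>T. B v w = c * (v \<bullet> w)})"
    then have "mset ls = mset ?L" using count by (intro multiset_eqI) (metis count_mset)
    then show "ls = ?L" using ls by (metis properties_for_sort sorted_sort_id sorted_sorted_list_of_multiset)
  qed
qed

text \<open>The list is indexed by positions, \<open>esym_mean\<close> by eigenvectors; a
  permutation matching the sorted list with an enumeration of E translates between subsets of the
  two.\<close>

lemma normalized_esym_eigenvalues: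
  assumes fin: "finite E"
  shows "normalized_esym i (sorted_list_of_multiset (image_mset \<mu> (mset_set E))) = esym_mean E \<mu> i"
proof -
  let ?L = "sorted_list_of_multiset (image_mset \<mu> (mset_set E))"
  obtain xs where xs: "set xs = E" "distinct xs" using finite_distinct_list[OF fin] by blast
  have "mset_set E = mset xs" using xs by (metis mset_set_set)
  then have "mset ?L = mset (map \<mu> xs)" by (simp only: mset_sorted_list_of_multiset mset_map)
  then obtain p where perm: "p permutes {..<length (map \<mu> xs)}" "permute_list p (map \<mu> xs) = ?L"
    by (rule mset_eq_permutation)
  then have lenL: "length ?L = length (map \<mu> xs)" by (metis length_permute_list)
  have p: "bij_betw p {..<length ?L} {..<length (map \<mu> xs)}"
      "\<forall>i<length ?L. ?L ! i = map \<mu> xs ! p i"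
    using permutes_imp_bij[OF perm(1)] permute_list_nth[OF perm(1)] perm(2) lenL by (simp, metis)
  have len: "length ?L = card E" using \<open>mset ?L = mset (map \<mu> xs)\<close> xs
    by (metis distinct_card length_map mset_eq_length)
  have q: "bij_betw (\<lambda>i. xs ! p i) {..<length ?L} E"
  proof -
    have "bij_betw ((!) xs) {..<length xs} E" using xs by (intro bij_betw_nth) auto
    then have "bij_betw ((!) xs \<circ> p) {..<length ?L} E" using bij_betw_trans[OF p(1)] by auto
    then show ?thesis by (simp add: o_def)
  qed
  have pl: "p i < length xs" if "i < length ?L" for i using p(1) that by (auto simp: bij_betw_def)
  have "esym E \<mu> i = esym {..<length ?L} (\<mu> \<circ> (\<lambda>i. xs ! p i)) i" by (rule esym_reindex[OF q])
  also have "\<dots> = esym {..<length ?L} ((!) ?L) i"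
    using p(2) pl by (intro esym_cong) auto
  finally show ?thesis unfolding normalized_esym_def esym_mean_def len esym_def by simp
qed

section \<open>Newton transformations\<close>

definition btrace :: "('a::euclidean_space \<Rightarrow>\<^sub>L 'a) \<Rightarrow> real" where
  "btrace L = (\<Sum>b\<in>Basis. L b \<bullet> b)"

lemma bounded_linear_btrace: "bounded_linear btrace"
  unfolding btrace_def
  by (intro bounded_linear_sum bounded_linear_intros bounded_linear_inner_left_comp blinfun.bounded_linear_left)

lemma btrace_simps:
  "btrace (A + B) = btrace A + btrace B" "btrace (A - B) = btrace A - btrace B"
  "btrace (c *\<^sub>R A) = c * btrace A" "btrace 0 = 0" "btrace (id_blinfun :: 'a::euclidean_space \<Rightarrow>\<^sub>L 'a) = DIM('a)"
  by (simp_all add: btrace_def blinfun.bilinear_simps inner_add_left inner_diff_left sum.distrib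
      sum_subtractf sum_distrib_left dot_square_norm)

lemma btrace_orthonormal:
  assumes E: "orthonormal_set E" "span E = UNIV"
  shows "btrace L = (\<Sum>e\<in>E. L e \<bullet> e)"
proof -
  have "(\<Sum>b\<in>Basis. L b \<bullet> b) = (\<Sum>b\<in>Basis. \<Sum>e\<in>E. (b \<bullet> e) * (L b \<bullet> e))"
  proof (rule sum.cong[OF refl])
    fix b :: 'a
    have "L b \<bullet> b = L b \<bullet> (\<Sum>e\<in>E. (b \<bullet> e) *\<^sub>R e)"
      using orthonormal_expansion[OF E(1), of b] E(2) by simp
    then show "L b \<bullet> b = (\<Sum>e\<in>E. (b \<bullet> e) * (L b \<bullet> e))" by (simp add: inner_sum_right)
  qed
  also have "\<dots> = (\<Sum>e\<in>E. \<Sum>b\<in>Basis. (b \<bullet> e) * (L b \<bullet> e))" by (rule sum.swap)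
  also have "\<dots> = (\<Sum>e\<in>E. L e \<bullet> e)"
  proof (rule sum.cong[OF refl])
    fix e assume "e \<in> E"
    have "L e = L (\<Sum>b\<in>Basis. (e \<bullet> b) *\<^sub>R b)" by (simp add: euclidean_representation)
    also have "\<dots> = (\<Sum>b\<in>Basis. (e \<bullet> b) *\<^sub>R L b)" by (simp add: blinfun.sum_right blinfun.scaleR_right)
    finally show "(\<Sum>b\<in>Basis. (b \<bullet> e) * (L b \<bullet> e)) = L e \<bullet> e"
      by (simp add: inner_sum_left inner_commute[of e])
  qed
  finally show ?thesis by (simp add: btrace_def)
qed

text \<open>The Faddeev--LeVerrier recursion: \<open>op_esym m A\<close> is the elementary symmetric function of degree \<open>m\<close>
  of the eigenvalues of \<open>A\<close>.\<close>

primrec newton_op :: "nat \<Rightarrow> ('a::euclidean_space \<Rightarrow>\<^sub>L 'a) \<Rightarrow> ('a \<Rightarrow>\<^sub>L 'a)" where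
  "newton_op 0 A = id_blinfun"
| "newton_op (Suc m) A =
     (btrace ((newton_op m A o\<^sub>L A)) / real (Suc m)) *\<^sub>R id_blinfun - (newton_op m A o\<^sub>L A)"

definition op_esym :: "nat \<Rightarrow> ('a::euclidean_space \<Rightarrow>\<^sub>L 'a) \<Rightarrow> real" where
  "op_esym m A = (case m of 0 \<Rightarrow> 1 | Suc j \<Rightarrow> btrace ((newton_op j A o\<^sub>L A)) / real (Suc j))"

lemma op_esym_0: "op_esym 0 A = 1" and op_esym_Suc: "op_esym (Suc m) A = btrace ((newton_op m A o\<^sub>L A)) / real (Suc m)"
  by (simp_all add: op_esym_def)

lemma newton_op_Suc: "newton_op (Suc m) A = op_esym (Suc m) A *\<^sub>R id_blinfun - (newton_op m A o\<^sub>L A)"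
  by (simp add: op_esym_Suc)

text \<open>The derivative of \<^const>\<open>newton_op\<close> at \<open>A\<close> in direction \<open>H\<close>, with the derivative of
  \<open>op_esym (Suc m)\<close> already written as \<open>btrace (newton_op m A o\<^sub>L H)\<close>; this is correct only for
  symmetric \<open>A\<close>.\<close>

primrec newton_deriv :: "nat \<Rightarrow> ('a::euclidean_space \<Rightarrow>\<^sub>L 'a) \<Rightarrow> ('a \<Rightarrow>\<^sub>L 'a) \<Rightarrow> ('a \<Rightarrow>\<^sub>L 'a)" where
  "newton_deriv 0 A H = 0"
| "newton_deriv (Suc m) A H =
     btrace ((newton_op m A o\<^sub>L H)) *\<^sub>R id_blinfun - ((newton_deriv m A H o\<^sub>L A) + (newton_op m A o\<^sub>L H))"

locale eigenbasis =
  fixes A :: "'a::euclidean_space \<Rightarrow>\<^sub>L 'a" and E :: "'a set" and \<mu> :: "'a \<Rightarrow> real"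
  assumes orthonormal: "orthonormal_set E" and span_E: "span E = UNIV"
    and eigen: "\<And>e. e \<in> E \<Longrightarrow> A e = \<mu> e *\<^sub>R e"
begin

lemma finite_E: "finite E" by (rule orthonormal_set_finite[OF orthonormal])

lemma inner_E: "e \<in> E \<Longrightarrow> f \<in> E \<Longrightarrow> e \<bullet> f = (if e = f then 1 else 0)"
  by (rule orthonormal_set_inner[OF orthonormal])

lemma expand: "v = (\<Sum>e\<in>E. (v \<bullet> e) *\<^sub>R e)"
  using orthonormal_expansion[OF orthonormal] span_E by blast

lemma btrace_E: "btrace L = (\<Sum>e\<in>E. L e \<bullet> e)"
  by (rule btrace_orthonormal[OF orthonormal span_E])

text \<open>On an eigenvector the recursion is the deletion of one variable,
  \<open>esym_remove\<close>, and its trace is \<open>sum_esym_remove\<close>. The claims are proved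
  jointly because each step of the recursion contains a trace.\<close>

lemma newton_op_eigen:
  "(\<forall>e\<in>E. newton_op m A e = esym (E - {e}) \<mu> m *\<^sub>R e) \<and> op_esym (Suc m) A = esym E \<mu> (Suc m)"
proof (induction m)
  case 0
  have "btrace (id_blinfun o\<^sub>L A) = (\<Sum>e\<in>E. \<mu> e * esym (E - {e}) \<mu> 0)"
    unfolding btrace_E using finite_E
    by (intro sum.cong) (auto simp: eigen inner_E esym_0)
  also have "\<dots> = esym E \<mu> (Suc 0)" using sum_esym_remove[OF finite_E, of \<mu> 0] by simp
  finally show ?case using finite_E by (simp add: op_esym_Suc esym_0)
next
  case (Suc m)
  have T: "newton_op (Suc m) A e = esym (E - {e}) \<mu> (Suc m) *\<^sub>R e" if "e \<in> E" for e
    unfolding newton_op_Suc using Suc that esym_remove[OF finite_E that, of \<mu> m]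
    by (simp add: blinfun.bilinear_simps eigen flip: scaleR_diff_left)
  have "btrace ((newton_op (Suc m) A o\<^sub>L A)) = (\<Sum>e\<in>E. \<mu> e * esym (E - {e}) \<mu> (Suc m))"
    unfolding btrace_E
    by (rule sum.cong[OF refl]) (simp add: eigen T blinfun.scaleR_right inner_E del: newton_op.simps)
  then have "op_esym (Suc (Suc m)) A = esym E \<mu> (Suc (Suc m))"
    unfolding op_esym_Suc sum_esym_remove[OF finite_E] by simp
  then show ?case using T by blast
qed

lemma newton_op_E: "e \<in> E \<Longrightarrow> newton_op m A e = esym (E - {e}) \<mu> m *\<^sub>R e"
  using newton_op_eigen by blast

lemma op_esym_E: "op_esym m A = esym E \<mu> m"
  using newton_op_eigen finite_E by (cases m) (auto simp: op_esym_0 esym_0)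

lemma newton_op_inner: "newton_op m A v \<bullet> w = (\<Sum>e\<in>E. esym (E - {e}) \<mu> m * (v \<bullet> e) * (w \<bullet> e))"
proof -
  have "newton_op m A v \<bullet> w = newton_op m A (\<Sum>e\<in>E. (v \<bullet> e) *\<^sub>R e) \<bullet> w" using expand[of v] by simp
  also have "\<dots> = (\<Sum>e\<in>E. esym (E - {e}) \<mu> m * (v \<bullet> e) * (w \<bullet> e))"
    by (simp add: blinfun.sum_right blinfun.scaleR_right newton_op_E inner_sum_left inner_commute[of w] mult_ac)
  finally show ?thesis .
qed

lemma newton_op_sym: "newton_op m A v \<bullet> w = newton_op m A w \<bullet> v"
  unfolding newton_op_inner by (simp add: mult_ac)

lemma btrace_newton_op: "btrace (newton_op m A) = (real DIM('a) - real m) * op_esym m A"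
proof (cases m)
  case 0
  then show ?thesis by (simp add: btrace_simps op_esym_0)
next
  case (Suc j)
  have "btrace ((newton_op j A o\<^sub>L A)) = real (Suc j) * op_esym (Suc j) A" by (simp add: op_esym_Suc)
  then show ?thesis by (simp add: Suc newton_op_Suc btrace_simps algebra_simps del: newton_op.simps)
qed

text \<open>Diagonal entries suffice, as the derivative will be traced against A, which is diagonal
  in E. Omitting e and differentiating with respect to the variable of f deletes both.\<close>

lemma newton_deriv_inner:
  assumes "e \<in> E"
  shows "newton_deriv (Suc m) A H e \<bullet> e = (\<Sum>f\<in>E - {e}. esym (E - {f} - {e}) \<mu> m * (H f \<bullet> f))"
  using assms
proof (induction m arbitrary: e)
  case 0
  have "btrace (id_blinfun o\<^sub>L H) = H e \<bullet> e + (\<Sum>f\<in>E - {e}. H f \<bullet> f)"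
    unfolding btrace_E using sum.remove[OF finite_E 0, of "\<lambda>f. H f \<bullet> f"] by simp
  then show ?case using 0 finite_E by (simp add: blinfun.bilinear_simps inner_E inner_diff_left esym_0)
next
  case (Suc m)
  have TH: "newton_op j A (H e) \<bullet> e = esym (E - {e}) \<mu> j * (H e \<bullet> e)" if "e \<in> E" for e j
    using newton_op_sym[of j "H e" e] newton_op_E[OF that] by (simp add: inner_commute)
  have rem: "esym (E - {f}) \<mu> (Suc m) - \<mu> e * esym (E - {f} - {e}) \<mu> m = esym (E - {f} - {e}) \<mu> (Suc m)"
    if "f \<in> E - {e}" for f
    using esym_remove[of "E - {f}" e \<mu> m] finite_E Suc.prems that by auto
  have "newton_deriv (Suc (Suc m)) A H e \<bullet> e =
      (\<Sum>f\<in>E. esym (E - {f}) \<mu> (Suc m) * (H f \<bullet> f))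
        - (\<mu> e * (\<Sum>f\<in>E - {e}. esym (E - {f} - {e}) \<mu> m * (H f \<bullet> f)) + esym (E - {e}) \<mu> (Suc m) * (H e \<bullet> e))"
    unfolding newton_deriv.simps(2)[of "Suc m"] using Suc.prems Suc.IH[OF Suc.prems]
    by (simp add: blinfun.bilinear_simps inner_diff_left inner_add_left eigen inner_E btrace_E TH
        del: newton_deriv.simps newton_op.simps)
  also have "\<dots> = (\<Sum>f\<in>E - {e}. esym (E - {f}) \<mu> (Suc m) * (H f \<bullet> f) - \<mu> e * (esym (E - {f} - {e}) \<mu> m * (H f \<bullet> f)))"
    unfolding sum.remove[OF finite_E Suc.prems] sum_distrib_left by (simp add: sum_subtractf)
  also have "\<dots> = (\<Sum>f\<in>E - {e}. esym (E - {f} - {e}) \<mu> (Suc m) * (H f \<bullet> f))"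
    by (rule sum.cong[OF refl]) (simp add: rem[symmetric] left_diff_distrib mult.assoc)
  finally show ?case .
qed

text \<open>The trace is a double sum over pairs of distinct eigenvectors; summing one of them out
  with \<open>sum_esym_remove\<close> leaves the factor m. Thereby the product rule for
  \<open>op_esym (Suc m)\<close> collapses to the single term
  \<open>btrace (newton_op m A o\<^sub>L H)\<close>.\<close>

lemma btrace_newton_deriv: "btrace ((newton_deriv m A H o\<^sub>L A)) = real m * btrace ((newton_op m A o\<^sub>L H))"
proof (cases m)
  case 0
  then show ?thesis by (simp add: btrace_simps)
next
  case (Suc j)
  have TH: "newton_op m A (H e) \<bullet> e = esym (E - {e}) \<mu> m * (H e \<bullet> e)" if "e \<in> E" for e
    using newton_op_sym[of m "H e" e] newton_op_E[OF that] by (simp add: inner_commute)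
  have "btrace ((newton_deriv m A H o\<^sub>L A)) =
      (\<Sum>e\<in>E. \<Sum>f\<in>E. if f = e then 0 else \<mu> e * (esym (E - {f} - {e}) \<mu> j * (H f \<bullet> f)))"
    unfolding btrace_E
  proof (rule sum.cong[OF refl])
    fix e assume e: "e \<in> E"
    have "blinfun_apply ((newton_deriv m A H o\<^sub>L A)) e \<bullet> e =
       \<mu> e * (\<Sum>f\<in>E - {e}. esym (E - {f} - {e}) \<mu> j * (H f \<bullet> f))"
      using newton_deriv_inner[OF e, of j H]
      by (simp add: Suc eigen[OF e] blinfun.scaleR_right del: newton_deriv.simps)
    also have "\<dots> = (\<Sum>f\<in>E. if f = e then 0 else \<mu> e * (esym (E - {f} - {e}) \<mu> j * (H f \<bullet> f)))"
      unfolding sum_distrib_left using finite_E by (intro sum.mono_neutral_cong_left) auto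
    finally show "blinfun_apply ((newton_deriv m A H o\<^sub>L A)) e \<bullet> e = \<dots>" .
  qed
  also have "\<dots> = (\<Sum>f\<in>E. \<Sum>e\<in>E. if f = e then 0 else \<mu> e * (esym (E - {f} - {e}) \<mu> j * (H f \<bullet> f)))"
    by (rule sum.swap)
  also have "\<dots> = (\<Sum>f\<in>E. real m * (esym (E - {f}) \<mu> m * (H f \<bullet> f)))"
  proof (rule sum.cong[OF refl])
    fix f assume f: "f \<in> E"
    have "(\<Sum>e\<in>E. if f = e then 0 else \<mu> e * (esym (E - {f} - {e}) \<mu> j * (H f \<bullet> f))) =
      (\<Sum>e\<in>E - {f}. \<mu> e * (esym (E - {f} - {e}) \<mu> j * (H f \<bullet> f)))"
      using finite_E by (intro sum.mono_neutral_cong_right) auto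
    also have "\<dots> = (\<Sum>e\<in>E - {f}. \<mu> e * esym (E - {f} - {e}) \<mu> j) * (H f \<bullet> f)"
      by (simp add: sum_distrib_right mult.assoc)
    also have "\<dots> = real m * (esym (E - {f}) \<mu> m * (H f \<bullet> f))"
      using finite_E by (subst sum_esym_remove) (auto simp: Suc)
    finally show "(\<Sum>e\<in>E. if f = e then 0 else \<mu> e * (esym (E - {f} - {e}) \<mu> j * (H f \<bullet> f))) = \<dots>" .
  qed
  also have "\<dots> = real m * btrace ((newton_op m A o\<^sub>L H))"
    unfolding btrace_E sum_distrib_left by (rule sum.cong[OF refl]) (simp add: TH)
  finally show ?thesis .
qed

lemma op_esym_has_derivative_aux:
  assumes "(newton_op m has_derivative newton_deriv m A) (at A)"
  shows "(op_esym (Suc m) has_derivative (\<lambda>H. btrace ((newton_op m A o\<^sub>L H)))) (at A)"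
proof -
  have "((\<lambda>B. btrace ((newton_op m B o\<^sub>L B)) / real (Suc m)) has_derivative
     (\<lambda>H. btrace ((newton_op m A o\<^sub>L H) + (newton_deriv m A H o\<^sub>L A)) / real (Suc m))) (at A)"
    by (auto intro!: derivative_eq_intros bounded_linear.has_derivative[OF bounded_linear_btrace]
        assms bounded_bilinear.FDERIV[OF bounded_bilinear_blinfun_compose])
  moreover have "btrace ((newton_op m A o\<^sub>L H) + (newton_deriv m A H o\<^sub>L A)) / real (Suc m) = btrace ((newton_op m A o\<^sub>L H))" for H
    unfolding btrace_simps btrace_newton_deriv by (simp add: field_simps)
  ultimately show ?thesis by (simp add: op_esym_Suc[abs_def])
qed

lemma newton_op_has_derivative: "(newton_op m has_derivative newton_deriv m A) (at A)"
proof (induction m)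
  case 0
  then show ?case by (simp add: fun_eq_iff[symmetric])
next
  case (Suc m)
  have "((\<lambda>B. op_esym (Suc m) B *\<^sub>R id_blinfun - (newton_op m B o\<^sub>L B)) has_derivative
     (\<lambda>H. btrace ((newton_op m A o\<^sub>L H)) *\<^sub>R id_blinfun - ((newton_op m A o\<^sub>L H) + (newton_deriv m A H o\<^sub>L A)))) (at A)"
    by (auto intro!: derivative_eq_intros op_esym_has_derivative_aux
        Suc bounded_bilinear.FDERIV[OF bounded_bilinear_blinfun_compose])
  then show ?case by (simp add: newton_op_Suc[abs_def] add.commute del: newton_op.simps(2))
qed

lemma op_esym_has_derivative:
  "(op_esym (Suc m) has_derivative (\<lambda>H. btrace ((newton_op m A o\<^sub>L H)))) (at A)"
  by (rule op_esym_has_derivative_aux[OF newton_op_has_derivative])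

end

text \<open>Newton transformations of a Hessian are divergence free: \<open>H b\<close> stands for the derivative of
  the Hessian \<open>A\<close> in direction \<open>b\<close>, and \<open>sym\<close> is the Codazzi symmetry.\<close>

lemma newton_deriv_div:
  fixes A :: "'a::euclidean_space \<Rightarrow>\<^sub>L 'a" and H :: "'a \<Rightarrow> ('a \<Rightarrow>\<^sub>L 'a)"
  assumes sym: "\<And>v w. H v w = H w v"
  shows "(\<Sum>b\<in>Basis. newton_deriv m A (H b) v \<bullet> b) = 0"
proof (induction m arbitrary: v)
  case 0
  then show ?case by simp
next
  case (Suc m)
  have lin: "linear (\<lambda>u. btrace ((newton_op m A o\<^sub>L H u)))"
  proof -
    have "btrace ((newton_op m A o\<^sub>L H u)) = (\<Sum>b\<in>Basis. newton_op m A (H b u) \<bullet> b)" for u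
      by (simp add: btrace_def sym[of u])
    then show ?thesis
      by (simp add: linear_iff blinfun.bilinear_simps inner_add_left sum.distrib sum_distrib_left)
  qed
  have "(\<Sum>b\<in>Basis. newton_deriv (Suc m) A (H b) v \<bullet> b) =
     (\<Sum>b\<in>Basis. btrace ((newton_op m A o\<^sub>L H b)) * (v \<bullet> b)) - (\<Sum>b\<in>Basis. newton_deriv m A (H b) (A v) \<bullet> b)
       - (\<Sum>b\<in>Basis. newton_op m A (H b v) \<bullet> b)"
    by (simp add: blinfun.bilinear_simps inner_diff_left inner_add_left sum_subtractf sum.distrib)
  also have "(\<Sum>b\<in>Basis. btrace ((newton_op m A o\<^sub>L H b)) * (v \<bullet> b)) = btrace ((newton_op m A o\<^sub>L H v))"
  proof -
    have "btrace ((newton_op m A o\<^sub>L H v)) = btrace (newton_op m A o\<^sub>L H (\<Sum>b\<in>Basis. (v \<bullet> b) *\<^sub>R b))"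
      by (simp add: euclidean_representation)
    also have "\<dots> = (\<Sum>b\<in>Basis. (v \<bullet> b) * btrace ((newton_op m A o\<^sub>L H b)))"
      by (subst linear_sum[OF lin], subst linear_scale[OF lin]) simp
    finally show ?thesis by (simp add: mult.commute)
  qed
  also have "(\<Sum>b\<in>Basis. newton_op m A (H b v) \<bullet> b) = btrace ((newton_op m A o\<^sub>L H v))"
    by (simp add: btrace_def sym[of v])
  finally show ?case using Suc.IH by simp
qed

section \<open>The weighted Minkowski identity\<close>

lemma integral_translation_lborel:
  fixes g :: "'a::euclidean_space \<Rightarrow> real"
  assumes "integrable lborel g"
  shows "integrable lborel (\<lambda>x. g (c + x))" "(LINT x|lborel. g (c + x)) = (LINT x|lborel. g x)"
proof -
  have g: "g \<in> borel_measurable borel" using assms by (simp add: borel_measurable_integrable)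
  have "(LINT x|distr lborel borel ((+) c). g x) = (LINT x|lborel. g (c + x))"
    by (rule integral_distr) (use g in auto)
  then show "(LINT x|lborel. g (c + x)) = (LINT x|lborel. g x)" by (simp add: lborel_distr_plus)
  have "integrable (distr lborel borel ((+) c)) g" using assms by (simp add: lborel_distr_plus)
  then show "integrable lborel (\<lambda>x. g (c + x))" by (subst (asm) integrable_distr_eq) (use g in auto)
qed

lemma integrable_compact_support:
  fixes g :: "'a::euclidean_space \<Rightarrow> real"
  assumes "compact C" "continuous_on UNIV g" "\<And>x. x \<notin> C \<Longrightarrow> g x = 0"
  shows "integrable lborel g"
proof -
  have "integrable lborel (\<lambda>x. indicator C x *\<^sub>R g x)"
    by (rule borel_integrable_compact) (use assms continuous_on_subset[OF assms(2)] in auto)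
  moreover have "(\<lambda>x. indicator C x *\<^sub>R g x) = g" using assms(3) by (auto simp: indicator_def fun_eq_iff)
  ultimately show ?thesis by simp
qed

text \<open>Difference quotients integrate to zero by translation invariance, and they converge
  boundedly with supports in one compact set.\<close>

lemma integral_directional_derivative_zero:
  fixes g :: "'a::euclidean_space \<Rightarrow> real"
  assumes C: "compact C" and g: "\<And>x. (g has_derivative g' x) (at x)" and g0: "\<And>x. x \<notin> C \<Longrightarrow> g x = 0"
    and cont: "continuous_on UNIV (\<lambda>x. g' x b)"
  shows "integrable lborel (\<lambda>x. g' x b)" "(LINT x|lborel. g' x b) = 0"
proof -
  have g'0: "g' x b = 0" if "x \<notin> C" for x
  proof -
    have "open (- C)" using C by (simp add: compact_imp_closed open_Compl)
    have "(g has_derivative (\<lambda>v. 0)) (at x)"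
      by (rule has_derivative_transform_within_open[OF has_derivative_const[of 0] \<open>open (- C)\<close>])
        (use that g0 in auto)
    then show ?thesis using g has_derivative_unique by metis
  qed
  show int: "integrable lborel (\<lambda>x. g' x b)"
    by (rule integrable_compact_support[OF C cont g'0])
  have contg: "continuous_on UNIV g"
    using g by (meson continuous_at_imp_continuous_on has_derivative_continuous)
  have intg: "integrable lborel g" by (rule integrable_compact_support[OF C contg g0])
  have "bounded ((\<lambda>x. g' x b) ` C)"
    using compact_continuous_image[OF continuous_on_subset[OF cont]] C compact_imp_bounded by blast
  then obtain B0 where B0: "\<And>x. x \<in> C \<Longrightarrow> \<bar>g' x b\<bar> \<le> B0" by (auto simp: bounded_iff)
  define B where "B = max B0 0"
  have B: "\<bar>g' x b\<bar> \<le> B" for x using B0[of x] g'0[of x] by (cases "x \<in> C") (auto simp: B_def)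
  \<comment> \<open>All points from which a shift by at most one copy of b can reach C; the steps
    \<open>1 / Suc j\<close> never exceed 1.\<close>
  let ?D = "(\<lambda>p. fst p - snd p *\<^sub>R b) ` (C \<times> {0..1::real})"
  have D: "compact ?D" using C by (intro compact_continuous_image continuous_intros compact_Times) auto
  define s where "s j x = real (Suc j) * (g ((1 / real (Suc j)) *\<^sub>R b + x) - g x)" for j x
  have line: "((\<lambda>t. g (t *\<^sub>R b + x)) has_real_derivative g' (t *\<^sub>R b + x) b) (at t)" for t x
  proof -
    have "((\<lambda>t. g (t *\<^sub>R b + x)) has_derivative (\<lambda>h. g' (t *\<^sub>R b + x) (h *\<^sub>R b))) (at t)"
      by (rule has_derivative_compose[OF _ g]) (auto intro!: derivative_eq_intros)
    moreover have "g' y (h *\<^sub>R b) = g' y b * h" for y h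
      using has_derivative_linear[OF g] linear_scale by (metis mult.commute real_scaleR_def)
    ultimately show ?thesis by (simp add: has_field_derivative_def)
  qed
  have bound: "norm (s j x) \<le> B * indicator ?D x" for j x
  proof (cases "x \<in> ?D")
    case True
    obtain z where "z > 0" "z < 1 / real (Suc j)"
      "g ((1 / real (Suc j)) *\<^sub>R b + x) - g (0 *\<^sub>R b + x) = (1 / real (Suc j) - 0) * g' (z *\<^sub>R b + x) b"
      using MVT2[of 0 "1 / real (Suc j)" "\<lambda>t. g (t *\<^sub>R b + x)" "\<lambda>t. g' (t *\<^sub>R b + x) b"] line by auto
    then have "s j x = g' (z *\<^sub>R b + x) b" by (simp add: s_def)
    then show ?thesis using B True by simp
  next
    case False
    have "x \<notin> C" using False by (force intro: image_eqI[where x="(x, 0)"])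
    moreover have "(1 / real (Suc j)) *\<^sub>R b + x \<notin> C"
    proof
      assume "(1 / real (Suc j)) *\<^sub>R b + x \<in> C"
      then have "x \<in> ?D" by (intro image_eqI[where x="((1 / real (Suc j)) *\<^sub>R b + x, 1 / real (Suc j))"]) auto
      then show False using False by simp
    qed
    ultimately show ?thesis using g0 False by (simp add: s_def)
  qed
  have lim: "(\<lambda>j. s j x) \<longlonglongrightarrow> g' x b" for x
  proof -
    have "((\<lambda>h. (g (h *\<^sub>R b + x) - g x) / h) \<longlongrightarrow> g' x b) (at 0)"
      using line[of x 0] by (simp add: has_field_derivative_iff)
    moreover have "filterlim (\<lambda>j. 1 / real (Suc j)) (at 0) sequentially"
      unfolding filterlim_at using LIMSEQ_inverse_real_of_nat by (auto simp: inverse_eq_divide)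
    ultimately have "(\<lambda>j. (g ((1 / real (Suc j)) *\<^sub>R b + x) - g x) / (1 / real (Suc j))) \<longlonglongrightarrow> g' x b"
      by (rule filterlim_compose)
    then show ?thesis by (simp add: s_def mult.commute)
  qed
  have tr: "integrable lborel (\<lambda>x. g (c + x))" "(LINT x|lborel. g (c + x)) = (LINT x|lborel. g x)" for c
    using integral_translation_lborel[OF intg] by auto
  have s0: "(LINT x|lborel. s j x) = 0" for j
    unfolding s_def by (simp add: tr intg)
  have "(\<lambda>j. LINT x|lborel. s j x) \<longlonglongrightarrow> (LINT x|lborel. g' x b)"
  proof (rule integral_dominated_convergence[where w="\<lambda>x. B * indicator ?D x"])
    show "(\<lambda>x. g' x b) \<in> borel_measurable lborel" using int by (rule borel_measurable_integrable)
    show "s j \<in> borel_measurable lborel" for j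
      unfolding s_def[abs_def] using tr(1)[THEN borel_measurable_integrable] intg[THEN borel_measurable_integrable]
      by (intro borel_measurable_times borel_measurable_diff) auto
    show "integrable lborel (\<lambda>x. B * indicator ?D x :: real)"
      using D borel_compact emeasure_compact_finite by (intro integrable_mult_right integrable_real_indicator) auto
  qed (use lim bound in auto)
  then show "(LINT x|lborel. g' x b) = 0" unfolding s0 by (simp add: LIMSEQ_const_iff)
qed

text \<open>Off C the field vanishes locally, so its derivative extends from U by zero; the
  extension is continuous because U and the complement of C form an open cover. The indicator
  discards the values of \<open>V'\<close> outside U.\<close>

lemma integral_divergence_zero:
  fixes V :: "'a::euclidean_space \<Rightarrow> 'a"
  assumes C: "compact C" and U: "open U" "C \<subseteq> U"
    and V: "\<And>x. x \<in> U \<Longrightarrow> (V has_derivative V' x) (at x)" and V0: "\<And>x. x \<notin> C \<Longrightarrow> V x = 0"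
    and cont: "\<And>b. continuous_on U (\<lambda>x. V' x b)"
  shows "integrable lborel (\<lambda>x. indicator C x * (\<Sum>b\<in>Basis. V' x b \<bullet> b))"
    "(LINT x|lborel. indicator C x * (\<Sum>b\<in>Basis. V' x b \<bullet> b)) = 0"
proof -
  define G where "G x v = (if x \<in> U then V' x v else 0)" for x v
  have open2: "open (- C)" using C by (simp add: compact_imp_closed open_Compl)
  have out: "(V has_derivative (\<lambda>v. 0)) (at x)" if "x \<notin> C" for x
    by (rule has_derivative_transform_within_open[OF has_derivative_const[of 0] open2])
      (use that V0 in auto)
  have G: "(V has_derivative G x) (at x)" for x
  proof (cases "x \<in> U")
    case True
    then have "G x = V' x" by (auto simp: G_def)
    then show ?thesis using V True by simp
  next
    case False
    then have "G x = (\<lambda>v. 0)" by (auto simp: G_def)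
    then show ?thesis using out[of x] False U by auto
  qed
  have G0: "G x v = 0" if "x \<notin> C" for x v
    using has_derivative_unique[OF G out[OF that]] by simp
  have contG: "continuous_on UNIV (\<lambda>x. G x b)" for b
  proof -
    have "continuous_on (U \<union> - C) (\<lambda>x. G x b)"
    proof (rule continuous_on_open_Un[OF U(1) open2])
      show "continuous_on U (\<lambda>x. G x b)"
        using cont[of b] by (rule continuous_on_eq) (simp add: G_def)
      show "continuous_on (- C) (\<lambda>x. G x b)"
        by (rule continuous_on_eq[OF continuous_on_const[of _ 0]]) (simp add: G0)
    qed
    moreover have "U \<union> - C = UNIV" using U by auto
    ultimately show ?thesis by simp
  qed
  have comp: "integrable lborel (\<lambda>x. G x b \<bullet> b)" "(LINT x|lborel. G x b \<bullet> b) = 0" for b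
  proof -
    have "continuous_on UNIV (\<lambda>x. G x b \<bullet> b)" by (intro continuous_intros contG)
    then show "integrable lborel (\<lambda>x. G x b \<bullet> b)" "(LINT x|lborel. G x b \<bullet> b) = 0"
      using integral_directional_derivative_zero[OF C, of "\<lambda>x. V x \<bullet> b" "\<lambda>x v. G x v \<bullet> b" b]
        has_derivative_inner_left[OF G] V0 by auto
  qed
  have eq: "indicator C x * (\<Sum>b\<in>Basis. V' x b \<bullet> b) = (\<Sum>b\<in>Basis. G x b \<bullet> b)" for x
    using U G0 by (cases "x \<in> C") (auto simp: G_def)
  show "integrable lborel (\<lambda>x. indicator C x * (\<Sum>b\<in>Basis. V' x b \<bullet> b))"
    "(LINT x|lborel. indicator C x * (\<Sum>b\<in>Basis. V' x b \<bullet> b)) = 0"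
    unfolding eq using comp by simp_all
qed

lemma has_derivative_remainder:
  fixes g :: "'a::real_normed_vector \<Rightarrow> 'b::real_normed_vector"
  assumes "(g has_derivative D) (at x)" "e > 0"
  obtains d where "d > 0" "\<And>y. norm (y - x) < d \<Longrightarrow> norm (g y - g x - D (y - x)) \<le> e * norm (y - x)"
  using assms unfolding has_derivative_at_alt by metis

lemma in_ball_translate: "x + v \<in> ball x r \<longleftrightarrow> norm v < r" for x :: "'a::real_normed_vector"
  using dist_commute[of x "x + v"] by (simp only: mem_ball dist_norm add_diff_cancel_left')

text \<open>The second difference divided by \<open>s\<^sup>2\<close> tends to both mixed
  derivatives as soon as the gradient is differentiable at the single point x.\<close>

lemma symmetric_second_derivative:
  fixes f :: "'a::euclidean_space \<Rightarrow> real" and g :: "'a \<Rightarrow> 'a"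
  assumes S: "open S" "x \<in> S" and f: "\<And>y. y \<in> S \<Longrightarrow> (f has_derivative (\<lambda>v. g y \<bullet> v)) (at y)"
    and g: "(g has_derivative D) (at x)"
  shows "D v \<bullet> w = D w \<bullet> v"
proof -
  have lin: "linear D" using g by (rule has_derivative_linear)
  obtain r where r: "r > 0" "ball x r \<subseteq> S" using S open_contains_ball by blast
  \<comment> \<open>the second difference of \<open>f\<close> along \<open>v\<close> and \<open>w\<close>, which is symmetric in \<open>v\<close> and \<open>w\<close>\<close>
  define \<Delta> where "\<Delta> s = f (x + s *\<^sub>R v + s *\<^sub>R w) - f (x + s *\<^sub>R v) - f (x + s *\<^sub>R w) + f x" for s
  define M where "M = norm v + norm w + 1"
  have M: "M > 0" by (simp add: M_def add_nonneg_pos)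
  have key: "\<exists>d>0. \<forall>s. 0 < s \<and> s < d \<longrightarrow>
      \<bar>f (x + s *\<^sub>R a + s *\<^sub>R c) - f (x + s *\<^sub>R a) - f (x + s *\<^sub>R c) + f x - s\<^sup>2 * (D c \<bullet> a)\<bar> \<le> s\<^sup>2 * e"
    if e: "e > 0" and ac: "norm a + norm c < M" for e a c
  proof -
    \<comment> \<open>The tolerance is divided by \<open>2 M\<^sup>2\<close>: two remainders are
      added, each at most the tolerance times \<open>s M\<close>, and the inner product with a costs
      another factor M.\<close>
    obtain d where d: "d > 0" "\<And>y. norm (y - x) < d \<Longrightarrow> norm (g y - g x - D (y - x)) \<le> e / (2 * M\<^sup>2) * norm (y - x)"
      using has_derivative_remainder[OF g, of "e / (2 * M\<^sup>2)"] e M by auto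
    have small: "norm (t *\<^sub>R a + q *\<^sub>R c) < min r d" "norm (t *\<^sub>R a + q *\<^sub>R c) \<le> s * M"
      if "0 < s" "s < min r d / M" "0 \<le> t" "t \<le> s" "0 \<le> q" "q \<le> s" for s t q
    proof -
      have "norm (t *\<^sub>R a + q *\<^sub>R c) \<le> t * norm a + q * norm c"
        using that norm_triangle_ineq[of "t *\<^sub>R a" "q *\<^sub>R c"] by simp
      also have "\<dots> \<le> s * norm a + s * norm c" using that by (intro add_mono mult_right_mono) auto
      also have "\<dots> \<le> s * M" using ac that by (simp flip: distrib_left)
      finally show "norm (t *\<^sub>R a + q *\<^sub>R c) \<le> s * M" .
      also have "\<dots> < min r d" using that(2) M by (simp only: less_divide_eq)
      finally show "norm (t *\<^sub>R a + q *\<^sub>R c) < min r d" .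
    qed
    have "\<bar>f (x + s *\<^sub>R a + s *\<^sub>R c) - f (x + s *\<^sub>R a) - f (x + s *\<^sub>R c) + f x - s\<^sup>2 * (D c \<bullet> a)\<bar> \<le> s\<^sup>2 * e"
      if s: "0 < s" "s < min r d / M" for s
    proof -
      let ?F = "\<lambda>t. f (x + (t *\<^sub>R a + s *\<^sub>R c)) - f (x + (t *\<^sub>R a + 0 *\<^sub>R c))"
      have derf: "((\<lambda>t. f (x + (t *\<^sub>R a + q *\<^sub>R c))) has_real_derivative g (x + (t *\<^sub>R a + q *\<^sub>R c)) \<bullet> a) (at t)"
        if "0 \<le> t" "t \<le> s" "0 \<le> q" "q \<le> s" for t q
      proof -
        have "x + (t *\<^sub>R a + q *\<^sub>R c) \<in> S"
          using small(1)[OF s that] by (intro subsetD[OF r(2)]) (simp only: in_ball_translate min_less_iff_conj)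
        then have "((\<lambda>t. f (x + (t *\<^sub>R a + q *\<^sub>R c))) has_derivative (\<lambda>h. g (x + (t *\<^sub>R a + q *\<^sub>R c)) \<bullet> (h *\<^sub>R a))) (at t)"
          by (intro has_derivative_compose[OF _ f]) (auto intro!: derivative_eq_intros)
        then show ?thesis by (simp add: has_field_derivative_def mult_commute_abs)
      qed
      have dF: "(?F has_real_derivative
          (g (x + (t *\<^sub>R a + s *\<^sub>R c)) \<bullet> a - g (x + (t *\<^sub>R a + 0 *\<^sub>R c)) \<bullet> a)) (at t)"
        if "0 \<le> t" "t \<le> s" for t
        by (rule DERIV_diff[OF derf derf]) (use that s in auto)
      obtain z where z: "z > 0" "z < s" "?F s - ?F 0 = (s - 0) *
          (g (x + (z *\<^sub>R a + s *\<^sub>R c)) \<bullet> a - g (x + (z *\<^sub>R a + 0 *\<^sub>R c)) \<bullet> a)"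
        using MVT2[OF s(1) dF] by auto
      have rem: "norm (g (x + (z *\<^sub>R a + q *\<^sub>R c)) - g x - D (z *\<^sub>R a + q *\<^sub>R c)) \<le> e / (2 * M\<^sup>2) * (s * M)"
        if "0 \<le> q" "q \<le> s" for q
      proof -
        have "norm (g (x + (z *\<^sub>R a + q *\<^sub>R c)) - g x - D (z *\<^sub>R a + q *\<^sub>R c)) \<le>
            e / (2 * M\<^sup>2) * norm (z *\<^sub>R a + q *\<^sub>R c)"
          using d(2)[of "x + (z *\<^sub>R a + q *\<^sub>R c)"] small(1)[OF s _ _ that, of z] z by simp
        also have "\<dots> \<le> e / (2 * M\<^sup>2) * (s * M)"
          using small(2)[OF s _ _ that, of z] z e M by (intro mult_left_mono) auto
        finally show ?thesis .
      qed
      define R where "R = g (x + (z *\<^sub>R a + s *\<^sub>R c)) - g (x + (z *\<^sub>R a + 0 *\<^sub>R c)) - D (s *\<^sub>R c)"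
      let ?R = "\<lambda>q. g (x + (z *\<^sub>R a + q *\<^sub>R c)) - g x - D (z *\<^sub>R a + q *\<^sub>R c)"
      have "R = ?R s - ?R 0" by (simp add: R_def linear_add[OF lin] linear_0[OF lin])
      then have "norm R \<le> norm (?R s) + norm (?R 0)" by (metis norm_triangle_ineq4)
      also have "\<dots> \<le> e / (2 * M\<^sup>2) * (s * M) + e / (2 * M\<^sup>2) * (s * M)"
        using s by (intro add_mono rem) auto
      also have "\<dots> = e * s / M" using M by (simp add: power2_eq_square field_simps)
      finally have nR: "norm R \<le> e * s / M" .
      have "\<bar>R \<bullet> a\<bar> \<le> norm R * norm a" by (rule Cauchy_Schwarz_ineq2)
      also have "\<dots> \<le> e * s / M * M" using nR ac e s M by (intro mult_mono) (auto intro: less_imp_le order_trans[OF _ less_imp_le[OF ac]])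
      finally have Ra: "\<bar>R \<bullet> a\<bar> \<le> e * s" using M by simp
      have "f (x + s *\<^sub>R a + s *\<^sub>R c) - f (x + s *\<^sub>R a) - f (x + s *\<^sub>R c) + f x - s\<^sup>2 * (D c \<bullet> a) = s * (R \<bullet> a)"
        using z(3) by (simp add: R_def inner_diff_left linear_scale[OF lin] power2_eq_square algebra_simps)
      also have "\<bar>\<dots>\<bar> \<le> s * (e * s)" using Ra s by (simp add: abs_mult)
      finally show ?thesis by (simp add: power2_eq_square mult_ac)
    qed
    moreover have "min r d / M > 0" using r d M by simp
    ultimately show ?thesis by blast
  qed
  have "\<bar>D v \<bullet> w - D w \<bullet> v\<bar> \<le> 2 * e" if e: "e > 0" for e
  proof -
    obtain d1 where d1: "d1 > 0" "\<And>s. 0 < s \<Longrightarrow> s < d1 \<Longrightarrow> \<bar>\<Delta> s - s\<^sup>2 * (D w \<bullet> v)\<bar> \<le> s\<^sup>2 * e"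
      using key[OF e, of v w] by (auto simp: \<Delta>_def M_def)
    obtain d2 where d2: "d2 > 0" "\<And>s. 0 < s \<Longrightarrow> s < d2 \<Longrightarrow> \<bar>\<Delta> s - s\<^sup>2 * (D v \<bullet> w)\<bar> \<le> s\<^sup>2 * e"
      using key[OF e, of w v] by (auto simp: \<Delta>_def M_def add_ac algebra_simps)
    define s where "s = min d1 d2 / 2"
    have s: "0 < s" "s < d1" "s < d2" using d1(1) d2(1) by (auto simp: s_def)
    have "\<bar>s\<^sup>2 * (D v \<bullet> w) - s\<^sup>2 * (D w \<bullet> v)\<bar> \<le> s\<^sup>2 * e + s\<^sup>2 * e"
      using d1(2)[OF s(1,2)] d2(2)[OF s(1,3)] by linarith
    moreover have "s\<^sup>2 * \<bar>D v \<bullet> w - D w \<bullet> v\<bar> = \<bar>s\<^sup>2 * (D v \<bullet> w) - s\<^sup>2 * (D w \<bullet> v)\<bar>"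
      by (simp add: abs_mult flip: right_diff_distrib)
    ultimately have "s\<^sup>2 * \<bar>D v \<bullet> w - D w \<bullet> v\<bar> \<le> s\<^sup>2 * (2 * e)" by linarith
    then show ?thesis using s by (simp add: mult_le_cancel_left)
  qed
  from this[of "\<bar>D v \<bullet> w - D w \<bullet> v\<bar> / 4"] show ?thesis by (cases "D v \<bullet> w = D w \<bullet> v") auto
qed

text \<open>A smooth convex body, described by its inverse Gauss map \<open>X\<close>: extended to be homogeneous
  of degree 0, \<open>X\<close> is the gradient of the support function, so its derivative \<open>A\<close> is the Hessian
  of the 1-homogeneous support function, and \<open>H\<close> is the third derivative. On the orthogonal
  complement of a unit vector \<open>z\<close>, \<open>A z\<close> is the paper's \<open>W\<close>.\<close>

locale smooth_body =
  fixes K :: "'a::euclidean_space set" and X :: "'a \<Rightarrow> 'a" and A :: "'a \<Rightarrow> ('a \<Rightarrow>\<^sub>L 'a)"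
    and H :: "'a \<Rightarrow> 'a \<Rightarrow> ('a \<Rightarrow>\<^sub>L 'a)"
  assumes dim2: "DIM('a) \<ge> 2"
    and K_convex: "convex K" and K_compact: "compact K" and K_0: "0 \<in> interior K"
    and X_in: "y \<noteq> 0 \<Longrightarrow> X y \<in> K"
    and X_max: "y \<noteq> 0 \<Longrightarrow> x \<in> K \<Longrightarrow> x \<bullet> y \<le> X y \<bullet> y"
    and X_deriv: "y \<noteq> 0 \<Longrightarrow> (X has_derivative A y) (at y)"
    and A_deriv: "y \<noteq> 0 \<Longrightarrow> (A has_derivative H y) (at y)"
    and H_cont: "continuous_on (- {0}) (\<lambda>y. H y b)"
    and A_pos: "y \<noteq> 0 \<Longrightarrow> v \<noteq> 0 \<Longrightarrow> v \<bullet> y = 0 \<Longrightarrow> A y v \<bullet> v > 0"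
begin

section \<open>Support function, its gradient and its Hessian\<close>

definition h :: "'a \<Rightarrow> real" where "h y = X y \<bullet> y"

lemma open_punctured: "open (- {0::'a})" by (intro open_Compl closed_singleton)

lemma punctured_cont:
  fixes f :: "'a \<Rightarrow> 'b::real_normed_vector"
  assumes "\<And>x. x \<noteq> 0 \<Longrightarrow> (f has_derivative f' x) (at x)"
  shows "continuous_on (- {0}) f"
  using assms by (intro continuous_at_imp_continuous_on ballI has_derivative_continuous) auto

lemma h_pos: assumes "y \<noteq> 0" shows "h y > 0"
proof -
  obtain r where r: "r > 0" "cball 0 r \<subseteq> K"
    using K_0 mem_interior_cball by blast
  have "(r / norm y) *\<^sub>R y \<in> K" using r assms by (intro subsetD[OF r(2)]) simp
  then have "(r / norm y) *\<^sub>R y \<bullet> y \<le> h y" using X_max[OF assms] unfolding h_def by blast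
  moreover have "(r / norm y) *\<^sub>R y \<bullet> y = r * norm y" using assms by (simp add: dot_square_norm power2_eq_square)
  moreover have "0 < r * norm y" using r assms by simp
  ultimately show ?thesis by linarith
qed

lemma X_cont: "continuous_on (- {0}) X"
  by (rule punctured_cont[OF X_deriv])

text \<open>Maximality of \<open>X y\<close> and of \<open>X z\<close> squeezes the error of the
  linear approximation between 0 and \<open>(X z - X y) \<bullet> (z - y)\<close>, so continuity of
  X suffices.\<close>

lemma h_deriv:
  assumes y: "y \<noteq> 0"
  shows "(h has_derivative (\<lambda>v. X y \<bullet> v)) (at y)"
  unfolding has_derivative_at_alt
proof (intro conjI allI impI)
  show "bounded_linear ((\<bullet>) (X y))" by (rule bounded_linear_inner_right)
  fix e :: real assume e: "e > 0"
  have "continuous (at y) X" using X_deriv[OF y] by (rule has_derivative_continuous)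
  then obtain d where d: "d > 0" "\<And>z. norm (z - y) < d \<Longrightarrow> norm (X z - X y) < e"
    unfolding continuous_at_eps_delta using e by (metis dist_norm)
  have "norm (h z - h y - X y \<bullet> (z - y)) \<le> e * norm (z - y)" if z: "norm (z - y) < min d (norm y)" for z
  proof -
    have z0: "z \<noteq> 0" using z by auto
    have 1: "h z - h y - X y \<bullet> (z - y) \<ge> 0"
      using X_max[OF z0 X_in[OF y]] by (simp add: h_def inner_diff_right)
    have "h z - h y - X y \<bullet> (z - y) = (X z - X y) \<bullet> (z - y) - (h y - X z \<bullet> y)"
      by (simp add: h_def inner_diff_right inner_diff_left)
    also have "\<dots> \<le> (X z - X y) \<bullet> (z - y)" using X_max[OF y X_in[OF z0]] by (simp add: h_def)
    also have "\<dots> \<le> norm (X z - X y) * norm (z - y)" by (rule norm_cauchy_schwarz)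
    also have "\<dots> \<le> e * norm (z - y)" using d(2)[of z] z by (intro mult_right_mono) auto
    finally show ?thesis using 1 by simp
  qed
  moreover have "min d (norm y) > 0" using d y by simp
  ultimately show "\<exists>d>0. \<forall>z. norm (z - y) < d \<longrightarrow> norm (h z - h y - X y \<bullet> (z - y)) \<le> e * norm (z - y)"
    by blast
qed

text \<open>A touching point x makes \<open>h z - x \<bullet> z\<close> minimal at y, and the
  gradient \<open>X y - x\<close> vanishes there.\<close>

lemma X_unique:
  assumes y: "y \<noteq> 0" and x: "x \<in> K" "x \<bullet> y = h y"
  shows "x = X y"
proof -
  have "((\<lambda>z. h z - x \<bullet> z) has_derivative (\<lambda>v. X y \<bullet> v - x \<bullet> v)) (at y)"
    using y by (auto intro!: derivative_eq_intros h_deriv)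
  moreover have "h y - x \<bullet> y \<le> h z - x \<bullet> z" if "z \<in> - {0}" for z
    using X_max[of z x] that x by (simp add: h_def)
  ultimately have "(\<lambda>v. X y \<bullet> v - x \<bullet> v) = (\<lambda>v. 0)"
    using differential_zero_maxmin[of y "- {0}" "\<lambda>z. h z - x \<bullet> z"] y by auto
  then have "(X y - x) \<bullet> (X y - x) = 0" unfolding inner_diff_left[of "X y" x] by meson
  then show ?thesis by simp
qed

lemma X_homogeneous:
  assumes "y \<noteq> 0" "c > 0"
  shows "X (c *\<^sub>R y) = X y"
proof (rule X_unique[OF assms(1)])
  have cy: "c *\<^sub>R y \<noteq> 0" using assms by simp
  show "X (c *\<^sub>R y) \<in> K" using X_in[OF cy] .
  have "c * (X y \<bullet> y) \<le> c * (X (c *\<^sub>R y) \<bullet> y)" using X_max[OF cy X_in[OF assms(1)]] by simp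
  moreover have "X (c *\<^sub>R y) \<bullet> y \<le> X y \<bullet> y" using X_max[OF assms(1) X_in[OF cy]] .
  ultimately show "X (c *\<^sub>R y) \<bullet> y = h y" using assms by (simp add: h_def)
qed

lemma A_radial: assumes "y \<noteq> 0" shows "A y y = 0"
proof -
  have 1: "((\<lambda>t. t *\<^sub>R y) has_derivative (\<lambda>s. s *\<^sub>R y)) (at (1::real))"
    by (auto intro!: derivative_eq_intros)
  have 2: "(X has_derivative A y) (at (1 *\<^sub>R y))" using X_deriv[OF assms] by simp
  have "((\<lambda>t. X (t *\<^sub>R y)) has_derivative (\<lambda>s. A y (s *\<^sub>R y))) (at 1)"
    by (rule has_derivative_compose[OF 1 2])
  moreover have "((\<lambda>t. X (t *\<^sub>R y)) has_derivative (\<lambda>s. 0)) (at 1)"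
    by (rule has_derivative_transform_within_open[OF has_derivative_const[of "X y"], of "{0<..}"])
      (use assms X_homogeneous in auto)
  ultimately have "(\<lambda>s. A y (s *\<^sub>R y)) = (\<lambda>s. 0)" by (rule has_derivative_unique)
  then show ?thesis by (metis scaleR_one)
qed

lemma A_sym: "y \<noteq> 0 \<Longrightarrow> A y v \<bullet> w = A y w \<bullet> v"
  using symmetric_second_derivative[OF open_punctured _ h_deriv X_deriv, of y v w] by simp

lemma H_apply_deriv:
  assumes y: "y \<noteq> 0" shows "((\<lambda>z. A z v) has_derivative (\<lambda>w. H y w v)) (at y)"
  using bounded_linear.has_derivative[OF blinfun.bounded_linear_left A_deriv[OF y]] .

lemma H_sym1: assumes y: "y \<noteq> 0" shows "H y u v \<bullet> w = H y u w \<bullet> v"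
proof -
  have "((\<lambda>z. A z v \<bullet> w - A z w \<bullet> v) has_derivative (\<lambda>u. H y u v \<bullet> w - H y u w \<bullet> v)) (at y)"
    by (intro has_derivative_diff has_derivative_inner_left H_apply_deriv y)
  moreover have "((\<lambda>z. A z v \<bullet> w - A z w \<bullet> v) has_derivative (\<lambda>u. 0)) (at y)"
    by (rule has_derivative_transform_within_open[OF has_derivative_const[of 0] open_punctured])
      (use y A_sym in auto)
  ultimately have "(\<lambda>u. H y u v \<bullet> w - H y u w \<bullet> v) = (\<lambda>u. 0)" by (rule has_derivative_unique)
  then show ?thesis by (simp add: fun_eq_iff)
qed

text \<open>For fixed b the field \<open>A z b\<close> is the gradient of
  \<open>X z \<bullet> b\<close>, so its derivative is symmetric; with the symmetry of each
  \<open>H y u\<close> the third derivative is totally symmetric.\<close>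

lemma H_sym: assumes y: "y \<noteq> 0" shows "H y v w = H y w v"
proof (rule euclidean_eqI)
  fix b :: 'a
  have "((\<lambda>z. X z \<bullet> b) has_derivative (\<lambda>v. A z b \<bullet> v)) (at z)" if "z \<noteq> 0" for z
    using has_derivative_inner_left[OF X_deriv[OF that], of b] A_sym[OF that, of _ b] by simp
  then have "H y v b \<bullet> w = H y w b \<bullet> v"
    using symmetric_second_derivative[OF open_punctured _ _ H_apply_deriv[OF y, of b], of "\<lambda>z. X z \<bullet> b"] y by auto
  then show "H y v w \<bullet> b = H y w v \<bullet> b" using H_sym1[OF y] by metis
qed

text \<open>A vanishes radially, so a tangential eigenbasis extends by the unit radial vector with
  eigenvalue 0. Elementary symmetric functions do not see a zero variable, hence those of the full
  Hessian agree with the tangential ones.\<close>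

lemma eigen_frame:
  assumes y: "y \<noteq> 0"
  obtains E \<mu> where "orthonormal_set E" "span E = {v. v \<bullet> y = 0}" "finite E" "card E = DIM('a) - 1"
    "\<And>e. e \<in> E \<Longrightarrow> A y e = \<mu> e *\<^sub>R e" "\<And>e. e \<in> E \<Longrightarrow> \<mu> e > 0" "y /\<^sub>R norm y \<notin> E"
    "\<mu> (y /\<^sub>R norm y) = 0" "eigenbasis (A y) (insert (y /\<^sub>R norm y) E) \<mu>"
    "\<And>m. op_esym m (A y) = esym E \<mu> m"
proof -
  let ?T = "{v. v \<bullet> y = 0}" and ?z = "y /\<^sub>R norm y"
  have sub: "subspace ?T" by (auto simp: subspace_def inner_add_left)
  have inv: "A y v \<in> ?T" for v using A_sym[OF y, of v y] A_radial[OF y] by simp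
  obtain E \<nu> where E: "orthonormal_set E" "E \<subseteq> ?T" "span E = ?T" "card E = dim ?T"
    and ev: "\<And>e. e \<in> E \<Longrightarrow> A y e = \<nu> e *\<^sub>R e"
    using spectral_theorem[OF sub, of "A y"] inv A_sym[OF y]
    by (metis (no_types, lifting) blinfun.bounded_linear_right bounded_linear.linear inner_commute)
  have dimT: "dim ?T = DIM('a) - 1"
    using dim_hyperplane[OF y] by (simp add: inner_commute)
  have z1: "norm ?z = 1" using y by simp
  have zE: "?z \<notin> E"
  proof
    assume "?z \<in> E"
    then have "?z \<bullet> y = 0" using E(2) by auto
    then show False using y by simp
  qed
  define \<mu> where "\<mu> = \<nu>(?z := 0)"
  have ev': "A y e = \<mu> e *\<^sub>R e" if "e \<in> E" for e using ev[OF that] zE that by (auto simp: \<mu>_def)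
  have pos: "\<mu> e > 0" if "e \<in> E" for e
  proof -
    have e: "e \<bullet> e = 1" "e \<bullet> y = 0" using E(1,2) that by (auto simp: orthonormal_set_def dot_square_norm)
    then have "A y e \<bullet> e > 0" using A_pos[OF y, of e] by force
    then show ?thesis using ev'[OF that] e by simp
  qed
  have orth: "orthonormal_set (insert ?z E)"
    using E(1,2) z1 by (auto simp: orthonormal_set_def pairwise_insert orthogonal_def inner_commute)
  have span: "span (insert ?z E) = UNIV"
  proof -
    have "card (insert ?z E) = DIM('a)"
      using zE E(4) dimT dim2 orthonormal_set_finite[OF E(1)] by simp
    then have "dim (span (insert ?z E)) = DIM('a)"
      by (metis dim_span dim_eq_card_independent orthonormal_set_independent[OF orth])
    then show ?thesis by (metis dim_eq_full span_span)
  qed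
  interpret eigenbasis "A y" "insert ?z E" \<mu>
  proof
    show "A y e = \<mu> e *\<^sub>R e" if "e \<in> insert ?z E" for e
      using that ev' A_radial[OF y] by (auto simp: \<mu>_def blinfun.scaleR_right)
  qed (use orth span in auto)
  have "op_esym m (A y) = esym E \<mu> m" for m
    unfolding op_esym_E using zE orthonormal_set_finite[OF E(1)]
    by (cases m) (simp_all add: esym_0 esym_insert, simp add: \<mu>_def)
  then show ?thesis
    using that[of E \<mu>] E ev' pos zE dimT orthonormal_set_finite[OF E(1)] eigenbasis_axioms by (simp add: \<mu>_def)
qed

text \<open>Deleting the radial eigenvalue 0 leaves all the tangential eigenvalues.\<close>

lemma newton_radial: assumes y: "y \<noteq> 0" shows "newton_op m (A y) y = op_esym m (A y) *\<^sub>R y"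
proof -
  let ?z = "y /\<^sub>R norm y"
  obtain E \<mu> where E: "?z \<notin> E" "eigenbasis (A y) (insert ?z E) \<mu>" "op_esym m (A y) = esym E \<mu> m"
    using eigen_frame[OF y] by metis
  then have "newton_op m (A y) ?z = esym E \<mu> m *\<^sub>R ?z"
    using eigenbasis.newton_op_E[OF E(2), of ?z m] by simp
  then have "inverse (norm y) *\<^sub>R newton_op m (A y) y = inverse (norm y) *\<^sub>R (op_esym m (A y) *\<^sub>R y)"
    using E(3) by (simp add: blinfun.scaleR_right mult.commute)
  then show ?thesis using y by (simp only: scaleR_cancel_left) simp
qed

lemma newton_sym: "y \<noteq> 0 \<Longrightarrow> newton_op m (A y) v \<bullet> w = newton_op m (A y) w \<bullet> v"
  using eigen_frame eigenbasis.newton_op_sym by metis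

lemma newton_deriv_x: "y \<noteq> 0 \<Longrightarrow> ((\<lambda>z. newton_op m (A z)) has_derivative (\<lambda>v. newton_deriv m (A y) (H y v))) (at y)"
  using has_derivative_compose[OF A_deriv] eigen_frame eigenbasis.newton_op_has_derivative by metis

lemma op_esym_deriv_ex: assumes y: "y \<noteq> 0"
  shows "((\<lambda>z. op_esym m (A z)) has_derivative
    (\<lambda>v. case m of 0 \<Rightarrow> 0 | Suc j \<Rightarrow> btrace (newton_op j (A y) o\<^sub>L H y v))) (at y)"
proof (cases m)
  case 0
  then show ?thesis by (simp add: op_esym_0)
next
  case (Suc j)
  obtain E \<mu> where "eigenbasis (A y) E \<mu>" using eigen_frame[OF y] by metis
  then show ?thesis using Suc has_derivative_compose[OF A_deriv[OF y] eigenbasis.op_esym_has_derivative] by simp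
qed

lemma A_cont: "continuous_on (- {0}) A"
  by (rule punctured_cont[OF A_deriv])

lemma newton_cont: "continuous_on (- {0}) (\<lambda>x. newton_op m (A x))"
  by (rule punctured_cont[OF newton_deriv_x])

lemma op_esym_cont: "continuous_on (- {0}) (\<lambda>x. op_esym m (A x))"
  by (rule punctured_cont[OF op_esym_deriv_ex])

lemma h_cont: "continuous_on (- {0}) h"
  unfolding h_def[abs_def] by (intro continuous_intros X_cont)

lemmas blinfun_compose_cont = bounded_bilinear.continuous_on[OF bounded_bilinear_blinfun_compose]
lemmas btrace_cont = bounded_linear.continuous_on[OF bounded_linear_btrace]

lemma newton_deriv_cont: "continuous_on (- {0}) (\<lambda>x. newton_deriv m (A x) (H x b))"
  by (induction m)
    (auto intro!: continuous_intros blinfun_compose_cont btrace_cont newton_cont A_cont H_cont simp del: newton_op.simps)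

text \<open>The tangential part of the position vector; on the unit sphere it is \<open>\<nabla>u\<close>.\<close>

definition q :: "'a \<Rightarrow> real" where "q x = h x / (x \<bullet> x)"
definition Y :: "'a \<Rightarrow> 'a" where "Y x = X x - q x *\<^sub>R x"

lemma Y_radial: "x \<noteq> 0 \<Longrightarrow> Y x \<bullet> x = 0"
  by (simp add: Y_def q_def h_def inner_diff_left)

definition q' :: "'a \<Rightarrow> 'a \<Rightarrow> real" where
  "q' x v = (X x \<bullet> v) / (x \<bullet> x) - 2 * h x * (x \<bullet> v) / (x \<bullet> x)\<^sup>2"

lemma q_deriv: "x \<noteq> 0 \<Longrightarrow> (q has_derivative q' x) (at x)"
  unfolding q_def[abs_def] q'_def[abs_def]
  by (auto intro!: derivative_eq_intros h_deriv simp: fun_eq_iff inner_commute power2_eq_square field_simps)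

lemma Y_deriv: "x \<noteq> 0 \<Longrightarrow> (Y has_derivative (\<lambda>v. A x v - (q x *\<^sub>R v + q' x v *\<^sub>R x))) (at x)"
  unfolding Y_def[abs_def] by (auto intro!: derivative_eq_intros X_deriv q_deriv)

lemma q_cont: "continuous_on (- {0}) q"
  unfolding q_def[abs_def] by (intro continuous_intros h_cont) auto

lemma q'_cont: "continuous_on (- {0}) (\<lambda>x. q' x b)"
  unfolding q'_def by (intro continuous_intros h_cont X_cont) auto

lemma Y_cont: "continuous_on (- {0}) Y"
  unfolding Y_def[abs_def] by (intro continuous_intros X_cont q_cont)

text \<open>Differentiating the Newton transformation contributes nothing, its product with A has
  trace \<open>Suc m\<close> times the next symmetric function, and its own trace gives
  \<open>DIM - m\<close>. The radial part of the derivative of Y lowers this last factor by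
  one.\<close>

lemma divergence_newton_Y:
  assumes x: "x \<noteq> 0"
  shows "(\<Sum>b\<in>Basis. (newton_deriv m (A x) (H x b) (Y x) +
      newton_op m (A x) (A x b - (q x *\<^sub>R b + q' x b *\<^sub>R x))) \<bullet> b) =
    real (Suc m) * op_esym (Suc m) (A x) - (real DIM('a) - 1 - real m) * q x * op_esym m (A x)"
proof -
  obtain E \<mu> where "eigenbasis (A x) E \<mu>" using eigen_frame[OF x] by metis
  then have tr: "btrace (newton_op m (A x)) = (real DIM('a) - real m) * op_esym m (A x)"
    by (rule eigenbasis.btrace_newton_op)
  have lin: "linear (q' x)" using q_deriv[OF x] by (rule has_derivative_linear)
  \<comment> \<open>Euler's relation: q is homogeneous of degree -1.\<close>
  have q'x: "(\<Sum>b\<in>Basis. q' x b * (x \<bullet> b)) = - q x"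
  proof -
    have "q' x x = q' x (\<Sum>b\<in>Basis. (x \<bullet> b) *\<^sub>R b)" by (simp add: euclidean_representation)
    also have "\<dots> = (\<Sum>b\<in>Basis. q' x b * (x \<bullet> b))"
      by (simp add: linear_sum[OF lin] linear_scale[OF lin] mult.commute)
    finally show ?thesis using x by (simp add: q'_def q_def h_def power2_eq_square)
  qed
  have "(\<Sum>b\<in>Basis. (newton_deriv m (A x) (H x b) (Y x) +
      newton_op m (A x) (A x b - (q x *\<^sub>R b + q' x b *\<^sub>R x))) \<bullet> b) =
    (\<Sum>b\<in>Basis. newton_deriv m (A x) (H x b) (Y x) \<bullet> b) + btrace (newton_op m (A x) o\<^sub>L A x)
     - q x * btrace (newton_op m (A x)) - (\<Sum>b\<in>Basis. op_esym m (A x) * (q' x b * (x \<bullet> b)))"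
    by (simp add: btrace_def blinfun.bilinear_simps inner_add_left inner_diff_left sum.distrib sum_subtractf
        sum_distrib_left newton_radial[OF x] mult_ac)
  also have "\<dots> = real (Suc m) * op_esym (Suc m) (A x) - (real DIM('a) - 1 - real m) * q x * op_esym m (A x)"
    unfolding tr newton_deriv_div[OF H_sym[OF x]] sum_distrib_left[symmetric] q'x
    using op_esym_Suc[of m "A x"] by (simp add: algebra_simps del: of_nat_Suc)
  finally show ?thesis .
qed

text \<open>The vanishing integral of the divergence of \<open>\<eta> f T\<^sub>m(A) Y\<close>, where the Newton transformation
  \<open>T\<^sub>m(A)\<close> is divergence free.\<close>

theorem weighted_minkowski_identity:
  fixes \<eta> f :: "'a \<Rightarrow> real" and m :: nat
  assumes C: "compact C" "0 \<notin> C"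
    and \<eta>: "\<And>x. x \<noteq> 0 \<Longrightarrow> (\<eta> has_derivative (\<lambda>v. e x * (x \<bullet> v))) (at x)" "continuous_on (- {0}) e"
      "\<And>x. x \<notin> C \<Longrightarrow> \<eta> x = 0"
    and f: "\<And>x. x \<noteq> 0 \<Longrightarrow> (f has_derivative f' x) (at x)" "\<And>b. continuous_on (- {0}) (\<lambda>x. f' x b)"
  defines F_def: "F \<equiv> \<lambda>x. \<eta> x * (f' x (newton_op m (A x) (Y x)) +
      f x * (real (Suc m) * op_esym (Suc m) (A x) - (real DIM('a) - 1 - real m) * q x * op_esym m (A x)))"
  shows "integrable lborel F" and "(LINT x|lborel. F x) = 0"
proof -
  define V where "V x = (\<eta> x * f x) *\<^sub>R newton_op m (A x) (Y x)" for x
  define V' where "V' x v = (\<eta> x * f x) *\<^sub>R (newton_deriv m (A x) (H x v) (Y x) +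
      newton_op m (A x) (A x v - (q x *\<^sub>R v + q' x v *\<^sub>R x)))
     + (\<eta> x * f' x v + e x * (x \<bullet> v) * f x) *\<^sub>R newton_op m (A x) (Y x)" for x v
  have V: "(V has_derivative V' x) (at x)" if "x \<in> - {0}" for x
  proof -
    have x: "x \<noteq> 0" using that by simp
    have TY: "((\<lambda>x. newton_op m (A x) (Y x)) has_derivative (\<lambda>v. newton_op m (A x) (A x v - (q x *\<^sub>R v + q' x v *\<^sub>R x)) +
        newton_deriv m (A x) (H x v) (Y x))) (at x)"
      by (rule bounded_bilinear.FDERIV[OF bounded_bilinear_blinfun_apply newton_deriv_x[OF x] Y_deriv[OF x]])
    have "((\<lambda>x. \<eta> x * f x) has_derivative (\<lambda>v. \<eta> x * f' x v + e x * (x \<bullet> v) * f x)) (at x)"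
      by (rule has_derivative_mult[OF \<eta>(1)[OF x] f(1)[OF x]])
    from has_derivative_scaleR[OF this TY] show ?thesis
      unfolding V_def[abs_def] V'_def[abs_def] by (simp add: add.commute)
  qed
  have \<eta>c: "continuous_on (- {0}) \<eta>" and fc: "continuous_on (- {0}) f"
    by (rule punctured_cont, fact)+
  have cont: "continuous_on (- {0}) (\<lambda>x. V' x b)" for b
    unfolding V'_def
    by (intro continuous_intros \<eta>c fc \<eta>(2) f(2) newton_deriv_cont newton_cont Y_cont A_cont q_cont q'_cont)
  have div: "(\<Sum>b\<in>Basis. V' x b \<bullet> b) = F x" if x: "x \<noteq> 0" for x
  proof -
    let ?w = "newton_op m (A x) (Y x)"
    have lin: "linear (f' x)" using f(1)[OF x] by (rule has_derivative_linear)
    have w: "(\<Sum>b\<in>Basis. (?w \<bullet> b) *\<^sub>R b) = ?w" by (rule euclidean_representation)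
    have 1: "(\<Sum>b\<in>Basis. f' x b * (?w \<bullet> b)) = f' x ?w"
      using arg_cong[OF w, of "f' x"] by (simp add: linear_sum[OF lin] linear_scale[OF lin] mult.commute)
    \<comment> \<open>The gradient of the cutoff \<eta> is radial, while the Newton transformation
      maps Y to a vector orthogonal to x; so differentiating \<eta> leaves no term.\<close>
    have "(\<Sum>b\<in>Basis. (x \<bullet> b) * (?w \<bullet> b)) = ?w \<bullet> x" by (simp add: euclidean_inner[of ?w x] mult.commute)
    also have "\<dots> = 0" using newton_sym[OF x, of m "Y x" x] newton_radial[OF x, of m] Y_radial[OF x]
      by (simp add: inner_commute)
    finally have 2: "(\<Sum>b\<in>Basis. (x \<bullet> b) * (?w \<bullet> b)) = 0" .
    have "(\<Sum>b\<in>Basis. V' x b \<bullet> b) = (\<eta> x * f x) * (\<Sum>b\<in>Basis. (newton_deriv m (A x) (H x b) (Y x) +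
      newton_op m (A x) (A x b - (q x *\<^sub>R b + q' x b *\<^sub>R x))) \<bullet> b)
      + \<eta> x * (\<Sum>b\<in>Basis. f' x b * (?w \<bullet> b)) + e x * f x * (\<Sum>b\<in>Basis. (x \<bullet> b) * (?w \<bullet> b))"
      unfolding V'_def sum_distrib_left sum.distrib[symmetric]
      by (rule sum.cong[OF refl]) (simp add: inner_add_left algebra_simps)
    then show ?thesis unfolding 1 2 divergence_newton_Y[OF x] F_def by (simp add: algebra_simps)
  qed
  have "indicator C x * (\<Sum>b\<in>Basis. V' x b \<bullet> b) = F x" for x
    using div[of x] C(2) \<eta>(3)[of x] by (cases "x \<in> C") (auto simp: F_def)
  then show "integrable lborel F" "(LINT x|lborel. F x) = 0"
    using integral_divergence_zero[OF C(1) open_punctured _ V _ cont] C(2) \<eta>(3)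
    by (auto simp: V_def)
qed

end

section \<open>Change of variables and polar coordinates\<close>

text \<open>The change of variables theorems of the library are stated for \<open>real ^ 'n\<close>; an index type with
  as many elements as the basis of \<open>'a\<close> transfers them to an arbitrary Euclidean space.\<close>

typedef (overloaded) ('a::euclidean_space) basis_index = "Basis :: 'a set"
  morphisms basis_vec Abs_basis_index
  by (rule ex_in_conv[THEN iffD2, OF nonempty_Basis])

instance basis_index :: (euclidean_space) finite
proof
  show "finite (UNIV :: 'a basis_index set)"
    unfolding type_definition.univ[OF type_definition_basis_index] by simp
qed

text \<open>Any injection of the finite index type into the naturals supplies the well-order that
  the sort of the change of variables theorems asks for.\<close>

instantiation basis_index :: (euclidean_space) wellorder
begin

definition code_index :: "'a basis_index \<Rightarrow> nat" where "code_index = (SOME f. inj f)"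
definition less_eq_basis_index :: "'a basis_index \<Rightarrow> 'a basis_index \<Rightarrow> bool" where
  "less_eq_basis_index i j \<longleftrightarrow> code_index i \<le> code_index j"
definition less_basis_index :: "'a basis_index \<Rightarrow> 'a basis_index \<Rightarrow> bool" where
  "less_basis_index i j \<longleftrightarrow> code_index i < code_index j"

instance
proof -
  have "\<exists>f :: 'a basis_index \<Rightarrow> nat. inj f"
    using finite_imp_inj_to_nat_seg[of "UNIV :: 'a basis_index set"] by auto
  then have inj: "inj (code_index :: 'a basis_index \<Rightarrow> nat)"
    unfolding code_index_def by (rule someI_ex)
  show "OFCLASS('a basis_index, wellorder_class)"
  proof
    fix P :: "'a basis_index \<Rightarrow> bool" and a
    assume step: "\<And>x. (\<And>y. y < x \<Longrightarrow> P y) \<Longrightarrow> P x"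
    show "P a"
      by (induction "code_index a" arbitrary: a rule: less_induct)
        (metis less_basis_index_def step)
  qed (use inj in \<open>auto simp: less_eq_basis_index_def less_basis_index_def dest: injD\<close>)
qed

end

definition to_cart :: "'a::euclidean_space \<Rightarrow> real ^ 'a basis_index" where
  "to_cart v = (\<chi> i. v \<bullet> basis_vec i)"

definition of_cart :: "real ^ 'a::euclidean_space basis_index \<Rightarrow> 'a" where
  "of_cart w = (\<Sum>i\<in>UNIV. (w $ i) *\<^sub>R basis_vec i)"

lemma bij_basis_vec: "bij_betw basis_vec (UNIV :: 'a::euclidean_space basis_index set) Basis"
  unfolding bij_betw_def type_definition.Rep_range[OF type_definition_basis_index]
  by (simp add: inj_on_def basis_vec_inject)

lemma basis_vec_inner: "basis_vec i \<bullet> basis_vec j = (if i = j then 1 else 0)"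
  using basis_vec[of i] basis_vec[of j] by (auto simp: inner_Basis basis_vec_inject)

lemma of_cart_inner: "of_cart w \<bullet> basis_vec i = w $ i"
  by (simp add: of_cart_def inner_sum_left basis_vec_inner if_distrib[of "(*) _"] cong: if_cong)

lemma to_of_cart [simp]: "to_cart (of_cart w) = w"
  by (simp add: to_cart_def of_cart_inner vec_eq_iff)

lemma of_to_cart [simp]: "of_cart (to_cart v) = v"
proof -
  have "of_cart (to_cart v) = (\<Sum>b\<in>Basis. (v \<bullet> b) *\<^sub>R b)"
    unfolding of_cart_def to_cart_def
    using sum.reindex_bij_betw[OF bij_basis_vec, of "\<lambda>b. (v \<bullet> b) *\<^sub>R b"] by simp
  then show ?thesis by (simp add: euclidean_representation)
qed

lemma bounded_linear_to_cart: "bounded_linear to_cart"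
  by (intro linear_conv_bounded_linear[THEN iffD1])
    (simp add: linear_iff to_cart_def vec_eq_iff inner_add_left)

lemma bounded_linear_of_cart: "bounded_linear of_cart"
  unfolding of_cart_def[abs_def]
  by (intro linear_conv_bounded_linear[THEN iffD1])
    (simp add: linear_iff scaleR_add_left sum.distrib scaleR_sum_right)

lemma to_cart_measurable [measurable]: "to_cart \<in> borel_measurable borel"
  by (intro borel_measurable_continuous_onI linear_continuous_on bounded_linear_to_cart)

lemma of_cart_measurable [measurable]: "of_cart \<in> borel_measurable borel"
  by (intro borel_measurable_continuous_onI linear_continuous_on bounded_linear_of_cart)

lemma distr_to_cart: "distr lborel borel (to_cart :: 'a::euclidean_space \<Rightarrow> _) = lborel"
proof (rule lborel_eqI[symmetric])
  fix l u :: "real ^ 'a basis_index"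
  assume le: "\<And>b. b \<in> Basis \<Longrightarrow> l \<bullet> b \<le> u \<bullet> b"
  have le': "l $ i \<le> u $ i" for i using le[of "axis i 1"] by (simp add: inner_axis)
  have all: "(\<forall>b\<in>Basis. P b) \<longleftrightarrow> (\<forall>i. P (basis_vec i))" for P :: "'a \<Rightarrow> bool"
    using bij_basis_vec by (metis (no_types, lifting) UNIV_I bij_betw_iff_bijections)
  have vi: "to_cart -` box l u = box (of_cart l :: 'a) (of_cart u)"
  proof (rule set_eqI)
    fix x :: 'a
    have "x \<in> to_cart -` box l u \<longleftrightarrow> (\<forall>i. l $ i < x \<bullet> basis_vec i \<and> x \<bullet> basis_vec i < u $ i)"
      by (simp add: mem_box_cart to_cart_def)
    also have "\<dots> \<longleftrightarrow> x \<in> box (of_cart l) (of_cart u)"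
      by (simp only: mem_box all of_cart_inner)
    finally show "x \<in> to_cart -` box l u \<longleftrightarrow> x \<in> box (of_cart l) (of_cart u)" .
  qed
  have "emeasure (distr lborel borel to_cart) (box l u) = emeasure lborel (box (of_cart l :: 'a) (of_cart u))"
    by (subst emeasure_distr) (simp_all add: vi)
  also have "\<dots> = ennreal (\<Prod>b\<in>Basis. (of_cart u - of_cart l :: 'a) \<bullet> b)"
  proof (rule emeasure_lborel_box)
    have "\<forall>b\<in>Basis. (of_cart l :: 'a) \<bullet> b \<le> of_cart u \<bullet> b"
      unfolding all of_cart_inner using le' by blast
    then show "\<And>b. b \<in> Basis \<Longrightarrow> (of_cart l :: 'a) \<bullet> b \<le> of_cart u \<bullet> b" by blast
  qed
  also have "(\<Prod>b\<in>Basis. (of_cart u - of_cart l :: 'a) \<bullet> b) = (\<Prod>i\<in>UNIV. u $ i - l $ i)"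
    using prod.reindex_bij_betw[OF bij_basis_vec, of "\<lambda>b. (of_cart u - of_cart l :: 'a) \<bullet> b"]
    by (simp add: inner_diff_left of_cart_inner)
  also have "\<dots> = (\<Prod>b\<in>Basis. (u - l) \<bullet> b)"
  proof -
    have b: "bij_betw (\<lambda>i. axis i 1) (UNIV :: 'a basis_index set) (Basis :: (real ^ 'a basis_index) set)"
      by (auto simp: bij_betw_def inj_on_def Basis_vec_def axis_eq_axis)
    show ?thesis using prod.reindex_bij_betw[OF b, of "\<lambda>b. (u - l) \<bullet> b"] by (simp add: inner_axis)
  qed
  finally show "emeasure (distr lborel borel (to_cart :: 'a \<Rightarrow> _)) (box l u) = (\<Prod>b\<in>Basis. (u - l) \<bullet> b)" .
qed simp

lemma nn_integral_of_cart:
  fixes F :: "'a::euclidean_space \<Rightarrow> ennreal"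
  assumes [measurable]: "F \<in> borel_measurable borel"
  shows "(\<integral>\<^sup>+w. F (of_cart w) \<partial>lborel) = (\<integral>\<^sup>+x. F x \<partial>lborel)"
proof -
  have "(\<integral>\<^sup>+w. F (of_cart w) \<partial>distr lborel borel to_cart) = (\<integral>\<^sup>+x. F (of_cart (to_cart x)) \<partial>lborel)"
    by (rule nn_integral_distr) measurable
  then show ?thesis by (simp add: distr_to_cart)
qed

lemma emeasure_of_cart:
  fixes B :: "'a::euclidean_space set"
  assumes B: "B \<in> sets borel"
  shows "of_cart -` B \<in> sets borel" "emeasure lborel (of_cart -` B) = emeasure lborel B"
proof -
  show m: "of_cart -` B \<in> sets borel" using measurable_sets[OF of_cart_measurable B] by simp
  have "emeasure (distr lborel borel to_cart) (of_cart -` B) = emeasure lborel (to_cart -` of_cart -` B \<inter> space lborel)"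
    by (rule emeasure_distr) (use m in auto)
  also have "to_cart -` of_cart -` B \<inter> space lborel = B" by auto
  finally show "emeasure lborel (of_cart -` B) = emeasure lborel B" by (simp add: distr_to_cart)
qed

section \<open>Determinants of operators and volumes of images\<close>

definition op_det :: "('a::euclidean_space \<Rightarrow> 'a) \<Rightarrow> real" where
  "op_det L = det (matrix (to_cart \<circ> L \<circ> of_cart))"

lemma det_almost_diagonal:
  fixes N :: "real ^ 'n ^ 'n"
  assumes "\<And>i j. j \<noteq> k \<Longrightarrow> i \<noteq> j \<Longrightarrow> N $ i $ j = 0"
  shows "det N = (\<Prod>i\<in>UNIV. N $ i $ i)"
proof -
  let ?PU = "{p. p permutes (UNIV :: 'n set)}"
  have z: "of_int (sign p) * (\<Prod>i\<in>UNIV. N $ i $ p i) = 0" if p: "p \<in> ?PU - {id}" for p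
  proof -
    have bij: "bij p" using p permutes_bij by blast
    obtain i where i: "p i \<noteq> i" "p i \<noteq> k"
    proof (rule ccontr)
      assume "\<not> thesis"
      then have fix_ne: "p i = i \<or> p i = k" for i using that by blast
      obtain j where j: "p j \<noteq> j" using p by fastforce
      then have "p j = k" "p k \<noteq> k" using fix_ne bij by (metis bij_pointE)+
      then show False using fix_ne by metis
    qed
    then have "N $ i $ p i = 0" using assms by metis
    then have "(\<Prod>i\<in>UNIV. N $ i $ p i) = 0" by (intro prod_zero) auto
    then show ?thesis by simp
  qed
  have "det N = (\<Sum>p\<in>?PU. of_int (sign p) * (\<Prod>i\<in>UNIV. N $ i $ p i))" by (simp add: det_def)
  also have "\<dots> = (\<Sum>p\<in>{id}. of_int (sign p) * (\<Prod>i\<in>UNIV. N $ i $ p i))"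
    using z by (intro sum.mono_neutral_right) (auto simp: permutes_id)
  finally show ?thesis by (simp add: sign_id)
qed

text \<open>The determinant is computed in frame coordinates: Q and R pass between these and the
  standard ones, and their determinants cancel. Of \<open>L z\<close> only the component along z
  survives.\<close>

lemma op_det_frame:
  fixes L :: "'a::euclidean_space \<Rightarrow> 'a"
  assumes lin: "linear L" and E: "orthonormal_set (insert z E)" "span (insert z E) = UNIV" "z \<notin> E"
    and eig: "\<And>e. e \<in> E \<Longrightarrow> L e = \<mu> e *\<^sub>R e"
  shows "op_det L = (L z \<bullet> z) * (\<Prod>e\<in>E. \<mu> e)"
proof -
  let ?B = "insert z E"
  have fin: "finite ?B" by (rule orthonormal_set_finite[OF E(1)])
  have "card ?B = DIM('a)"
    using orthonormal_set_independent[OF E(1)] E(2) by (metis dim_UNIV dim_span dim_eq_card_independent)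
  moreover have "card (UNIV :: 'a basis_index set) = DIM('a)"
    using bij_betw_same_card[OF bij_basis_vec] .
  ultimately obtain p where p: "bij_betw p (UNIV :: 'a basis_index set) ?B"
    using finite_same_card_bij[OF finite_class.finite_UNIV fin] by metis
  have pB: "p i \<in> ?B" for i using p by (auto simp: bij_betw_def)
  have pinj: "p i = p j \<longleftrightarrow> i = j" for i j using p by (auto simp: bij_betw_def inj_on_def)
  have pin: "p i \<bullet> p j = (if i = j then 1 else 0)" for i j
    using orthonormal_set_inner[OF E(1) pB pB] pinj by simp
  obtain k where k: "p k = z" using p unfolding bij_betw_def by (metis imageE insertI1)
  define Q where "Q w = to_cart (\<Sum>i\<in>UNIV. (w $ i) *\<^sub>R p i)" for w :: "real ^ 'a basis_index"
  define R where "R w = (\<chi> i. of_cart w \<bullet> p i)" for w :: "real ^ 'a basis_index"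
  define M where "M = to_cart \<circ> L \<circ> of_cart"
  note lin_to = bounded_linear.linear[OF bounded_linear_to_cart]
  note lin_of = bounded_linear.linear[OF bounded_linear_of_cart]
  have linQ: "linear Q"
    unfolding Q_def[abs_def]
    by (rule linear_compose[OF _ lin_to, unfolded o_def])
      (simp add: linear_iff scaleR_add_left sum.distrib scaleR_sum_right)
  have linR: "linear R"
    by (simp add: R_def linear_iff vec_eq_iff linear_add[OF lin_of] linear_scale[OF lin_of] inner_add_left)
  have linM: "linear M" unfolding M_def by (intro linear_compose lin_of lin_to lin)
  have RQ: "R \<circ> Q = id"
    by (simp add: fun_eq_iff R_def Q_def vec_eq_iff inner_sum_left pin if_distrib[of "(*) _"] cong: if_cong)
  have Qax: "of_cart (Q (axis j 1)) = p j" for j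
    by (simp add: Q_def axis_def if_distrib[of "\<lambda>a. a *\<^sub>R _"] cong: if_cong)
  have 1: "det (matrix R) * det (matrix Q) = 1"
  proof -
    have "matrix R ** matrix Q = mat 1"
      using matrix_compose[OF linQ linR] RQ by (simp add: matrix_id_mat_1)
    then show ?thesis by (metis det_I det_mul)
  qed
  have "matrix (R \<circ> M \<circ> Q) = matrix R ** (matrix M ** matrix Q)"
    using matrix_compose[OF linQ linM] matrix_compose[OF linear_compose[OF linQ linM] linR]
    by (simp add: o_assoc)
  then have detN: "det (matrix (R \<circ> M \<circ> Q)) = det (matrix M)"
    using 1 by (simp add: det_mul)
  have N: "matrix (R \<circ> M \<circ> Q) $ i $ j = L (p j) \<bullet> p i" for i j
    by (simp add: matrix_def R_def M_def Qax)
  have Lp: "L (p j) \<bullet> p i = (if i = j then \<mu> (p j) else 0)" if "j \<noteq> k" for i j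
  proof -
    have "p j \<in> E" using pB[of j] that k pinj by auto
    then show ?thesis using eig[of "p j"] pin[of j i] by auto
  qed
  have "op_det L = (\<Prod>i\<in>UNIV. L (p i) \<bullet> p i)"
    unfolding op_det_def M_def[symmetric] detN[symmetric]
    by (subst det_almost_diagonal[of k]) (auto simp: N Lp)
  also have "\<dots> = (\<Prod>b\<in>?B. L b \<bullet> b)" by (rule prod.reindex_bij_betw[OF p])
  also have "\<dots> = (L z \<bullet> z) * (\<Prod>e\<in>E. L e \<bullet> e)" using fin E(3) by simp
  also have "(\<Prod>e\<in>E. L e \<bullet> e) = (\<Prod>e\<in>E. \<mu> e)"
  proof (rule prod.cong[OF refl])
    fix e assume "e \<in> E"
    then show "L e \<bullet> e = \<mu> e" using eig[of e] orthonormal_set_inner[OF E(1), of e e] by simp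
  qed
  finally show ?thesis .
qed

lemma cart_image_setup:
  fixes f :: "'a::euclidean_space \<Rightarrow> 'a"
  assumes "\<And>x. x \<in> S \<Longrightarrow> (f has_derivative f' x) (at x within S)" "w \<in> of_cart -` S"
  shows "((to_cart \<circ> f \<circ> of_cart) has_derivative (to_cart \<circ> f' (of_cart w) \<circ> of_cart)) (at w within (of_cart -` S))"
proof -
  have "(of_cart has_derivative of_cart) (at w within (of_cart -` S))"
    by (rule bounded_linear_imp_has_derivative[OF bounded_linear_of_cart])
  moreover have "(f has_derivative f' (of_cart w)) (at (of_cart w) within of_cart ` (of_cart -` S))"
    using has_derivative_subset[OF assms(1), of "of_cart w"] assms(2) by auto
  ultimately have "((f \<circ> of_cart) has_derivative (f' (of_cart w) \<circ> of_cart)) (at w within (of_cart -` S))"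
    by (rule diff_chain_within)
  from bounded_linear.has_derivative[OF bounded_linear_to_cart this] show ?thesis by (simp add: o_def)
qed

lemma cart_image: "(to_cart \<circ> f \<circ> of_cart) ` (of_cart -` S) = of_cart -` (f ` S)"
proof (intro set_eqI iffI)
  fix w assume "w \<in> of_cart -` (f ` S)"
  then obtain x where "x \<in> S" "of_cart w = f x" by auto
  then show "w \<in> (to_cart \<circ> f \<circ> of_cart) ` (of_cart -` S)"
    by (intro image_eqI[where x="to_cart x"]) (auto, metis to_of_cart)
qed auto

text \<open>Multiple covering only enlarges the integral of the Jacobian. The Borel set B stands in
  for the image, which is known to be Lebesgue measurable only.\<close>

lemma emeasure_image_le:
  fixes f :: "'a::euclidean_space \<Rightarrow> 'a"
  assumes S: "S \<in> sets borel" and f: "\<And>x. x \<in> S \<Longrightarrow> (f has_derivative f' x) (at x within S)"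
    and meas: "(\<lambda>x. \<bar>op_det (f' x)\<bar> * indicator S x) \<in> borel_measurable borel"
    and B: "B \<in> sets borel" "B \<subseteq> f ` S"
  shows "emeasure lborel B \<le> (\<integral>\<^sup>+x. ennreal (\<bar>op_det (f' x)\<bar> * indicator S x) \<partial>lborel)"
proof (cases "(\<integral>\<^sup>+x. ennreal (\<bar>op_det (f' x)\<bar> * indicator S x) \<partial>lborel) = \<infinity>")
  case False
  let ?S = "of_cart -` S" and ?g = "\<lambda>w. \<bar>op_det (f' (of_cart w))\<bar>"
  have eq: "(\<integral>\<^sup>+w. ennreal (?g w * indicator S (of_cart w)) \<partial>lborel) = (\<integral>\<^sup>+x. ennreal (\<bar>op_det (f' x)\<bar> * indicator S x) \<partial>lborel)"
    by (rule nn_integral_of_cart[of "\<lambda>x. ennreal (\<bar>op_det (f' x)\<bar> * indicator S x)"]) (use meas in measurable)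
  have ind: "?g w * indicator S (of_cart w) = indicator ?S w *\<^sub>R ?g w" for w by (simp add: indicator_def)
  have gm: "(\<lambda>w. indicator ?S w *\<^sub>R ?g w) \<in> borel_measurable lborel"
    unfolding ind[symmetric] using measurable_compose[OF of_cart_measurable meas] by simp
  have int: "integrable lborel (\<lambda>w. indicator ?S w *\<^sub>R ?g w)"
    using gm eq False by (intro integrableI_nonneg) (auto simp: ind top.not_eq_extremum)
  then have HK: "?g integrable_on ?S" "integral ?S ?g = (LINT w|lborel. indicator ?S w *\<^sub>R ?g w)"
    using set_borel_integral_eq_integral[of ?S ?g]
    by (auto simp: set_integrable_def set_lebesgue_integral_def)
  have nn: "(\<integral>\<^sup>+x. ennreal (\<bar>op_det (f' x)\<bar> * indicator S x) \<partial>lborel) = ennreal (integral ?S ?g)"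
    unfolding eq[symmetric] HK(2) ind by (rule nn_integral_eq_integral[OF int]) simp
  have Sleb: "?S \<in> sets lebesgue" using emeasure_of_cart(1)[OF S] by simp
  have lm: "of_cart -` (f ` S) \<in> lmeasurable" "measure lebesgue (of_cart -` (f ` S)) \<le> integral ?S ?g"
  proof -
    have int: "(\<lambda>w. \<bar>det (matrix (to_cart \<circ> f' (of_cart w) \<circ> of_cart))\<bar>) integrable_on ?S"
      using HK(1) by (simp add: op_det_def)
    show "of_cart -` (f ` S) \<in> lmeasurable"
      unfolding cart_image[symmetric]
      by (rule measurable_differentiable_image[OF Sleb cart_image_setup[OF f] int])
    show "measure lebesgue (of_cart -` (f ` S)) \<le> integral ?S ?g"
      unfolding cart_image[symmetric] op_det_def
      by (rule measure_differentiable_image[OF Sleb cart_image_setup[OF f] int])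
  qed
  have "emeasure lborel B = emeasure lebesgue (of_cart -` B)"
    using emeasure_of_cart[OF B(1)] by simp
  also have "\<dots> \<le> emeasure lebesgue (of_cart -` (f ` S))"
    using B(2) lm(1) by (intro emeasure_mono) (auto simp: fmeasurableD)
  also have "\<dots> = ennreal (measure lebesgue (of_cart -` (f ` S)))" using emeasure_eq_measure2[OF lm(1)] .
  also have "\<dots> \<le> ennreal (integral ?S ?g)" using lm(2) by (rule ennreal_leI)
  finally show ?thesis unfolding nn .
qed simp

text \<open>For injective f the Jacobian integral is the volume of the image, and B contains the
  image.\<close>

lemma emeasure_image_ge:
  fixes f :: "'a::euclidean_space \<Rightarrow> 'a"
  assumes S: "S \<in> sets borel" and f: "\<And>x. x \<in> S \<Longrightarrow> (f has_derivative f' x) (at x within S)"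
    and inj: "inj_on f S"
    and meas: "(\<lambda>x. \<bar>op_det (f' x)\<bar> * indicator S x) \<in> borel_measurable borel"
    and B: "B \<in> sets borel" "f ` S \<subseteq> B"
  shows "(\<integral>\<^sup>+x. ennreal (\<bar>op_det (f' x)\<bar> * indicator S x) \<partial>lborel) \<le> emeasure lborel B"
proof (cases "emeasure lborel B = \<infinity>")
  case False
  let ?S = "of_cart -` S" and ?g = "\<lambda>w. \<bar>op_det (f' (of_cart w))\<bar>" and ?F = "to_cart \<circ> f \<circ> of_cart"
  have eq: "(\<integral>\<^sup>+w. ennreal (?g w * indicator S (of_cart w)) \<partial>lborel) = (\<integral>\<^sup>+x. ennreal (\<bar>op_det (f' x)\<bar> * indicator S x) \<partial>lborel)"
    by (rule nn_integral_of_cart[of "\<lambda>x. ennreal (\<bar>op_det (f' x)\<bar> * indicator S x)"]) (use meas in measurable)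
  have Sleb: "?S \<in> sets lebesgue" using emeasure_of_cart(1)[OF S] by simp
  have injF: "inj_on ?F ?S"
    using inj unfolding inj_on_def o_def by (metis of_to_cart to_of_cart vimageE)
  have Bm: "of_cart -` B \<in> lmeasurable"
    using emeasure_of_cart[OF B(1)] False by (intro fmeasurableI) (auto simp: top.not_eq_extremum)
  have "?F differentiable_on ?S"
    unfolding differentiable_on_def differentiable_def using cart_image_setup[OF f] by blast
  then have Fm: "?F ` ?S \<in> sets lebesgue" using differentiable_image_in_sets_lebesgue[OF Sleb] by blast
  have sub: "?F ` ?S \<subseteq> of_cart -` B" unfolding cart_image using B(2) by blast
  have Fl: "?F ` ?S \<in> lmeasurable" by (rule fmeasurableI2[OF Bm sub Fm])
  \<comment> \<open>The change of variables formula is applied to a vector-valued integrand; the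
    constant 1 in \<open>real ^ 1\<close> yields the volume, and its only component is read off
    afterwards.\<close>
  have one: "(\<lambda>x. 1 :: real ^ 1) absolutely_integrable_on (?F ` ?S)"
    using Fl by (simp add: absolutely_integrable_on_const)
  have "(\<lambda>w. \<bar>det (matrix (to_cart \<circ> f' (of_cart w) \<circ> of_cart))\<bar> *\<^sub>R (1 :: real ^ 1)) absolutely_integrable_on ?S \<and>
      integral ?S (\<lambda>w. \<bar>det (matrix (to_cart \<circ> f' (of_cart w) \<circ> of_cart))\<bar> *\<^sub>R (1 :: real ^ 1)) =
      integral (?F ` ?S) (\<lambda>x. 1)"
    using has_absolute_integral_change_of_variables[OF Sleb cart_image_setup[OF f] injF, of "\<lambda>x. 1 :: real ^ 1" "integral (?F ` ?S) (\<lambda>x. 1)"] one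
    by simp
  then have ai: "(\<lambda>w. ?g w *\<^sub>R (1 :: real ^ 1)) absolutely_integrable_on ?S"
    and ie: "integral ?S (\<lambda>w. ?g w *\<^sub>R (1 :: real ^ 1)) = integral (?F ` ?S) (\<lambda>x. 1)"
    by (auto simp: op_det_def)
  have ai1: "?g absolutely_integrable_on ?S"
    using ai[unfolded absolutely_integrable_componentwise_iff[where f="\<lambda>w. ?g w *\<^sub>R (1 :: real ^ 1)"]]
    by (auto simp: Basis_vec_def inner_axis)
  have i1: "integral ?S ?g = measure lebesgue (?F ` ?S)"
  proof -
    have "integral ?S (\<lambda>w. ?g w *\<^sub>R (1 :: real ^ 1)) $ 1 = integral ?S ?g"
      using integral_component_eq_cart[of "\<lambda>w. ?g w *\<^sub>R (1 :: real ^ 1)" ?S 1] set_lebesgue_integral_eq_integral(1)[OF ai] by simp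
    moreover have "integral (?F ` ?S) (\<lambda>x. 1 :: real ^ 1) $ 1 = measure lebesgue (?F ` ?S)"
      using integral_component_eq_cart[of "\<lambda>w. 1 :: real ^ 1" "?F ` ?S" 1] set_lebesgue_integral_eq_integral(1)[OF one] lmeasure_integral[OF Fl]
      by simp
    ultimately show ?thesis using ie by simp
  qed
  have ind: "?g w * indicator S (of_cart w) = indicator ?S w *\<^sub>R ?g w" for w by (simp add: indicator_def)
  have int: "integrable lebesgue (\<lambda>w. indicator ?S w *\<^sub>R ?g w)"
    using ai1 by (simp add: set_integrable_def)
  have gm: "(\<lambda>w. ennreal (indicator ?S w *\<^sub>R ?g w)) \<in> borel_measurable lborel"
    unfolding ind[symmetric] using measurable_compose[OF of_cart_measurable meas] by simp
  have "(\<integral>\<^sup>+x. ennreal (\<bar>op_det (f' x)\<bar> * indicator S x) \<partial>lborel) = (\<integral>\<^sup>+w. ennreal (indicator ?S w *\<^sub>R ?g w) \<partial>lebesgue)"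
    unfolding eq[symmetric] ind using gm by (simp add: nn_integral_completion)
  also have "\<dots> = ennreal (LINT w|lebesgue. indicator ?S w *\<^sub>R ?g w)"
    by (rule nn_integral_eq_integral[OF int]) simp
  also have "(LINT w|lebesgue. indicator ?S w *\<^sub>R ?g w) = integral ?S ?g"
    using set_lebesgue_integral_eq_integral(2)[of ?S ?g] ai1 by (simp add: set_lebesgue_integral_def)
  also have "ennreal (integral ?S ?g) = emeasure lebesgue (?F ` ?S)"
    unfolding i1 using emeasure_eq_measure2[OF Fl] by simp
  also have "\<dots> \<le> emeasure lebesgue (of_cart -` B)" using sub Bm by (intro emeasure_mono) (auto simp: fmeasurableD)
  also have "\<dots> = emeasure lborel B" using emeasure_of_cart[OF B(1)] by simp
  finally show ?thesis .
qed simp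

lemma nn_integral_scale_lborel:
  fixes G :: "'a::euclidean_space \<Rightarrow> ennreal"
  assumes [measurable]: "G \<in> borel_measurable borel" and c: "c > 0"
  shows "(\<integral>\<^sup>+x. G x \<partial>lborel) = ennreal (c ^ DIM('a)) * (\<integral>\<^sup>+x. G (c *\<^sub>R x) \<partial>lborel)"
proof -
  have "lborel = density (distr lborel borel (\<lambda>x :: 'a. 0 + c *\<^sub>R x)) (\<lambda>_. ennreal (\<bar>c\<bar> ^ DIM('a)))"
    by (rule lborel_affine) (use c in simp)
  then have "(\<integral>\<^sup>+x. G x \<partial>lborel) =
      (\<integral>\<^sup>+x. G x \<partial>density (distr lborel borel (\<lambda>x :: 'a. 0 + c *\<^sub>R x)) (\<lambda>_. ennreal (\<bar>c\<bar> ^ DIM('a))))"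
    by simp
  also have "\<dots> = (\<integral>\<^sup>+x. ennreal (\<bar>c\<bar> ^ DIM('a)) * G x \<partial>distr lborel borel (\<lambda>x :: 'a. 0 + c *\<^sub>R x))"
    by (rule nn_integral_density) auto
  also have "\<dots> = (\<integral>\<^sup>+x. ennreal (\<bar>c\<bar> ^ DIM('a)) * G (c *\<^sub>R x) \<partial>lborel)"
    by (subst nn_integral_distr) auto
  also have "\<dots> = ennreal (\<bar>c\<bar> ^ DIM('a)) * (\<integral>\<^sup>+x. G (c *\<^sub>R x) \<partial>lborel)"
    by (rule nn_integral_cmult) auto
  finally show ?thesis using c by simp
qed

text \<open>Integration in polar coordinates without a sphere: average over dilations, \<open>s = e\<^sup>-\<^sup>t\<close>.\<close>

lemma nn_integral_polar:
  fixes F :: "'a::euclidean_space \<Rightarrow> ennreal" and w :: "real \<Rightarrow> ennreal"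
  assumes [measurable]: "F \<in> borel_measurable borel" "w \<in> borel_measurable borel"
  shows "(\<integral>\<^sup>+t. w (exp t) \<partial>lborel) * (\<integral>\<^sup>+x. F x \<partial>lborel) =
    (\<integral>\<^sup>+y. w (norm y) * (\<integral>\<^sup>+t. ennreal (exp (- t) ^ DIM('a)) * F (exp (- t) *\<^sub>R y) \<partial>lborel) \<partial>lborel)"
proof -
  \<comment> \<open>Replacing t by \<open>t + ln (norm x)\<close> shows that the dilation average of
    the weight is the same for all nonzero x.\<close>
  have shift: "(\<integral>\<^sup>+t. w (exp t * norm x) \<partial>lborel) = (\<integral>\<^sup>+t. w (exp t) \<partial>lborel)" if "x \<noteq> 0" for x :: 'a
  proof -
    have "(\<integral>\<^sup>+t. w (exp t) \<partial>lborel) = (\<integral>\<^sup>+t. w (exp (ln (norm x) + t)) \<partial>lborel)"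
      using nn_integral_real_affine[of "\<lambda>t. w (exp t)" 1 "ln (norm x)"] by simp
    also have "\<dots> = (\<integral>\<^sup>+t. w (exp t * norm x) \<partial>lborel)"
      using that by (simp add: exp_add mult.commute)
    finally show ?thesis by simp
  qed
  have "(\<integral>\<^sup>+t. w (exp t) \<partial>lborel) * (\<integral>\<^sup>+x. F x \<partial>lborel) = (\<integral>\<^sup>+x. (\<integral>\<^sup>+t. w (exp t) \<partial>lborel) * F x \<partial>lborel)"
    by (rule nn_integral_cmult[symmetric]) simp
  also have "\<dots> = (\<integral>\<^sup>+x. (\<integral>\<^sup>+t. w (exp t * norm x) \<partial>lborel) * F x \<partial>lborel)"
    using AE_lborel_singleton[of "0::'a"] by (intro nn_integral_cong_AE) (auto simp: shift)
  also have "\<dots> = (\<integral>\<^sup>+x. (\<integral>\<^sup>+t. w (exp t * norm x) * F x \<partial>lborel) \<partial>lborel)"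
    by (intro nn_integral_cong nn_integral_multc[symmetric]) measurable
  also have "\<dots> = (\<integral>\<^sup>+t. (\<integral>\<^sup>+x. w (exp t * norm x) * F x \<partial>lborel) \<partial>lborel)"
    by (rule lborel_pair.Fubini') measurable
  also have "\<dots> = (\<integral>\<^sup>+t. (\<integral>\<^sup>+y. w (norm y) * (ennreal (exp (- t) ^ DIM('a)) * F (exp (- t) *\<^sub>R y)) \<partial>lborel) \<partial>lborel)"
  proof (rule nn_integral_cong)
    fix t :: real
    have "(\<integral>\<^sup>+x. w (exp t * norm x) * F x \<partial>lborel) =
       ennreal (exp (- t) ^ DIM('a)) * (\<integral>\<^sup>+y. w (exp t * norm (exp (- t) *\<^sub>R y)) * F (exp (- t) *\<^sub>R y) \<partial>lborel)"
      by (rule nn_integral_scale_lborel) auto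
    moreover have nrm: "exp t * norm (exp (- t) *\<^sub>R y) = norm y" for y :: 'a
      by (simp add: exp_minus flip: mult.assoc)
    have "ennreal (exp (- t) ^ DIM('a)) * (\<integral>\<^sup>+y. w (exp t * norm (exp (- t) *\<^sub>R y)) * F (exp (- t) *\<^sub>R y) \<partial>lborel) =
        (\<integral>\<^sup>+y. ennreal (exp (- t) ^ DIM('a)) * (w (norm y) * F (exp (- t) *\<^sub>R y)) \<partial>lborel)"
      unfolding nrm by (rule nn_integral_cmult[symmetric]) measurable
    ultimately show "(\<integral>\<^sup>+x. w (exp t * norm x) * F x \<partial>lborel) =
       (\<integral>\<^sup>+y. w (norm y) * (ennreal (exp (- t) ^ DIM('a)) * F (exp (- t) *\<^sub>R y)) \<partial>lborel)"
      by (simp add: mult_ac)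
  qed
  also have "\<dots> = (\<integral>\<^sup>+y. (\<integral>\<^sup>+t. w (norm y) * (ennreal (exp (- t) ^ DIM('a)) * F (exp (- t) *\<^sub>R y)) \<partial>lborel) \<partial>lborel)"
    by (rule lborel_pair.Fubini') measurable
  also have "\<dots> = (\<integral>\<^sup>+y. w (norm y) * (\<integral>\<^sup>+t. ennreal (exp (- t) ^ DIM('a)) * F (exp (- t) *\<^sub>R y) \<partial>lborel) \<partial>lborel)"
    by (intro nn_integral_cong nn_integral_cmult) measurable
  finally show ?thesis .
qed

section \<open>The Heintze--Karcher inequality\<close>

lemma newton_op_scaleR: "newton_op m (c *\<^sub>R A) = c ^ m *\<^sub>R newton_op m A"
proof (induction m)
  case (Suc m)
  have "(newton_op m (c *\<^sub>R A) o\<^sub>L (c *\<^sub>R A)) = c ^ Suc m *\<^sub>R (newton_op m A o\<^sub>L A)"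
    unfolding Suc by (simp add: bounded_bilinear.scaleR_left[OF bounded_bilinear_blinfun_compose]
        bounded_bilinear.scaleR_right[OF bounded_bilinear_blinfun_compose])
  then show ?case by (simp add: btrace_simps scaleR_diff_right del: power_Suc)
qed simp

lemma op_esym_scaleR: "op_esym m (c *\<^sub>R A) = c ^ m * op_esym m A"
  by (cases m) (simp_all add: op_esym_0 op_esym_Suc newton_op_scaleR btrace_simps
      bounded_bilinear.scaleR_left[OF bounded_bilinear_blinfun_compose]
      bounded_bilinear.scaleR_right[OF bounded_bilinear_blinfun_compose])

text \<open>The gradient has to be differentiable at the minimum only. By the mean value theorem a
  negative second derivative would make f smaller a short step along v.\<close>

lemma second_order_min:
  fixes f :: "'a::euclidean_space \<Rightarrow> real" and g :: "'a \<Rightarrow> 'a"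
  assumes S: "open S" "z \<in> S" and f: "\<And>y. y \<in> S \<Longrightarrow> (f has_derivative (\<lambda>v. g y \<bullet> v)) (at y)"
    and g: "(g has_derivative D) (at z)" and min: "\<And>y. y \<in> S \<Longrightarrow> f z \<le> f y"
  shows "g z = 0" "D v \<bullet> v \<ge> 0"
proof -
  have "(\<lambda>v. g z \<bullet> v) = (\<lambda>v. 0)"
    using differential_zero_maxmin[OF S(2,1) f[OF S(2)]] min by blast
  then have "g z \<bullet> g z = 0" by meson
  then show gz: "g z = 0" by simp
  show "D v \<bullet> v \<ge> 0"
  proof (rule ccontr)
    assume "\<not> D v \<bullet> v \<ge> 0"
    then have neg: "D v \<bullet> v < 0" by simp
    have lin: "linear D" using g by (rule has_derivative_linear)
    have v0: "v \<noteq> 0" using neg by auto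
    \<comment> \<open>Chosen so that the remainder offsets at most half of the supposed negative
      second derivative.\<close>
    define e where "e = - (D v \<bullet> v) / (2 * (v \<bullet> v))"
    have e: "e > 0" using neg v0 unfolding e_def by (intro divide_pos_pos) simp_all
    obtain d where d: "d > 0" "\<And>y. norm (y - z) < d \<Longrightarrow> norm (g y - g z - D (y - z)) \<le> e * norm (y - z)"
      using has_derivative_remainder[OF g e] by blast
    obtain r where r: "r > 0" "ball z r \<subseteq> S" using S open_contains_ball by blast
    define s where "s = min r d / (2 * norm v)"
    have s: "s > 0" using r d v0 by (simp add: s_def)
    have sv: "norm (t *\<^sub>R v) < min r d" if "0 \<le> t" "t \<le> s" for t
    proof -
      have "norm (t *\<^sub>R v) \<le> s * norm v" using that by (simp add: mult_right_mono)
      also have "\<dots> = min r d / 2" using v0 by (simp add: s_def)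
      also have "\<dots> < min r d"
      proof -
        have "min r d > 0" using r d by simp
        then show ?thesis by linarith
      qed
      finally show ?thesis .
    qed
    have der: "((\<lambda>t. f (z + t *\<^sub>R v)) has_real_derivative g (z + t *\<^sub>R v) \<bullet> v) (at t)" if "0 \<le> t" "t \<le> s" for t
    proof -
      have "z + t *\<^sub>R v \<in> S"
        using sv[OF that] by (intro subsetD[OF r(2)]) (simp only: in_ball_translate min_less_iff_conj)
      then have "((\<lambda>t. f (z + t *\<^sub>R v)) has_derivative (\<lambda>h. g (z + t *\<^sub>R v) \<bullet> (h *\<^sub>R v))) (at t)"
        by (intro has_derivative_compose[OF _ f]) (auto intro!: derivative_eq_intros)
      then show ?thesis by (simp add: has_field_derivative_def mult_commute_abs)
    qed
    obtain t where t: "t > 0" "t < s" "f (z + s *\<^sub>R v) - f (z + 0 *\<^sub>R v) = (s - 0) * (g (z + t *\<^sub>R v) \<bullet> v)"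
      using MVT2[OF s der] by blast
    have "norm (g (z + t *\<^sub>R v) - g z - D (z + t *\<^sub>R v - z)) \<le> e * norm (z + t *\<^sub>R v - z)"
      using d(2)[of "z + t *\<^sub>R v"] sv[of t] t by simp
    then have "norm (g (z + t *\<^sub>R v) - t *\<^sub>R D v) \<le> e * (t * norm v)"
      using t by (simp add: gz linear_scale[OF lin])
    then have "(g (z + t *\<^sub>R v) - t *\<^sub>R D v) \<bullet> v \<le> e * (t * norm v) * norm v"
      using norm_cauchy_schwarz[of "g (z + t *\<^sub>R v) - t *\<^sub>R D v" v] mult_right_mono[of _ _ "norm v"]
      by (meson norm_ge_zero order_trans)
    also have "e * (t * norm v) * norm v = t * (e * (v \<bullet> v))" by (simp add: dot_square_norm power2_eq_square)
    also have "e * (v \<bullet> v) = - (D v \<bullet> v) / 2" using v0 by (simp add: e_def)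
    finally have "g (z + t *\<^sub>R v) \<bullet> v \<le> t * (D v \<bullet> v) / 2" by (simp add: inner_diff_left)
    also have "\<dots> < 0" using t neg by (simp add: mult_pos_neg)
    finally have "s * (g (z + t *\<^sub>R v) \<bullet> v) < 0" using s by (simp add: mult_pos_neg)
    then have "f (z + s *\<^sub>R v) < f z" using t(3) by simp
    moreover have "z + s *\<^sub>R v \<in> S"
      using sv[of s] s by (intro subsetD[OF r(2)]) (simp only: in_ball_translate min_less_iff_conj less_imp_le)
    ultimately show False using min by fastforce
  qed
qed

lemma unit_inner: "x \<noteq> 0 \<Longrightarrow> (x /\<^sub>R norm x) \<bullet> (x /\<^sub>R norm x) = 1" for x :: "'a::real_inner"
proof -
  assume "x \<noteq> 0"
  then have "norm (x /\<^sub>R norm x) = 1" by simp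
  then show ?thesis by (metis dot_square_norm power_one)
qed

lemma norm_has_derivative: "x \<noteq> 0 \<Longrightarrow> (norm has_derivative (\<lambda>v. (x \<bullet> v) / norm x)) (at (x :: 'a::euclidean_space))"
  using has_derivative_norm[of x] by (simp add: sgn_div_norm inner_commute divide_inverse_commute)

context smooth_body
begin

lemma A_homogeneous:
  assumes y: "y \<noteq> 0" and c: "c > 0"
  shows "A (c *\<^sub>R y) = (1 / c) *\<^sub>R A y"
proof -
  have cy: "c *\<^sub>R y \<noteq> 0" using assms by simp
  have 1: "((\<lambda>z. c *\<^sub>R z) has_derivative (\<lambda>v. c *\<^sub>R v)) (at y)" by (auto intro!: derivative_eq_intros)
  have "((\<lambda>z. X (c *\<^sub>R z)) has_derivative (\<lambda>v. A (c *\<^sub>R y) (c *\<^sub>R v))) (at y)"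
    by (rule has_derivative_compose[OF 1 X_deriv[OF cy]])
  moreover have "((\<lambda>z. X (c *\<^sub>R z)) has_derivative A y) (at y)"
    by (rule has_derivative_transform_within_open[OF X_deriv[OF y] open_punctured])
      (use y c X_homogeneous in auto)
  ultimately have "(\<lambda>v. A (c *\<^sub>R y) (c *\<^sub>R v)) = A y" by (rule has_derivative_unique)
  then have "A (c *\<^sub>R y) (c *\<^sub>R v) = A y v" for v by metis
  from this[of "(1 / c) *\<^sub>R v" for v] show ?thesis
    using c by (intro blinfun_eqI) (simp add: blinfun.bilinear_simps)
qed

lemma op_esym_homogeneous: "y \<noteq> 0 \<Longrightarrow> c > 0 \<Longrightarrow> op_esym m (A (c *\<^sub>R y)) = op_esym m (A y) / c ^ m"
  by (simp add: A_homogeneous op_esym_scaleR power_divide)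

lemma h_homogeneous: "y \<noteq> 0 \<Longrightarrow> c > 0 \<Longrightarrow> h (c *\<^sub>R y) = c * h y"
  by (simp add: h_def X_homogeneous)

lemma q_homogeneous: "y \<noteq> 0 \<Longrightarrow> c > 0 \<Longrightarrow> q (c *\<^sub>R y) = q y / c"
  by (simp add: q_def h_homogeneous)

lemma Y_homogeneous: "y \<noteq> 0 \<Longrightarrow> c > 0 \<Longrightarrow> Y (c *\<^sub>R y) = Y y"
  by (simp add: Y_def X_homogeneous q_homogeneous)

end

locale smooth_body_dim = smooth_body +
  fixes n :: nat
  assumes dim_n: "DIM('a) = Suc n"
begin

text \<open>The Hessian acts on \<open>Suc n\<close> dimensions, but one eigenvalue is the radial
  zero; the normalization by n is the one that agrees with \<open>P_W\<close> on the unit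
  sphere.\<close>

definition P :: "nat \<Rightarrow> 'a \<Rightarrow> real" where "P m x = op_esym m (A x) / real (n choose m)"

lemma n_pos: "n > 0" using dim2 dim_n by simp

lemma mean_frame:
  assumes y: "y \<noteq> 0"
  obtains E \<mu> where "orthonormal_set (insert (y /\<^sub>R norm y) E)" "span (insert (y /\<^sub>R norm y) E) = UNIV"
    "finite E" "card E = n" "\<And>e. e \<in> E \<Longrightarrow> e \<bullet> y = 0"
    "\<And>e. e \<in> E \<Longrightarrow> A y e = \<mu> e *\<^sub>R e" "\<And>e. e \<in> E \<Longrightarrow> \<mu> e > 0" "y /\<^sub>R norm y \<notin> E"
    "eigenbasis (A y) (insert (y /\<^sub>R norm y) E) \<mu>" "\<mu> (y /\<^sub>R norm y) = 0"
    "\<And>m. op_esym m (A y) = esym E \<mu> m" "\<And>m. P m y = esym_mean E \<mu> m"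
proof -
  obtain E \<mu> where E: "orthonormal_set E" "span E = {v. v \<bullet> y = 0}" "finite E" "card E = DIM('a) - 1"
    "\<And>e. e \<in> E \<Longrightarrow> A y e = \<mu> e *\<^sub>R e" "\<And>e. e \<in> E \<Longrightarrow> \<mu> e > 0" "y /\<^sub>R norm y \<notin> E"
    "\<mu> (y /\<^sub>R norm y) = 0" "eigenbasis (A y) (insert (y /\<^sub>R norm y) E) \<mu>"
    "\<And>m. op_esym m (A y) = esym E \<mu> m"
    by (rule eigen_frame[OF y], rule that; assumption)
  have card: "card E = n" using E(4) dim_n by simp
  have "e \<bullet> y = 0" if "e \<in> E" for e using E(2) span_base[OF that] by auto
  moreover have "P m y = esym_mean E \<mu> m" for m by (simp add: P_def card E(10) esym_mean_def)
  ultimately show ?thesis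
    using that[of E \<mu>] card E eigenbasis.orthonormal[OF E(9)] eigenbasis.span_E[OF E(9)] by simp
qed

lemma P_pos: assumes "y \<noteq> 0" "m \<le> n" shows "P m y > 0"
proof -
  obtain E and \<mu> :: "'a \<Rightarrow> real" where "finite E" "card E = n" "\<And>e. e \<in> E \<Longrightarrow> \<mu> e > 0" "P m y = esym_mean E \<mu> m"
    using mean_frame[OF assms(1)] by metis
  then show ?thesis using esym_mean_pos[of E \<mu> m] assms(2) by simp
qed

lemma op_esym_eq_P: "m \<le> n \<Longrightarrow> op_esym m (A y) = real (n choose m) * P m y"
  by (simp add: P_def)

lemma P_ratio:
  assumes "y \<noteq> 0" "i \<le> j" shows "P (Suc j) y * P i y \<le> P j y * P (Suc i) y"
proof -
  obtain E and \<mu> :: "'a \<Rightarrow> real" where "finite E" "\<And>e. e \<in> E \<Longrightarrow> \<mu> e > 0" "\<And>m. P m y = esym_mean E \<mu> m"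
    using mean_frame[OF assms(1)] by metis
  then show ?thesis using esym_mean_ratio_antimono[of E \<mu> i j] assms(2) by simp
qed

lemma P_homogeneous: "y \<noteq> 0 \<Longrightarrow> c > 0 \<Longrightarrow> P m (c *\<^sub>R y) = P m y / c ^ m"
  by (simp add: P_def op_esym_homogeneous)

lemma P_cont: "continuous_on (- {0}) (P m)"
  unfolding P_def[abs_def] divide_inverse by (intro continuous_intros op_esym_cont)

text \<open>A tangential eigenvalue of the Newton transformation is a symmetric function of the
  other \<open>n - 1\<close> positive eigenvalues, and \<open>m < n\<close> keeps it from being an
  empty sum.\<close>

lemma newton_op_pos:
  assumes x: "x \<noteq> 0" and v: "v \<bullet> x = 0" "v \<noteq> 0" and m: "m < n"
  shows "newton_op m (A x) v \<bullet> v > 0" "newton_op m (A x) v \<bullet> A x v > 0"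
proof -
  let ?z = "x /\<^sub>R norm x"
  obtain E \<mu> where E: "finite E" "card E = n" "\<And>e. e \<in> E \<Longrightarrow> A x e = \<mu> e *\<^sub>R e"
    "\<And>e. e \<in> E \<Longrightarrow> \<mu> e > 0" "?z \<notin> E" "eigenbasis (A x) (insert ?z E) \<mu>" "\<mu> ?z = 0"
    using mean_frame[OF x] by metis
  interpret eigenbasis "A x" "insert ?z E" \<mu> by (rule E(6))
  have vz: "v \<bullet> ?z = 0" using v by simp
  have pos: "esym (insert ?z E - {e}) \<mu> m > 0" if e: "e \<in> E" for e
  proof -
    have eq: "insert ?z E - {e} = insert ?z (E - {e})" using e E(5) by auto
    have "esym (insert ?z (E - {e})) \<mu> m = esym (E - {e}) \<mu> m"
      using E(1,5,7) by (cases m) (auto simp: esym_0 esym_insert)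
    moreover have "esym (E - {e}) \<mu> m > 0" using E(1,2,4) e m by (intro esym_pos) auto
    ultimately show ?thesis unfolding eq by simp
  qed
  obtain e where e: "e \<in> E" "v \<bullet> e \<noteq> 0"
  proof (rule ccontr)
    assume "\<not> thesis"
    then have "\<And>e. e \<in> insert ?z E \<Longrightarrow> v \<bullet> e = 0" using that vz by auto
    then have "v = 0" using expand[of v] by simp
    then show False using v by simp
  qed
  have sum: "newton_op m (A x) v \<bullet> w = (\<Sum>e\<in>E. esym (insert ?z E - {e}) \<mu> m * (v \<bullet> e) * (w \<bullet> e))" for w
    unfolding newton_op_inner using E(1,5) vz by simp
  show "newton_op m (A x) v \<bullet> v > 0"
    unfolding sum
  proof (rule sum_pos2[OF E(1) e(1)])
    have "esym (insert ?z E - {e}) \<mu> m * (v \<bullet> e)\<^sup>2 > 0" using pos[OF e(1)] e(2) by simp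
    then show "0 < esym (insert ?z E - {e}) \<mu> m * (v \<bullet> e) * (v \<bullet> e)"
      by (simp add: power2_eq_square mult.assoc)
    show "0 \<le> esym (insert ?z E - {i}) \<mu> m * (v \<bullet> i) * (v \<bullet> i)" if "i \<in> E" for i
      using pos[OF that] by (simp add: mult.assoc)
  qed
  have Av: "A x v \<bullet> i = \<mu> i * (v \<bullet> i)" if "i \<in> E" for i
    using A_sym[OF x, of v i] E(3)[OF that] by (simp add: inner_commute)
  show "newton_op m (A x) v \<bullet> A x v > 0"
    unfolding sum
  proof (rule sum_pos2[OF E(1) e(1)])
    have eq: "esym (insert ?z E - {e}) \<mu> m * (v \<bullet> e) * (A x v \<bullet> e) = (esym (insert ?z E - {e}) \<mu> m * \<mu> e) * (v \<bullet> e)\<^sup>2"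
      using Av[OF e(1)] by (simp add: power2_eq_square)
    show "0 < esym (insert ?z E - {e}) \<mu> m * (v \<bullet> e) * (A x v \<bullet> e)"
      unfolding eq using pos[OF e(1)] e(2) E(4)[OF e(1)] by (intro mult_pos_pos) auto
    show "0 \<le> esym (insert ?z E - {i}) \<mu> m * (v \<bullet> i) * (A x v \<bullet> i)" if "i \<in> E" for i
    proof -
      have eq: "esym (insert ?z E - {i}) \<mu> m * (v \<bullet> i) * (A x v \<bullet> i) = (esym (insert ?z E - {i}) \<mu> m * \<mu> i) * (v \<bullet> i)\<^sup>2"
        using Av[OF that] by (simp add: power2_eq_square)
      show ?thesis unfolding eq using pos[OF that] E(4)[OF that] by (intro mult_nonneg_nonneg) auto
    qed
  qed
qed

section \<open>Volume of the body by inner parallels and by cones\<close>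

lemma interior_below_h:
  assumes "y \<in> interior K" "z \<noteq> 0" shows "y \<bullet> z < h z"
proof -
  obtain r where r: "r > 0" "cball y r \<subseteq> K" using assms(1) mem_interior_cball by blast
  have "y + (r / norm z) *\<^sub>R z \<in> K"
    using r assms by (intro subsetD[OF r(2)]) (simp add: dist_norm)
  then have "(y + (r / norm z) *\<^sub>R z) \<bullet> z \<le> h z" using X_max[OF assms(2)] unfolding h_def by blast
  moreover have "(r / norm z) *\<^sub>R z \<bullet> z > 0" using r assms by simp
  ultimately show ?thesis by (simp add: inner_add_left)
qed

text \<open>Gaussian normal parallels: \<open>x \<mapsto> X x - x\<close> moves along the inner normal from the boundary point
  with normal \<open>x\<close> by the distance \<open>|x|\<close>. It covers the body even when restricted to points before
  the first focal point.\<close>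

definition focal_domain :: "'a set" where
  "focal_domain = {x \<in> - {0}. \<forall>v. v \<bullet> v - (v \<bullet> x)\<^sup>2 / (x \<bullet> x) \<le> A x v \<bullet> v}"

lemma focal_domain_borel: "focal_domain \<in> sets borel"
proof -
  have "closedin (top_of_set (- {0::'a})) {x \<in> - {0}. v \<bullet> v - (v \<bullet> x)\<^sup>2 / (x \<bullet> x) - A x v \<bullet> v \<in> {..0}}" for v
  proof -
    have "continuous_on (- {0}) (\<lambda>x. v \<bullet> v - (v \<bullet> x)\<^sup>2 / (x \<bullet> x) - A x v \<bullet> v)"
      by (intro continuous_intros A_cont) auto
    from continuous_closedin_preimage[OF this, of "{..0}"] show ?thesis
      by (simp add: Int_def vimage_def)
  qed
  then have "closedin (top_of_set (- {0::'a})) (\<Inter>v. {x \<in> - {0}. v \<bullet> v - (v \<bullet> x)\<^sup>2 / (x \<bullet> x) - A x v \<bullet> v \<in> {..0}})"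
    by (intro closedin_INT) auto
  also have "(\<Inter>v. {x \<in> - {0}. v \<bullet> v - (v \<bullet> x)\<^sup>2 / (x \<bullet> x) - A x v \<bullet> v \<in> {..0}}) = focal_domain"
    by (auto simp: focal_domain_def)
  finally obtain T where "closed T" "focal_domain = - {0} \<inter> T" by (auto simp: closedin_closed)
  then show ?thesis using open_punctured by (auto intro: borel_closed borel_open)
qed

text \<open>An interior point y has a nearest supporting hyperplane, found by minimizing
  \<open>h z - y \<bullet> z\<close> over unit normals. The first-order condition puts y on the
  inner normal at \<open>X z\<close>; the second-order condition says that no focal point lies
  strictly before it.\<close>

lemma focal_cover: "interior K \<subseteq> (\<lambda>x. X x - x) ` focal_domain"
proof
  fix y assume y: "y \<in> interior K"
  have "continuous_on (sphere 0 1) (\<lambda>z. h z - y \<bullet> z)"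
    by (rule continuous_on_subset[of "- {0}"]) (auto intro!: continuous_intros h_cont)
  moreover have "sphere (0::'a) 1 \<noteq> {}" by simp
  ultimately obtain z where z: "z \<in> sphere 0 1" and zmin: "\<And>w. w \<in> sphere 0 1 \<Longrightarrow> h z - y \<bullet> z \<le> h w - y \<bullet> w"
    using continuous_attains_inf[OF compact_sphere] by blast
  define t where "t = h z - y \<bullet> z"
  have z0: "z \<noteq> 0" and z1: "norm z = 1" using z by auto
  have zz: "z \<bullet> z = 1" using z1 by (simp add: dot_square_norm)
  have t: "t > 0" using interior_below_h[OF y z0] by (simp add: t_def)
  \<comment> \<open>The 1-homogeneous extension of the problem: subtracting
    \<open>t * norm w\<close> turns the minimum on the sphere into one over all nonzero vectors,
    with value 0.\<close>
  define f where "f w = h w - y \<bullet> w - t * norm w" for w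
  define g where "g w = X w - y - (t / norm w) *\<^sub>R w" for w
  have fz: "f z = 0" using z1 by (simp add: f_def t_def)
  have fmin: "f z \<le> f w" if "w \<in> - {0}" for w
  proof -
    have w: "w \<noteq> 0" using that by simp
    have "h (w /\<^sub>R norm w) - y \<bullet> (w /\<^sub>R norm w) \<ge> t"
      using zmin[of "w /\<^sub>R norm w"] w by (simp add: t_def)
    then have "(h w - y \<bullet> w) / norm w \<ge> t"
      using w h_homogeneous[OF w, of "inverse (norm w)"] by (simp add: divide_inverse_commute right_diff_distrib)
    then have "0 \<le> f w" unfolding f_def using w by (simp add: le_divide_eq)
    then show ?thesis unfolding fz .
  qed
  have fder: "(f has_derivative (\<lambda>v. g w \<bullet> v)) (at w)" if "w \<in> - {0}" for w
    using that unfolding f_def[abs_def] g_def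
    by (auto intro!: derivative_eq_intros h_deriv norm_has_derivative simp: fun_eq_iff inner_diff_left)
  have gder: "(g has_derivative (\<lambda>v. A z v - ((t / norm z) *\<^sub>R v + (- (t * ((z \<bullet> v) / norm z)) / (norm z)\<^sup>2) *\<^sub>R z))) (at z)"
    unfolding g_def[abs_def] using z0
    by (auto intro!: derivative_eq_intros X_deriv norm_has_derivative simp: fun_eq_iff power2_eq_square divide_simps)
  note so = second_order_min[OF open_punctured _ fder gder fmin]
  have "X z - y = t *\<^sub>R z" using so(1) z0 z1 by (simp add: g_def)
  then have yeq: "y = X z - t *\<^sub>R z" by (simp flip: \<open>X z - y = t *\<^sub>R z\<close>)
  have Ay: "A z v \<bullet> v \<ge> t * (v \<bullet> v - (v \<bullet> z)\<^sup>2)" for v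
    using so(2)[of v] z0 z1 by (simp add: inner_diff_left inner_add_left inner_commute power2_eq_square algebra_simps)
  \<comment> \<open>A is homogeneous of degree -1, so the lower bound t at z becomes the lower bound
    1 at \<open>t *\<^sub>R z\<close>.\<close>
  have "t *\<^sub>R z \<in> focal_domain"
    unfolding focal_domain_def
  proof (intro CollectI conjI allI)
    show "t *\<^sub>R z \<in> - {0}" using t z0 by simp
    fix v
    have "A (t *\<^sub>R z) v \<bullet> v = (A z v \<bullet> v) / t" using A_homogeneous[OF z0 t] by (simp add: blinfun.bilinear_simps)
    also have "\<dots> \<ge> v \<bullet> v - (v \<bullet> z)\<^sup>2" using Ay[of v] t by (simp add: le_divide_eq mult.commute)
    also have "v \<bullet> v - (v \<bullet> z)\<^sup>2 = v \<bullet> v - (v \<bullet> (t *\<^sub>R z))\<^sup>2 / ((t *\<^sub>R z) \<bullet> (t *\<^sub>R z))"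
      using t zz by (simp add: power2_eq_square)
    finally show "v \<bullet> v - (v \<bullet> (t *\<^sub>R z))\<^sup>2 / ((t *\<^sub>R z) \<bullet> (t *\<^sub>R z)) \<le> A (t *\<^sub>R z) v \<bullet> v" .
  qed
  moreover have "y = X (t *\<^sub>R z) - t *\<^sub>R z" using yeq X_homogeneous[OF z0 t] by simp
  ultimately show "y \<in> (\<lambda>x. X x - x) ` focal_domain" by (intro image_eqI)
qed

lemma parallel_det:
  assumes x: "x \<noteq> 0" and E: "orthonormal_set (insert (x /\<^sub>R norm x) E)" "span (insert (x /\<^sub>R norm x) E) = UNIV"
    "x /\<^sub>R norm x \<notin> E" "\<And>e. e \<in> E \<Longrightarrow> A x e = \<mu> e *\<^sub>R e"
  shows "op_det (\<lambda>v. A x v - v) = - (\<Prod>e\<in>E. \<mu> e - 1)"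
proof -
  let ?z = "x /\<^sub>R norm x"
  have lin: "linear (\<lambda>v. A x v - v)"
    by (intro bounded_linear.linear bounded_linear_sub blinfun.bounded_linear_right bounded_linear_ident)
  have "op_det (\<lambda>v. A x v - v) = ((A x ?z - ?z) \<bullet> ?z) * (\<Prod>e\<in>E. \<mu> e - 1)"
    by (rule op_det_frame[OF lin E(1,2,3)]) (simp add: E(4) scaleR_left_diff_distrib)
  also have "(A x ?z - ?z) \<bullet> ?z = -1"
    using A_radial[OF x] unit_inner[OF x] by (simp only: blinfun.scaleR_right scaleR_zero_right diff_0 inner_minus_left)
  finally show ?thesis by simp
qed

text \<open>The tangential columns are \<open>norm x\<close> times the principal radii; of the
  radial column \<open>X x\<close> only its radial component \<open>h x / norm x\<close>
  counts.\<close>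

lemma radial_det:
  assumes x: "x \<noteq> 0"
  shows "op_det (\<lambda>v. ((x \<bullet> v) / norm x) *\<^sub>R X x + norm x *\<^sub>R A x v) = h x * norm x ^ (n - 1) * op_esym n (A x)"
proof -
  let ?z = "x /\<^sub>R norm x" and ?L = "\<lambda>v. ((x \<bullet> v) / norm x) *\<^sub>R X x + norm x *\<^sub>R A x v"
  obtain E \<mu> where E: "orthonormal_set (insert ?z E)" "span (insert ?z E) = UNIV" "finite E" "card E = n"
    "\<And>e. e \<in> E \<Longrightarrow> e \<bullet> x = 0" "\<And>e. e \<in> E \<Longrightarrow> A x e = \<mu> e *\<^sub>R e" "?z \<notin> E"
    "op_esym n (A x) = esym E \<mu> n"
    using mean_frame[OF x] by metis
  have lin: "linear ?L"
  proof (rule linearI)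
    show "?L (v + w) = ?L v + ?L w" for v w
      by (simp add: inner_add_right add_divide_distrib scaleR_add_left scaleR_add_right blinfun.add_right)
    show "?L (c *\<^sub>R v) = c *\<^sub>R ?L v" for c v
      by (simp add: blinfun.scaleR_right scaleR_add_right mult.commute)
  qed
  have "op_det ?L = (?L ?z \<bullet> ?z) * (\<Prod>e\<in>E. norm x * \<mu> e)"
    by (rule op_det_frame[OF lin E(1,2,7)]) (simp add: E(5,6) inner_commute)
  also have "?L ?z \<bullet> ?z = h x / norm x"
  proof -
    have 1: "(x \<bullet> ?z) / norm x = 1" using x by (simp add: dot_square_norm power2_eq_square)
    have 2: "X x \<bullet> ?z = h x / norm x" by (simp add: h_def divide_inverse_commute)
    have 3: "A x ?z = 0" using A_radial[OF x] by (simp add: blinfun.scaleR_right)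
    show ?thesis unfolding 1 3 by (simp only: scaleR_one scaleR_zero_right add_0_right 2)
  qed
  also have "(\<Prod>e\<in>E. norm x * \<mu> e) = norm x ^ n * op_esym n (A x)"
    using E(3,4,8) esym_top[OF E(3), of \<mu>] by (simp add: prod.distrib)
  finally have "op_det ?L = h x / norm x * (norm x ^ n * op_esym n (A x))" .
  moreover have "norm x ^ n = norm x ^ (n - 1) * norm x" using power_minus_mult[OF n_pos, of "norm x"] by simp
  ultimately show ?thesis using x by simp
qed

end

lemma continuous_on_op_det:
  fixes L :: "'b::topological_space \<Rightarrow> 'a::euclidean_space \<Rightarrow> 'a"
  assumes "\<And>v. continuous_on S (\<lambda>x. L x v)"
  shows "continuous_on S (\<lambda>x. op_det (L x))"
  unfolding op_det_def det_def matrix_def to_cart_def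
  by (simp, intro continuous_intros assms)

context smooth_body_dim
begin

lemma kernel_A:
  assumes z: "z \<noteq> 0" and v: "A z v = 0"
  shows "v = ((v \<bullet> z) / (z \<bullet> z)) *\<^sub>R z"
proof -
  define w where "w = v - ((v \<bullet> z) / (z \<bullet> z)) *\<^sub>R z"
  have "w \<bullet> z = 0" using z by (simp add: w_def inner_diff_left)
  moreover have "A z w = 0" using v A_radial[OF z] by (simp add: w_def blinfun.bilinear_simps)
  ultimately have "w = 0" using A_pos[OF z, of w] by force
  then show ?thesis by (simp add: w_def)
qed

text \<open>A point touching in the directions x and y touches in all directions between them. So X
  is constant on the segment, A kills its direction at the midpoint, and the kernel of A is
  radial.\<close>

lemma X_inj:
  assumes x: "x \<noteq> 0" and y: "y \<noteq> 0" and eq: "X x = X y"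
  obtains c where "c > 0" "y = c *\<^sub>R x"
proof -
  let ?p = "X x"
  \<comment> \<open>Positivity, from 0 being interior, keeps the segment away from the
    origin.\<close>
  have px: "?p \<bullet> x > 0" and py: "?p \<bullet> y > 0" using h_pos[OF x] h_pos[OF y] eq by (simp_all add: h_def)
  have on: "x + t *\<^sub>R (y - x) \<noteq> 0 \<and> X (x + t *\<^sub>R (y - x)) = ?p" if t: "0 < t" "t < 1" for t
  proof -
    let ?z = "x + t *\<^sub>R (y - x)"
    have z: "?z = (1 - t) *\<^sub>R x + t *\<^sub>R y" by (simp add: algebra_simps)
    have pz: "?p \<bullet> ?z = (1 - t) * (?p \<bullet> x) + t * (?p \<bullet> y)" unfolding z by (simp add: inner_add_right)
    have "?p \<bullet> ?z > 0" unfolding pz using px py t by (intro add_pos_pos mult_pos_pos) auto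
    then have z0: "?z \<noteq> 0" by auto
    have "X ?z \<bullet> x \<le> ?p \<bullet> x" "X ?z \<bullet> y \<le> ?p \<bullet> y" using X_max[OF x X_in[OF z0]] X_max[OF y X_in[OF z0]] eq by auto
    then have "(1 - t) * (X ?z \<bullet> x) + t * (X ?z \<bullet> y) \<le> ?p \<bullet> ?z"
      unfolding pz using t by (intro add_mono mult_left_mono) auto
    then have "h ?z \<le> ?p \<bullet> ?z" unfolding h_def using z by (metis inner_add_right inner_scaleR_right)
    moreover have "?p \<bullet> ?z \<le> h ?z" using X_max[OF z0 X_in[OF x]] by (simp add: h_def)
    ultimately show ?thesis using X_unique[OF z0 X_in[OF x]] z0 by simp
  qed
  define z where "z = x + (1/2::real) *\<^sub>R (y - x)"
  have z0: "z \<noteq> 0" using on[of "1/2"] by (simp add: z_def)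
  have 1: "((\<lambda>t::real. x + t *\<^sub>R (y - x)) has_derivative (\<lambda>s. s *\<^sub>R (y - x))) (at (1/2))"
    by (auto intro!: derivative_eq_intros)
  have "((\<lambda>t. X (x + t *\<^sub>R (y - x))) has_derivative (\<lambda>s. A z (s *\<^sub>R (y - x)))) (at (1/2))"
    unfolding z_def by (rule has_derivative_compose[OF 1 X_deriv]) (use z0 in \<open>simp add: z_def\<close>)
  moreover have "((\<lambda>t. X (x + t *\<^sub>R (y - x))) has_derivative (\<lambda>s. 0)) (at (1/2::real))"
    by (rule has_derivative_transform_within_open[OF has_derivative_const[of ?p], of "{0<..<1}"])
      (use on in auto)
  ultimately have "(\<lambda>s. A z (s *\<^sub>R (y - x))) = (\<lambda>s. 0)" by (rule has_derivative_unique)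
  then have "A z (y - x) = 0" by (metis scaleR_one)
  then obtain c where c: "y - x = c *\<^sub>R z" using kernel_A[OF z0] by blast
  have eq2: "(1 - c / 2) *\<^sub>R y = (1 + c / 2) *\<^sub>R x"
  proof -
    have half: "(1/2) *\<^sub>R x + (1/2) *\<^sub>R x = x" by (simp flip: scaleR_add_left)
    have "z = ((1/2) *\<^sub>R x + (1/2) *\<^sub>R x) + ((1/2) *\<^sub>R y - (1/2) *\<^sub>R x)"
      unfolding half by (simp add: z_def scaleR_diff_right)
    then have "z = (1/2) *\<^sub>R x + (1/2) *\<^sub>R y" by simp
    then have "y - x = (c / 2) *\<^sub>R x + (c / 2) *\<^sub>R y" unfolding c by (simp add: scaleR_add_right)
    then show ?thesis by (simp add: scaleR_diff_left scaleR_add_left algebra_simps)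
  qed
  have ne: "1 - c / 2 \<noteq> 0"
  proof
    assume "1 - c / 2 = 0"
    then have "(1 + c / 2) *\<^sub>R x = 0" using eq2 by simp
    then show False using x \<open>1 - c / 2 = 0\<close> by simp
  qed
  define b where "b = (1 + c / 2) / (1 - c / 2)"
  have yb: "y = b *\<^sub>R x"
  proof -
    have "y = (1 / (1 - c / 2)) *\<^sub>R ((1 - c / 2) *\<^sub>R y)" using ne by simp
    then show ?thesis unfolding eq2 b_def by simp
  qed
  then have "b * (?p \<bullet> x) > 0" using py by simp
  then have "b > 0" using px by (simp add: zero_less_mult_iff)
  then show ?thesis using that yb by blast
qed

text \<open>Pairing the equation with x and with y gives equal norms by maximality of X; then
  \<open>X_inj\<close> leaves a dilation, whose factor must be 1.\<close>

lemma radial_map_inj: "inj_on (\<lambda>x. norm x *\<^sub>R X x) (- {0})"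
proof (rule inj_onI)
  fix x y assume x: "x \<in> - {0}" and y: "y \<in> - {0}" and eq: "norm x *\<^sub>R X x = norm y *\<^sub>R X y"
  have le: "norm a \<le> norm b" if a: "a \<noteq> 0" and b: "b \<noteq> 0" and e: "norm a *\<^sub>R X a = norm b *\<^sub>R X b" for a b
  proof -
    have "norm a * h a = norm b * (X b \<bullet> a)" using arg_cong[OF e, of "\<lambda>v. v \<bullet> a"] by (simp add: h_def)
    also have "\<dots> \<le> norm b * h a" using X_max[OF a X_in[OF b]] by (simp add: h_def mult_left_mono)
    finally show ?thesis using h_pos[OF a] by simp
  qed
  have n: "norm x = norm y" using le[of x y] le[of y x] x y eq by auto
  then have "X x = X y" using eq x y by auto
  then obtain c where c: "c > 0" "y = c *\<^sub>R x" using X_inj x y by auto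
  then have "c = 1" using n x by simp
  then show "x = y" using c by simp
qed

text \<open>The map \<open>norm x *\<^sub>R X x\<close> sweeps the cone over the boundary: it is
  injective on the punctured unit ball, stays in the interior, and its Jacobian is the
  integrand.\<close>

lemma volume_lower:
  "(\<integral>\<^sup>+x. ennreal (h x * norm x ^ (n - 1) * op_esym n (A x) * indicator (ball 0 1 - {0}) x) \<partial>lborel)
    \<le> emeasure lborel (interior K)"
proof -
  let ?S = "ball 0 1 - {0::'a}"
  let ?f' = "\<lambda>x v. ((x \<bullet> v) / norm x) *\<^sub>R X x + norm x *\<^sub>R A x v"
  have det: "\<bar>op_det (?f' x)\<bar> * indicator ?S x = h x * norm x ^ (n - 1) * op_esym n (A x) * indicator ?S x" for x
  proof (cases "x = 0")
    case False
    then have "op_det (?f' x) = h x * norm x ^ (n - 1) * op_esym n (A x)" by (rule radial_det)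
    moreover have "op_esym n (A x) > 0" using P_pos[OF False, of n] by (simp add: P_def)
    ultimately show ?thesis using h_pos[OF False] by simp
  qed simp
  have "(\<integral>\<^sup>+x. ennreal (\<bar>op_det (?f' x)\<bar> * indicator ?S x) \<partial>lborel) \<le> emeasure lborel (interior K)"
  proof (rule emeasure_image_ge[where f="\<lambda>x. norm x *\<^sub>R X x" and f'="?f'"])
    show "((\<lambda>x. norm x *\<^sub>R X x) has_derivative ?f' x) (at x within ?S)" if "x \<in> ?S" for x
    proof -
      have x: "x \<noteq> 0" using that by simp
      have eq: "?f' x = (\<lambda>v. norm x *\<^sub>R A x v + ((x \<bullet> v) / norm x) *\<^sub>R X x)"
        by (rule ext) (rule add.commute)
      show ?thesis unfolding eq
        by (rule has_derivative_at_withinI[OF has_derivative_scaleR[OF norm_has_derivative[OF x] X_deriv[OF x]]])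
    qed
    show "inj_on (\<lambda>x. norm x *\<^sub>R X x) ?S" by (rule inj_on_subset[OF radial_map_inj]) auto
    have "continuous_on ?S (\<lambda>x. h x * norm x ^ (n - 1) * op_esym n (A x))"
      by (rule continuous_on_subset[of "- {0}"]) (auto intro!: continuous_intros h_cont op_esym_cont)
    then have "(\<lambda>x. indicator ?S x *\<^sub>R (h x * norm x ^ (n - 1) * op_esym n (A x))) \<in> borel_measurable borel"
      by (intro borel_measurable_continuous_on_indicator) auto
    then show "(\<lambda>x. \<bar>op_det (?f' x)\<bar> * indicator ?S x) \<in> borel_measurable borel"
      unfolding det by (simp add: mult.commute)
    show "(\<lambda>x. norm x *\<^sub>R X x) ` ?S \<subseteq> interior K"
    proof (rule image_subsetI)
      fix x :: 'a assume x: "x \<in> ?S"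
      have "X x - (1 - norm x) *\<^sub>R (X x - 0) \<in> interior K"
        by (rule mem_interior_convex_shrink[OF K_convex K_0 X_in]) (use x in auto)
      then show "norm x *\<^sub>R X x \<in> interior K" by (simp add: algebra_simps)
    qed
  qed auto
  then show ?thesis unfolding det .
qed

lemma volume_upper:
  "emeasure lborel (interior K) \<le>
    (\<integral>\<^sup>+x. ennreal (\<bar>op_det (\<lambda>v. A x v - v)\<bar> * indicator focal_domain x) \<partial>lborel)"
    "(\<lambda>x. \<bar>op_det (\<lambda>v. A x v - v)\<bar> * indicator focal_domain x) \<in> borel_measurable borel"
proof -
  have sub: "focal_domain \<subseteq> - {0}" by (auto simp: focal_domain_def)
  have "continuous_on (- {0}) (\<lambda>x. op_det (\<lambda>v. A x v - v))"
    by (rule continuous_on_op_det) (intro continuous_intros A_cont)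
  then have "continuous_on focal_domain (\<lambda>x. \<bar>op_det (\<lambda>v. A x v - v)\<bar>)"
    by (intro continuous_intros continuous_on_subset[OF _ sub])
  from borel_measurable_continuous_on_indicator[OF focal_domain_borel this]
  show m: "(\<lambda>x. \<bar>op_det (\<lambda>v. A x v - v)\<bar> * indicator focal_domain x) \<in> borel_measurable borel"
    by (simp only: real_scaleR_def mult.commute)
  show "emeasure lborel (interior K) \<le>
    (\<integral>\<^sup>+x. ennreal (\<bar>op_det (\<lambda>v. A x v - v)\<bar> * indicator focal_domain x) \<partial>lborel)"
  proof (rule emeasure_image_le[where f="\<lambda>x. X x - x" and f'="\<lambda>x v. A x v - v" and S=focal_domain and B="interior K"])
    show "((\<lambda>x. X x - x) has_derivative (\<lambda>v. A x v - v)) (at x within focal_domain)" if "x \<in> focal_domain" for x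
      by (rule has_derivative_at_withinI, intro has_derivative_diff X_deriv has_derivative_ident) (use that sub in auto)
    show "interior K \<in> sets borel" by simp
  qed (fact focal_domain_borel m focal_cover)+
qed

text \<open>The Jacobian is homogeneous of degree 0, so along dilations it is a constant times the
  indicator of \<open>t > ln (norm y)\<close>; an exponential remains to be integrated.\<close>

lemma radial_integral_lower:
  assumes y: "y \<noteq> 0"
  shows "(\<integral>\<^sup>+t. ennreal (exp (- t) ^ DIM('a)) * ennreal (h (exp (- t) *\<^sub>R y) * norm (exp (- t) *\<^sub>R y) ^ (n - 1) *
      op_esym n (A (exp (- t) *\<^sub>R y)) * indicator (ball 0 1 - {0}) (exp (- t) *\<^sub>R y)) \<partial>lborel)
    = ennreal (q y * op_esym n (A y) / Suc n)"
proof -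
  define C where "C = h y * norm y ^ (n - 1) * op_esym n (A y)"
  let ?N = "real (Suc n)"
  have S: "op_esym n (A y) > 0" using P_pos[OF y, of n] by (simp add: P_def)
  have C0: "C \<ge> 0" using h_pos[OF y] S by (simp add: C_def)
  have eN: "exp (- t) ^ DIM('a) = exp (- (?N * t))" for t
    unfolding dim_n by (simp only: exp_of_nat_mult[symmetric] mult_minus_right)
  have pt: "ennreal (exp (- t) ^ DIM('a)) * ennreal (h (exp (- t) *\<^sub>R y) * norm (exp (- t) *\<^sub>R y) ^ (n - 1) *
      op_esym n (A (exp (- t) *\<^sub>R y)) * indicator (ball 0 1 - {0}) (exp (- t) *\<^sub>R y)) =
      ennreal (C * exp (- (?N * t))) * indicator {ln (norm y)<..} t" for t
  proof -
    define s where "s = exp (- t)"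
    have s: "s > 0" by (simp add: s_def)
    have "s ^ n = s * s ^ (n - 1)" using power_minus_mult[OF n_pos, of s] by (simp add: mult.commute)
    then have val: "h (s *\<^sub>R y) * norm (s *\<^sub>R y) ^ (n - 1) * op_esym n (A (s *\<^sub>R y)) = C"
      using s y by (simp add: h_homogeneous op_esym_homogeneous C_def power_mult_distrib)
    have ny: "norm y > 0" using y by simp
    have "s *\<^sub>R y \<in> ball 0 1 - {0} \<longleftrightarrow> s * norm y < 1" using s y by simp
    also have "\<dots> \<longleftrightarrow> exp (- t + ln (norm y)) < exp 0"
      unfolding exp_add exp_ln[OF ny] s_def exp_zero ..
    also have "\<dots> \<longleftrightarrow> t \<in> {ln (norm y)<..}" by (simp only: exp_less_cancel_iff) auto
    finally have ind: "indicator (ball 0 1 - {0}) (s *\<^sub>R y) = (indicator {ln (norm y)<..} t :: real)"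
      by (auto simp: indicator_def)
    show ?thesis unfolding s_def[symmetric] val ind unfolding s_def eN
      using C0 by (cases "t \<in> {ln (norm y)<..}") (simp_all add: ennreal_mult[symmetric] mult.commute)
  qed
  have "(\<integral>\<^sup>+t. ennreal (C * exp (- (?N * t))) * indicator {ln (norm y)<..} t \<partial>lborel) =
      (\<integral>\<^sup>+t. ennreal (C * exp (- (?N * t))) * indicator {ln (norm y)..} t \<partial>lborel)"
    using AE_lborel_singleton[of "ln (norm y)"]
    by (intro nn_integral_cong_AE) (auto simp: indicator_def elim!: eventually_mono)
  also have "\<dots> = ennreal (0 - (- (C / ?N) * exp (- (?N * ln (norm y)))))"
  proof (rule nn_integral_FTC_atLeast)
    show "((\<lambda>t. - (C / ?N) * exp (- (?N * t))) has_real_derivative C * exp (- (?N * t))) (at t)" for t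
    proof -
      have "((\<lambda>t. - (C / ?N) * exp (- (?N * t))) has_real_derivative - (C / ?N) * (exp (- (?N * t)) * - ?N)) (at t)"
        by (auto intro!: derivative_eq_intros)
      moreover have "- (C / ?N) * (exp (- (?N * t)) * - ?N) = C * exp (- (?N * t))" by (simp del: of_nat_Suc)
      ultimately show ?thesis by (simp only:)
    qed
    have "filterlim (\<lambda>t. - (?N * t)) at_bot at_top"
      unfolding filterlim_uminus_at_bot
      by (simp add: filterlim_tendsto_pos_mult_at_top[OF tendsto_const] filterlim_ident del: of_nat_Suc)
    then have "((\<lambda>t. exp (- (?N * t))) \<longlongrightarrow> 0) at_top" by (rule filterlim_compose[OF exp_at_bot])
    then show "((\<lambda>t. - (C / ?N) * exp (- (?N * t))) \<longlongrightarrow> 0) at_top" by (rule tendsto_mult_right_zero)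
  qed (use C0 in auto)
  also have "0 - (- (C / ?N) * exp (- (?N * ln (norm y)))) = q y * op_esym n (A y) / ?N"
  proof -
    have "exp (- (?N * ln (norm y))) = exp (- ln (norm y)) ^ Suc n"
      by (simp only: exp_of_nat_mult[symmetric] mult_minus_right)
    also have "\<dots> = inverse (norm y) ^ Suc n" using y by (simp add: exp_minus)
    finally have e: "exp (- (?N * ln (norm y))) = inverse (norm y) ^ Suc n" .
    have "norm y ^ (n - 1) * inverse (norm y) ^ Suc n = 1 / (y \<bullet> y)"
    proof -
      have "Suc n = (n - 1) + 2" using n_pos by simp
      then have "inverse (norm y) ^ Suc n = inverse (norm y) ^ (n - 1) * inverse (norm y) ^ 2" by (metis power_add)
      moreover have "norm y ^ (n - 1) * inverse (norm y) ^ (n - 1) = 1" using y by (simp flip: power_mult_distrib)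
      ultimately have "norm y ^ (n - 1) * inverse (norm y) ^ Suc n = inverse (norm y) ^ 2" by (simp add: mult.assoc[symmetric])
      then show ?thesis by (simp add: dot_square_norm power_divide inverse_eq_divide)
    qed
    then have "C * inverse (norm y) ^ Suc n = q y * op_esym n (A y)"
      by (simp add: C_def q_def mult.assoc mult.left_commute del: power_Suc)
    then show ?thesis unfolding e by (simp add: field_simps del: of_nat_Suc power_Suc)
  qed
  finally show ?thesis unfolding pt .
qed

text \<open>With \<open>s = exp (- t)\<close> the focal condition bounds s by every principal radius
  of \<open>A y\<close>. The weighted Jacobian is then at most \<open>S (1 - s J) ^ n\<close>
  against ds, where J is the mean of the reciprocal radii, and integration over
  \<open>0 < s \<le> 1 / J\<close> gives \<open>S / (J (n + 1))\<close>.\<close>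

lemma radial_integral_upper:
  assumes y: "y \<noteq> 0"
  shows "(\<integral>\<^sup>+t. ennreal (exp (- t) ^ DIM('a)) * ennreal (\<bar>op_det (\<lambda>v. A (exp (- t) *\<^sub>R y) v - v)\<bar> *
      indicator focal_domain (exp (- t) *\<^sub>R y)) \<partial>lborel)
    \<le> ennreal (op_esym n (A y) * (P n y / P (n - 1) y) / Suc n)"
proof -
  obtain E \<mu> where E: "orthonormal_set (insert (y /\<^sub>R norm y) E)" "span (insert (y /\<^sub>R norm y) E) = UNIV"
    "finite E" "card E = n" "\<And>e. e \<in> E \<Longrightarrow> e \<bullet> y = 0"
    "\<And>e. e \<in> E \<Longrightarrow> A y e = \<mu> e *\<^sub>R e" "\<And>e. e \<in> E \<Longrightarrow> \<mu> e > 0" "y /\<^sub>R norm y \<notin> E"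
    "\<And>m. op_esym m (A y) = esym E \<mu> m" "\<And>m. P m y = esym_mean E \<mu> m"
    using mean_frame[OF y] by metis
  let ?N = "real (Suc n)"
  define S where "S = op_esym n (A y)"
  define J where "J = P (n - 1) y / P n y"
  have Ene: "E \<noteq> {}" using E(3,4) n_pos by auto
  have S: "S = (\<Prod>e\<in>E. \<mu> e)" using esym_top[OF E(3), of \<mu>] E(4,9) by (simp add: S_def)
  have S0: "S > 0" unfolding S using E(7) by (rule prod_pos)
  have J: "J = esym_mean E \<mu> (card E - 1) / esym_mean E \<mu> (card E)" by (simp add: J_def E(4,10))
  have J0: "J > 0" unfolding J_def using P_pos[OF y] by simp
  have pt: "ennreal (exp (- t) ^ DIM('a)) * ennreal (\<bar>op_det (\<lambda>v. A (exp (- t) *\<^sub>R y) v - v)\<bar> *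
      indicator focal_domain (exp (- t) *\<^sub>R y)) \<le>
      ennreal (exp (- t) * (S * (1 - exp (- t) * J) ^ n)) * indicator {ln J..} t" for t
  proof (cases "exp (- t) *\<^sub>R y \<in> focal_domain")
    case False
    then show ?thesis by simp
  next
    case True
    define s where "s = exp (- t)"
    have s: "s > 0" by (simp add: s_def)
    have x0: "s *\<^sub>R y \<noteq> 0" using s y by simp
    have Ax: "A (s *\<^sub>R y) e = (\<mu> e / s) *\<^sub>R e" if "e \<in> E" for e
      using A_homogeneous[OF y s] E(6)[OF that] by (simp add: blinfun.bilinear_simps)
    have le: "s \<le> \<mu> e" if e: "e \<in> E" for e
    proof -
      have ee: "e \<bullet> e = 1" using orthonormal_set_inner[OF E(1), of e e] e by simp
      have "e \<bullet> e - (e \<bullet> (s *\<^sub>R y))\<^sup>2 / ((s *\<^sub>R y) \<bullet> (s *\<^sub>R y)) \<le> A (s *\<^sub>R y) e \<bullet> e"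
        using True unfolding s_def[symmetric] focal_domain_def by blast
      then have "1 \<le> \<mu> e / s" using E(5)[OF e] ee Ax[OF e] by simp
      then show ?thesis using s by (simp add: le_divide_eq_1_pos)
    qed
    have zx: "(s *\<^sub>R y) /\<^sub>R norm (s *\<^sub>R y) = y /\<^sub>R norm y" using s by simp
    have "op_det (\<lambda>v. A (s *\<^sub>R y) v - v) = - (\<Prod>e\<in>E. \<mu> e / s - 1)"
      using parallel_det[OF x0, of E "\<lambda>e. \<mu> e / s"] E(1,2,8) Ax unfolding zx by blast
    moreover have nn: "(\<Prod>e\<in>E. \<mu> e / s - 1) \<ge> 0" using le s by (intro prod_nonneg) (simp add: le_divide_eq_1_pos)
    ultimately have det: "\<bar>op_det (\<lambda>v. A (s *\<^sub>R y) v - v)\<bar> = (\<Prod>e\<in>E. \<mu> e / s - 1)" by simp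
    have "s ^ n * (\<Prod>e\<in>E. \<mu> e / s - 1) = (\<Prod>e\<in>E. s * (\<mu> e / s - 1))"
      using E(4) by (simp add: prod.distrib)
    also have "\<dots> = (\<Prod>e\<in>E. \<mu> e - s)" using s by (intro prod.cong) (auto simp: field_simps)
    also have "\<dots> \<le> S * (1 - s * J) ^ n"
      using prod_diff_le[OF E(3) Ene E(7) le] unfolding S J E(4) by simp
    finally have "s * (s ^ n * (\<Prod>e\<in>E. \<mu> e / s - 1)) \<le> s * (S * (1 - s * J) ^ n)" using s by simp
    then have b: "s ^ DIM('a) * (\<Prod>e\<in>E. \<mu> e / s - 1) \<le> s * (S * (1 - s * J) ^ n)" by (simp add: dim_n mult.assoc)
    have "s * J \<le> 1" using esym_mean_ratio_top_le[OF E(3) Ene E(7) le] unfolding J by simp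
    then have "J \<le> exp t" by (simp add: s_def exp_minus field_simps)
    then have "ln J \<le> t" using J0 by (simp add: ln_le_cancel_iff[symmetric, of J "exp t"] del: ln_le_cancel_iff)
    then have ind: "indicator {ln J..} t = (1::ennreal)" by simp
    have "ennreal (s ^ DIM('a)) * ennreal (\<bar>op_det (\<lambda>v. A (s *\<^sub>R y) v - v)\<bar> * indicator focal_domain (s *\<^sub>R y)) =
       ennreal (s ^ DIM('a) * (\<Prod>e\<in>E. \<mu> e / s - 1))"
      using True s unfolding det by (simp add: ennreal_mult[OF _ nn] True[folded s_def])
    also have "\<dots> \<le> ennreal (s * (S * (1 - s * J) ^ n))" by (rule ennreal_leI[OF b])
    finally show ?thesis unfolding ind s_def[symmetric] by simp
  qed
  have "(\<integral>\<^sup>+t. ennreal (exp (- t) ^ DIM('a)) * ennreal (\<bar>op_det (\<lambda>v. A (exp (- t) *\<^sub>R y) v - v)\<bar> *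
      indicator focal_domain (exp (- t) *\<^sub>R y)) \<partial>lborel) \<le>
      (\<integral>\<^sup>+t. ennreal (exp (- t) * (S * (1 - exp (- t) * J) ^ n)) * indicator {ln J..} t \<partial>lborel)"
    by (rule nn_integral_mono) (rule pt)
  also have "\<dots> = ennreal (S / (J * ?N) * (1 - 0 * J) ^ Suc n - S / (J * ?N) * (1 - exp (- ln J) * J) ^ Suc n)"
  \<comment> \<open>The antiderivative tends to \<open>S / (J (n + 1))\<close> at infinity and
    vanishes at \<open>t = ln J\<close>, where \<open>exp (- t) * J = 1\<close>.\<close>
  proof (rule nn_integral_FTC_atLeast)
    show "((\<lambda>t. S / (J * ?N) * (1 - exp (- t) * J) ^ Suc n) has_real_derivative exp (- t) * (S * (1 - exp (- t) * J) ^ n)) (at t)" for t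
    proof -
      have "((\<lambda>t. S / (J * ?N) * (1 - exp (- t) * J) ^ Suc n) has_real_derivative
          S / (J * ?N) * (?N * ((exp (- t) * J) * (1 - exp (- t) * J) ^ n))) (at t)"
        by (auto intro!: derivative_eq_intros simp del: power_Suc)
      moreover have "S / (J * ?N) * (?N * ((exp (- t) * J) * (1 - exp (- t) * J) ^ n)) = exp (- t) * (S * (1 - exp (- t) * J) ^ n)"
        using J0 by (simp del: of_nat_Suc)
      ultimately show ?thesis by (simp only:)
    qed
    show "0 \<le> exp (- t) * (S * (1 - exp (- t) * J) ^ n)" if "ln J \<le> t" for t
    proof -
      have "J \<le> exp t" using that J0 by (metis exp_le_cancel_iff exp_ln)
      then have "exp (- t) * J \<le> 1" by (simp add: exp_minus field_simps)
      then show ?thesis using S0 by simp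
    qed
    have "((\<lambda>t::real. exp (- t)) \<longlongrightarrow> 0) at_top"
      by (rule filterlim_compose[OF exp_at_bot]) (simp add: filterlim_uminus_at_bot filterlim_ident)
    then show "((\<lambda>t. S / (J * ?N) * (1 - exp (- t) * J) ^ Suc n) \<longlongrightarrow> S / (J * ?N) * (1 - 0 * J) ^ Suc n) at_top"
      by (intro tendsto_intros)
  qed simp
  also have "S / (J * ?N) * (1 - 0 * J) ^ Suc n - S / (J * ?N) * (1 - exp (- ln J) * J) ^ Suc n =
      op_esym n (A y) * (P n y / P (n - 1) y) / ?N"
    using J0 by (simp add: exp_minus S_def) (simp add: J_def)
  finally show ?thesis .
qed

text \<open>Both volume bounds are multiplied by the same dilation integral of w and written in
  polar form; the two fibre integrals then give the two sides, with the common factor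
  \<open>1 / Suc n\<close> removed by \<open>scale\<close>.\<close>

theorem heintze_karcher:
  assumes [measurable]: "w \<in> borel_measurable borel"
  shows "(\<integral>\<^sup>+y. w (norm y) * ennreal (q y * op_esym n (A y)) \<partial>lborel) \<le>
    (\<integral>\<^sup>+y. w (norm y) * ennreal (op_esym n (A y) * (P n y / P (n - 1) y)) \<partial>lborel)"
proof -
  let ?F1 = "\<lambda>x. ennreal (h x * norm x ^ (n - 1) * op_esym n (A x) * indicator (ball 0 1 - {0}) x)"
  let ?F2 = "\<lambda>x. ennreal (\<bar>op_det (\<lambda>v. A x v - v)\<bar> * indicator focal_domain x)"
  let ?c = "\<integral>\<^sup>+t. w (exp t) \<partial>lborel"
  have "continuous_on (- {0}) (\<lambda>x. h x * norm x ^ (n - 1) * op_esym n (A x))"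
    by (intro continuous_intros h_cont op_esym_cont)
  then have "continuous_on (ball 0 1 - {0}) (\<lambda>x. h x * norm x ^ (n - 1) * op_esym n (A x))"
    by (rule continuous_on_subset) auto
  then have "(\<lambda>x. indicator (ball 0 1 - {0}) x *\<^sub>R (h x * norm x ^ (n - 1) * op_esym n (A x))) \<in> borel_measurable borel"
    by (rule borel_measurable_continuous_on_indicator[rotated]) simp
  then have "(\<lambda>x. h x * norm x ^ (n - 1) * op_esym n (A x) * indicator (ball 0 1 - {0}) x) \<in> borel_measurable borel"
    by (simp only: real_scaleR_def mult.commute)
  then have F1: "?F1 \<in> borel_measurable borel" by (rule measurable_compose) (rule measurable_ennreal)
  have F2: "?F2 \<in> borel_measurable borel" by (rule measurable_compose[OF volume_upper(2)]) (rule measurable_ennreal)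
  have ae: "AE y in lborel. y \<noteq> (0::'a)" by (rule AE_lborel_singleton)
  have "(\<integral>\<^sup>+y. w (norm y) * ennreal (q y * op_esym n (A y) / Suc n) \<partial>lborel) = ?c * (\<integral>\<^sup>+x. ?F1 x \<partial>lborel)"
    unfolding nn_integral_polar[OF F1 assms]
    by (rule nn_integral_cong_AE, rule AE_mp[OF ae], rule AE_I2, rule impI, drule radial_integral_lower, simp only:)
  also have "\<dots> \<le> ?c * (\<integral>\<^sup>+x. ?F2 x \<partial>lborel)"
    by (intro mult_left_mono order_trans[OF volume_lower volume_upper(1)]) simp
  also have "\<dots> \<le> (\<integral>\<^sup>+y. w (norm y) * ennreal (op_esym n (A y) * (P n y / P (n - 1) y) / Suc n) \<partial>lborel)"
    unfolding nn_integral_polar[OF F2 assms]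
    by (rule nn_integral_mono_AE, rule AE_mp[OF ae], rule AE_I2, rule impI, rule mult_left_mono, erule radial_integral_upper, simp)
  finally have le: "(\<integral>\<^sup>+y. w (norm y) * ennreal (q y * op_esym n (A y) / Suc n) \<partial>lborel) \<le>
    (\<integral>\<^sup>+y. w (norm y) * ennreal (op_esym n (A y) * (P n y / P (n - 1) y) / Suc n) \<partial>lborel)" .
  have scale: "(\<integral>\<^sup>+y. w (norm y) * ennreal (g y) \<partial>lborel) =
      ennreal (Suc n) * (\<integral>\<^sup>+y. w (norm y) * ennreal (g y / Suc n) \<partial>lborel)"
    if g: "continuous_on (- {0}) g" for g :: "'a \<Rightarrow> real"
  proof -
    have "(\<lambda>x. indicator (- {0}) x *\<^sub>R g x) \<in> borel_measurable borel"
      by (rule borel_measurable_continuous_on_indicator[OF _ g]) auto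
    then have gm: "(\<lambda>x. indicator (- {0}) x * g x) \<in> borel_measurable borel" by simp
    have "(\<integral>\<^sup>+y. w (norm y) * ennreal (g y) \<partial>lborel) =
       (\<integral>\<^sup>+y. ennreal (Suc n) * (w (norm y) * ennreal (indicator (- {0}) y * g y / Suc n)) \<partial>lborel)"
    proof (rule nn_integral_cong_AE, use ae in \<open>eventually_elim\<close>)
      fix y :: 'a assume "y \<noteq> 0"
      moreover have "ennreal (g y) = ennreal (Suc n) * ennreal (g y / Suc n)"
        by (subst ennreal_mult'[symmetric]) (simp_all del: of_nat_Suc)
      ultimately show "w (norm y) * ennreal (g y) = ennreal (Suc n) * (w (norm y) * ennreal (indicator (- {0}) y * g y / Suc n))"
        by (simp add: mult.left_commute del: of_nat_Suc)
    qed
    also have "\<dots> = ennreal (Suc n) * (\<integral>\<^sup>+y. w (norm y) * ennreal (indicator (- {0}) y * g y / Suc n) \<partial>lborel)"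
      by (rule nn_integral_cmult) (use gm in measurable)
    also have "(\<integral>\<^sup>+y. w (norm y) * ennreal (indicator (- {0}) y * g y / Suc n) \<partial>lborel) =
        (\<integral>\<^sup>+y. w (norm y) * ennreal (g y / Suc n) \<partial>lborel)"
      using ae by (intro nn_integral_cong_AE) (auto elim!: eventually_mono)
    finally show ?thesis .
  qed
  have "P (n - 1) y \<noteq> 0" if "y \<noteq> 0" for y using P_pos[OF that, of "n - 1"] by simp
  then have "continuous_on (- {0}) (\<lambda>y. op_esym n (A y) * (P n y / P (n - 1) y))"
    by (intro continuous_intros op_esym_cont P_cont) auto
  moreover have "continuous_on (- {0}) (\<lambda>y. q y * op_esym n (A y))" by (intro continuous_intros op_esym_cont q_cont)
  ultimately show ?thesis using le by (simp only: scale mult_left_mono zero_le)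
qed

end

section \<open>Rigidity\<close>

text \<open>Squaring smooths the corner of the positive part, so a polynomial cut off at its zeros
  gives a C^1 cutoff.\<close>

lemma pos_part_square_deriv: "((\<lambda>p::real. (max 0 p)\<^sup>2) has_real_derivative 2 * max 0 p) (at p)"
proof -
  consider "p < 0" | "p > 0" | "p = 0" by linarith
  then show ?thesis
  proof cases
    case 1
    have "((\<lambda>p::real. 0) has_real_derivative 0) (at p)" by simp
    then have "((\<lambda>p::real. (max 0 p)\<^sup>2) has_real_derivative 0) (at p)"
      by (rule DERIV_cong_ev[THEN iffD1, OF refl _ refl, rotated])
        (use 1 eventually_nhds_in_open[of "{..<0}" p] in \<open>auto elim!: eventually_mono\<close>)
    then show ?thesis using 1 by simp
  next
    case 2
    have "((\<lambda>p::real. p\<^sup>2) has_real_derivative 2 * p) (at p)" by (auto intro!: derivative_eq_intros)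
    then have "((\<lambda>p::real. (max 0 p)\<^sup>2) has_real_derivative 2 * p) (at p)"
      by (rule DERIV_cong_ev[THEN iffD1, OF refl _ refl, rotated])
        (use 2 eventually_nhds_in_open[of "{0<..}" p] in \<open>auto elim!: eventually_mono\<close>)
    then show ?thesis using 2 by simp
  next
    case 3
    have "((\<lambda>h::real. ((max 0 (0 + h))\<^sup>2 - (max 0 0)\<^sup>2) / h) \<longlongrightarrow> 0) (at 0)"
    proof (rule Lim_null_comparison)
      show "\<forall>\<^sub>F h::real in at 0. norm (((max 0 (0 + h))\<^sup>2 - (max 0 0)\<^sup>2) / h) \<le> \<bar>h\<bar>"
        by (intro always_eventually allI) (auto simp: max_def power2_eq_square)
      show "((\<lambda>h::real. \<bar>h\<bar>) \<longlongrightarrow> 0) (at 0)" by (rule tendsto_rabs_zero) (rule tendsto_ident_at)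
    qed
    then show ?thesis using 3 by (simp add: DERIV_def)
  qed
qed

text \<open>To be evaluated at \<open>x \<bullet> x\<close>: the zeros 1 and 4 are the squares of
  the radii 1 and 2 of the shell.\<close>

definition bump :: "real \<Rightarrow> real" where "bump s = (max 0 ((s - 1) * (4 - s)))\<^sup>2"

lemma bump_deriv: "(bump has_real_derivative 2 * max 0 ((s - 1) * (4 - s)) * (5 - 2 * s)) (at s)"
proof -
  have "((\<lambda>s. (s - 1) * (4 - s)) has_real_derivative 5 - 2 * s) (at s)"
    by (auto intro!: derivative_eq_intros)
  from DERIV_chain2[OF pos_part_square_deriv this] show ?thesis by (simp add: bump_def[abs_def])
qed

lemma bump_nonneg: "bump s \<ge> 0" by (simp add: bump_def)

lemma bump_eq_0: "s \<notin> {1..4} \<Longrightarrow> bump s = 0"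
proof -
  assume "s \<notin> {1..4}"
  then have "(s - 1) * (4 - s) \<le> 0"
    using mult_nonpos_nonneg[of "s - 1" "4 - s"] mult_nonneg_nonpos[of "s - 1" "4 - s"] by (cases "s < 1") auto
  then show "bump s = 0" by (simp add: bump_def max_def)
qed

lemma bump_pos: "1 < s \<Longrightarrow> s < 4 \<Longrightarrow> bump s > 0"
  by (simp add: bump_def max_def not_le)

section \<open>Integration over a shell in place of the sphere\<close>

context smooth_body_dim
begin

definition \<eta> :: "'a \<Rightarrow> real" where "\<eta> x = bump (x \<bullet> x)"
definition shell :: "'a set" where "shell = cball 0 2 - ball 0 1"

lemma shell: "compact shell" "0 \<notin> shell"
  unfolding shell_def by (auto intro: compact_diff)

lemma \<eta>_outside: "x \<notin> shell \<Longrightarrow> \<eta> x = 0"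
proof -
  assume "x \<notin> shell"
  then have "norm x > 2 \<or> norm x < 1" by (auto simp: shell_def)
  then have "x \<bullet> x > 4 \<or> x \<bullet> x < 1"
    using power_strict_mono[of 2 "norm x" 2] power_strict_mono[of "norm x" 1 2] by (auto simp: dot_square_norm)
  then show ?thesis unfolding \<eta>_def by (intro bump_eq_0) auto
qed

lemma \<eta>_nonneg: "\<eta> x \<ge> 0" by (simp add: \<eta>_def bump_nonneg)

lemma \<eta>_deriv:
  "(\<eta> has_derivative (\<lambda>v. (2 * (2 * max 0 ((x \<bullet> x - 1) * (4 - x \<bullet> x)) * (5 - 2 * (x \<bullet> x)))) * (x \<bullet> v))) (at x)"
proof -
  have 1: "((\<lambda>x. x \<bullet> x) has_derivative (\<lambda>v. 2 * (x \<bullet> v))) (at x)"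
    by (auto intro!: derivative_eq_intros simp: inner_commute)
  from has_derivative_compose[OF 1 bump_deriv[unfolded has_field_derivative_def]]
  show ?thesis by (simp add: \<eta>_def[abs_def] mult_ac)
qed

lemma \<eta>_cont: "continuous_on S \<eta>"
  using \<eta>_deriv by (meson continuous_at_imp_continuous_on has_derivative_continuous)

text \<open>For homogeneous g this is the integral over the unit sphere times a positive factor that
  depends on the degree only.\<close>

definition I :: "('a \<Rightarrow> real) \<Rightarrow> real" where "I g = (LINT x|lborel. \<eta> x * g x)"

lemma I_integrable: assumes g: "continuous_on (- {0}) g" shows "integrable lborel (\<lambda>x. \<eta> x * g x)"
proof -
  have sub: "shell \<subseteq> - {0}" using shell(2) by auto
  have "integrable lborel (\<lambda>x. indicator shell x *\<^sub>R (\<eta> x * g x))"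
    by (rule borel_integrable_compact[OF shell(1)])
      (intro continuous_intros \<eta>_cont continuous_on_subset[OF g sub])
  moreover have "(\<lambda>x. indicator shell x *\<^sub>R (\<eta> x * g x)) = (\<lambda>x. \<eta> x * g x)"
    by (rule ext) (use \<eta>_outside in \<open>auto simp: indicator_def\<close>)
  ultimately show ?thesis by simp
qed

lemma I_add: "continuous_on (- {0}) f \<Longrightarrow> continuous_on (- {0}) g \<Longrightarrow> I (\<lambda>x. f x + g x) = I f + I g"
  unfolding I_def distrib_left by (intro Bochner_Integration.integral_add I_integrable)

lemma I_cmult: "I (\<lambda>x. c * g x) = c * I g"
  unfolding I_def mult.left_commute[of _ c] by (rule integral_mult_right_zero)

lemma I_mono:
  assumes "continuous_on (- {0}) f" "continuous_on (- {0}) g" "\<And>x. x \<noteq> 0 \<Longrightarrow> f x \<le> g x"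
  shows "I f \<le> I g"
  unfolding I_def
proof (rule integral_mono[OF I_integrable[OF assms(1)] I_integrable[OF assms(2)]])
  fix x :: 'a
  show "\<eta> x * f x \<le> \<eta> x * g x"
    using assms(3)[of x] \<eta>_nonneg[of x] \<eta>_outside[of 0] shell(2) by (cases "x = 0") (auto intro: mult_left_mono)
qed

text \<open>The set where \<open>\<eta> * g\<close> is nonzero is open and null, hence empty, and
  \<eta> is positive inside the shell.\<close>

lemma I_zero_imp:
  assumes g: "continuous_on (- {0}) g" "\<And>x. x \<noteq> 0 \<Longrightarrow> g x \<ge> 0" and "I g \<le> 0" and x: "1 < norm x" "norm x < 2"
  shows "g x = 0"
proof (rule ccontr)
  assume ne: "g x \<noteq> 0"
  have x0: "x \<noteq> 0" using x by auto
  have nn: "\<eta> y * g y \<ge> 0" for y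
    using g(2)[of y] \<eta>_nonneg[of y] \<eta>_outside[of 0] shell(2) by (cases "y = 0") auto
  have "I g \<ge> 0" unfolding I_def by (rule integral_nonneg_AE) (simp add: nn)
  then have "I g = 0" using assms(3) by simp
  then have ae: "AE y in lborel. \<eta> y * g y = 0"
    using integral_nonneg_eq_0_iff_AE[OF I_integrable[OF g(1)]] nn by (simp add: I_def)
  have "continuous_on (- {0}) (\<lambda>y. \<eta> y * g y)" by (intro continuous_intros \<eta>_cont g)
  then have op: "open ((\<lambda>y. \<eta> y * g y) -` (- {0}) \<inter> - {0})"
    using continuous_on_open_vimage[OF open_punctured] open_Compl[OF closed_singleton] by blast
  have "\<eta> x > 0"
  proof -
    have "x \<bullet> x > 1" "x \<bullet> x < 4"
      using power_strict_mono[of 1 "norm x" 2] power_strict_mono[of "norm x" 2 2] x by (auto simp: dot_square_norm)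
    then show ?thesis unfolding \<eta>_def by (rule bump_pos)
  qed
  then have mem: "x \<in> (\<lambda>y. \<eta> y * g y) -` (- {0}) \<inter> - {0}" using ne x0 by simp
  have "(\<lambda>y. \<eta> y * g y) -` (- {0}) \<inter> - {0} \<in> null_sets lborel"
  proof (rule AE_iff_null_sets[THEN iffD2])
    show "AE y in lborel. y \<notin> (\<lambda>y. \<eta> y * g y) -` (- {0}) \<inter> - {0}" using ae by eventually_elim simp
  qed (use op in auto)
  then have "negligible ((\<lambda>y. \<eta> y * g y) -` (- {0}) \<inter> - {0})"
    by (simp add: negligible_iff_null_sets null_sets_completionI)
  then show False using open_not_negligible[OF op] mem by blast
qed

text \<open>Since \<open>(m + 1) (n choose (m + 1)) = (n - m) (n choose m)\<close>, both symmetric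
  functions carry the same factor after normalization.\<close>

lemma I_identity:
  fixes f :: "'a \<Rightarrow> real" and m :: nat
  assumes m: "m < n"
    and f: "\<And>x. x \<noteq> 0 \<Longrightarrow> (f has_derivative f' x) (at x)" "\<And>b. continuous_on (- {0}) (\<lambda>x. f' x b)"
    and G: "\<And>x. x \<noteq> 0 \<Longrightarrow> f' x (newton_op m (A x) (Y x)) = G x" "continuous_on (- {0}) G"
  shows "I G + real (Suc m * (n choose Suc m)) * I (\<lambda>x. f x * (P (Suc m) x - q x * P m x)) = 0"
proof -
  let ?k = "real (Suc m * (n choose Suc m))"
  let ?B = "\<lambda>x. f x * (P (Suc m) x - q x * P m x)"
  have k2: "?k = (real n - real m) * real (n choose m)"
    using Suc_times_binomial_eq[of "n - 1" m] binomial_absorb_comp[of n m] m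
    by (metis Suc_leI of_nat_diff of_nat_mult less_imp_le_nat binomial_absorption mult.commute)
  have fc: "continuous_on (- {0}) f" using f(1) by (rule punctured_cont)
  have Bc: "continuous_on (- {0}) ?B" by (intro continuous_intros fc P_cont q_cont)
  have "(LINT x|lborel. \<eta> x * (f' x (newton_op m (A x) (Y x)) +
      f x * (real (Suc m) * op_esym (Suc m) (A x) - (real DIM('a) - 1 - real m) * q x * op_esym m (A x)))) = 0"
    by (rule weighted_minkowski_identity(2)[OF shell \<eta>_deriv _ \<eta>_outside f]) (auto intro!: continuous_intros)
  also have "(\<lambda>x. \<eta> x * (f' x (newton_op m (A x) (Y x)) +
      f x * (real (Suc m) * op_esym (Suc m) (A x) - (real DIM('a) - 1 - real m) * q x * op_esym m (A x))))
      = (\<lambda>x. \<eta> x * (G x + ?k * ?B x))"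
  proof
    fix x :: 'a
    show "\<eta> x * (f' x (newton_op m (A x) (Y x)) +
      f x * (real (Suc m) * op_esym (Suc m) (A x) - (real DIM('a) - 1 - real m) * q x * op_esym m (A x))) =
      \<eta> x * (G x + ?k * ?B x)"
    proof (cases "x = 0")
      case True
      then show ?thesis using \<eta>_outside[of 0] shell(2) by simp
    next
      case False
      have 1: "real (Suc m) * op_esym (Suc m) (A x) = ?k * P (Suc m) x"
      proof -
        have "op_esym (Suc m) (A x) = real (n choose Suc m) * P (Suc m) x" using m by (intro op_esym_eq_P) simp
        then show ?thesis by (simp only: of_nat_mult mult.assoc)
      qed
      have 2: "(real DIM('a) - 1 - real m) * q x * op_esym m (A x) = ?k * (q x * P m x)"
        unfolding k2 using m by (simp add: op_esym_eq_P dim_n)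
      show ?thesis unfolding G(1)[OF False] 1 2 by (simp add: right_diff_distrib mult_ac)
    qed
  qed
  finally have "I (\<lambda>x. G x + ?k * ?B x) = 0" by (simp add: I_def)
  moreover have "I (\<lambda>x. G x + ?k * ?B x) = I G + I (\<lambda>x. ?k * ?B x)"
    by (rule I_add[OF G(2)]) (intro continuous_intros Bc)
  ultimately show ?thesis by (simp only: I_cmult)
qed

text \<open>A radial weight has no gradient term, as the Newton transformation of Y is orthogonal to
  x. The power d adapts the identity to the weight \<open>norm x ^ d\<close> that the equation
  brings in.\<close>

lemma I_minkowski:
  assumes m: "m < n"
  shows "I (\<lambda>x. norm x ^ d * (P (Suc m) x - q x * P m x)) = 0"
proof -
  have der: "((\<lambda>x. norm x ^ d) has_derivative (\<lambda>v. real d * (norm x ^ (d - 1) * ((x \<bullet> v) / norm x)))) (at x)"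
    if "x \<noteq> 0" for x :: 'a
    using that by (auto intro!: derivative_eq_intros norm_has_derivative simp: fun_eq_iff)
  have cont: "continuous_on (- {0}) (\<lambda>x :: 'a. real d * (norm x ^ (d - 1) * ((x \<bullet> b) / norm x)))" for b
    by (intro continuous_intros) auto
  have z: "real d * (norm x ^ (d - 1) * ((x \<bullet> newton_op m (A x) (Y x)) / norm x)) = 0" if x: "x \<noteq> 0" for x
    using newton_sym[OF x, of m "Y x" x] newton_radial[OF x, of m] Y_radial[OF x] by (simp add: inner_commute)
  have "I (\<lambda>x. 0) + real (Suc m * (n choose Suc m)) * I (\<lambda>x. norm x ^ d * (P (Suc m) x - q x * P m x)) = 0"
    by (rule I_identity[OF m der cont z]) (assumption | rule continuous_on_const)+
  moreover have "Suc m * (n choose Suc m) > 0" using m by (simp del: mult_Suc)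
  then have "real (Suc m * (n choose Suc m)) > 0" by (simp only: of_nat_0_less_iff)
  ultimately show ?thesis by (simp add: I_def)
qed

text \<open>The radial weight \<open>bump (r\<^sup>2) * r ^ d\<close> turns the extended nonnegative
  inequality into one for I; in top degree \<open>op_esym n\<close> and \<open>P n\<close>
  coincide.\<close>

lemma I_heintze_karcher:
  "I (\<lambda>x. norm x ^ d * (q x * P n x)) \<le> I (\<lambda>x. norm x ^ d * (P n x * (P n x / P (n - 1) x)))"
proof -
  define w where "w r = ennreal (bump (r\<^sup>2) * r ^ d)" for r :: real
  have "bump \<in> borel_measurable borel"
    using bump_deriv by (intro borel_measurable_continuous_onI) (meson DERIV_isCont continuous_at_imp_continuous_on)
  then have w: "w \<in> borel_measurable borel" unfolding w_def[abs_def] by measurable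
  have op: "op_esym n (A y) = P n y" for y by (simp add: P_def)
  have Pn: "P (n - 1) x > 0" "P n x > 0" "q x > 0" if "x \<noteq> 0" for x
    using P_pos[OF that] h_pos[OF that] that by (simp_all add: q_def)
  have wn: "w (norm y) * ennreal (g y) = ennreal (\<eta> y * (norm y ^ d * g y))" if "y = 0 \<or> g y \<ge> 0" for g :: "'a \<Rightarrow> real" and y
  proof -
    have "w (norm y) * ennreal (g y) = ennreal (bump ((norm y)\<^sup>2) * norm y ^ d * g y)" if "g y \<ge> 0"
      unfolding w_def using that by (subst ennreal_mult) (simp_all add: bump_nonneg)
    moreover have "w (norm y) = 0" "\<eta> y = 0" if "y = 0"
      using that bump_eq_0[of 0] by (simp_all add: w_def \<eta>_def)
    ultimately show ?thesis using that by (auto simp: \<eta>_def dot_square_norm mult.assoc)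
  qed
  have nnI: "(\<integral>\<^sup>+y. w (norm y) * ennreal (g y) \<partial>lborel) = ennreal (I (\<lambda>x. norm x ^ d * g x))"
    if g: "continuous_on (- {0}) g" "\<And>x. x \<noteq> 0 \<Longrightarrow> g x \<ge> 0" for g :: "'a \<Rightarrow> real"
  proof -
    have int: "integrable lborel (\<lambda>x. \<eta> x * (norm x ^ d * g x))"
      by (rule I_integrable) (intro continuous_intros g)
    have nn: "\<eta> y * (norm y ^ d * g y) \<ge> 0" for y
      using g(2)[of y] \<eta>_nonneg[of y] \<eta>_outside[of 0] shell(2) by (cases "y = 0") auto
    have "(\<integral>\<^sup>+y. w (norm y) * ennreal (g y) \<partial>lborel) = (\<integral>\<^sup>+y. ennreal (\<eta> y * (norm y ^ d * g y)) \<partial>lborel)"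
      by (rule nn_integral_cong) (use wn g(2) in blast)
    also have "\<dots> = ennreal (I (\<lambda>x. norm x ^ d * g x))"
      unfolding I_def by (rule nn_integral_eq_integral[OF int]) (simp add: nn)
    finally show ?thesis .
  qed
  have ne: "P (n - 1) x \<noteq> 0" if "x \<noteq> 0" for x using Pn(1)[OF that] by simp
  have c1: "continuous_on (- {0}) (\<lambda>y. q y * P n y)" by (intro continuous_intros q_cont P_cont)
  have c2: "continuous_on (- {0}) (\<lambda>y. P n y * (P n y / P (n - 1) y))"
    by (intro continuous_intros P_cont) (use ne in auto)
  have "ennreal (I (\<lambda>x. norm x ^ d * (q x * P n x))) \<le> ennreal (I (\<lambda>x. norm x ^ d * (P n x * (P n x / P (n - 1) x))))"
    using heintze_karcher[OF w] unfolding op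
    by (subst (asm) nnI[OF c1], use Pn in \<open>simp add: less_imp_le\<close>)
      (subst (asm) nnI[OF c2], use Pn in \<open>simp_all add: less_imp_le\<close>)
  moreover have "I (\<lambda>x. norm x ^ d * (P n x * (P n x / P (n - 1) x))) \<ge> 0"
  proof -
    have "I (\<lambda>x. 0) \<le> I (\<lambda>x. norm x ^ d * (P n x * (P n x / P (n - 1) x)))"
    proof (rule I_mono[OF continuous_on_const])
      show "continuous_on (- {0}) (\<lambda>x. norm x ^ d * (P n x * (P n x / P (n - 1) x)))"
        by (rule continuous_on_mult[OF _ c2]) (intro continuous_intros)
      show "0 \<le> norm x ^ d * (P n x * (P n x / P (n - 1) x))" if "x \<noteq> 0" for x
        using Pn[OF that] by simp
    qed
    then show ?thesis by (simp add: I_def)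
  qed
  ultimately show ?thesis by (simp add: ennreal_le_iff)
qed

theorem isotropic_rigidity:
  fixes k l :: nat and \<psi> \<psi>1 \<psi>2 :: "real \<times> real \<Rightarrow> real"
  assumes lk: "l < k" and kn: "k \<le> n"
    and \<psi>_deriv: "\<And>s t. s > 0 \<Longrightarrow> t > 0 \<Longrightarrow>
        (\<psi> has_derivative (\<lambda>v. \<psi>1 (s, t) * fst v + \<psi>2 (s, t) * snd v)) (at (s, t))"
    and \<psi>_cont: "continuous_on ({0<..} \<times> {0<..}) \<psi>1" "continuous_on ({0<..} \<times> {0<..}) \<psi>2"
    and \<psi>_pos: "\<And>s t. s > 0 \<Longrightarrow> t > 0 \<Longrightarrow> \<psi> (s, t) > 0"
    and \<psi>_mono: "\<And>s t. s > 0 \<Longrightarrow> t > 0 \<Longrightarrow> \<psi>1 (s, t) \<ge> 0" "\<And>s t. s > 0 \<Longrightarrow> t > 0 \<Longrightarrow> \<psi>2 (s, t) \<ge> 0"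
    and \<psi>_strict: "\<And>s t. s > 0 \<Longrightarrow> t > 0 \<Longrightarrow> \<psi>1 (s, t) > 0 \<or> \<psi>2 (s, t) > 0"
    and eq: "\<And>z. norm z = 1 \<Longrightarrow> P k z / P l z = \<psi> (h z, norm (X z)) ^ (k - l)"
    and x: "x \<noteq> 0"
  shows "Y x = 0"
proof -
  define d where "d = k - l"
  have d: "d > 0" using lk by (simp add: d_def)
  have ln: "l < n" using lk kn by simp
  \<comment> \<open>The arguments of \<psi> on the unit sphere, extended to be homogeneous of degree
    0.\<close>
  define p where "p x = (h x / norm x, norm (X x))" for x
  have X0: "X x \<noteq> 0" if "x \<noteq> 0" for x using h_pos[OF that] by (auto simp: h_def)
  have p_pos: "fst (p x) > 0" "snd (p x) > 0" if "x \<noteq> 0" for x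
    using h_pos[OF that] X0[OF that] that by (simp_all add: p_def)
  \<comment> \<open>The gradients of the components are \<open>Y x\<close> over
    \<open>norm x\<close> and, by the symmetry of A, \<open>A x (X x)\<close> over
    \<open>norm (X x)\<close>.\<close>
  define p' where "p' x v = ((Y x \<bullet> v) / norm x, (A x (X x) \<bullet> v) / norm (X x))" for x v
  have p_deriv: "(p has_derivative p' x) (at x)" if x: "x \<noteq> 0" for x
  proof -
    have 1: "((\<lambda>x. h x / norm x) has_derivative (\<lambda>v. (Y x \<bullet> v) / norm x)) (at x)"
    proof -
      have "((\<lambda>x. h x / norm x) has_derivative
        (\<lambda>v. - h x * (inverse (norm x) * ((x \<bullet> v) / norm x) * inverse (norm x)) + (X x \<bullet> v) / norm x)) (at x)"
        using has_derivative_divide[OF h_deriv[OF x] norm_has_derivative[OF x]] x by simp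
      moreover have "- h x * (inverse (norm x) * ((x \<bullet> v) / norm x) * inverse (norm x)) + (X x \<bullet> v) / norm x = (Y x \<bullet> v) / norm x" for v
        using x by (simp add: Y_def q_def inner_diff_left dot_square_norm power2_eq_square field_simps)
      ultimately show ?thesis by simp
    qed
    have 2: "((\<lambda>x. norm (X x)) has_derivative (\<lambda>v. (A x (X x) \<bullet> v) / norm (X x))) (at x)"
      using has_derivative_compose[OF X_deriv[OF x] norm_has_derivative[OF X0[OF x]]] A_sym[OF x]
      by (simp add: inner_commute)
    show ?thesis unfolding p_def[abs_def] p'_def[abs_def] by (rule has_derivative_Pair[OF 1 2])
  qed
  have p_cont: "continuous_on (- {0}) p" by (rule punctured_cont[OF p_deriv])
  have psi_comp: "continuous_on (- {0}) (\<lambda>x. \<phi> (p x))" if "continuous_on ({0<..} \<times> {0<..}) \<phi>" for \<phi> :: "real \<times> real \<Rightarrow> real"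
    by (rule continuous_on_compose2[OF that p_cont], rule image_subsetI) (simp add: mem_Times_iff p_pos)
  define f where "f x = \<psi> (p x) ^ d" for x
  define f' where "f' x v = real d * (\<psi> (p x) ^ (d - 1) * (\<psi>1 (p x) * fst (p' x v) + \<psi>2 (p x) * snd (p' x v)))" for x v
  have \<psi>p_deriv: "((\<lambda>x. \<psi> (p x)) has_derivative (\<lambda>v. \<psi>1 (p x) * fst (p' x v) + \<psi>2 (p x) * snd (p' x v))) (at x)"
    if x: "x \<noteq> 0" for x
  proof (rule has_derivative_compose[OF p_deriv[OF x]])
    show "(\<psi> has_derivative (\<lambda>v. \<psi>1 (p x) * fst v + \<psi>2 (p x) * snd v)) (at (p x))"
      using \<psi>_deriv[OF p_pos[OF x]] by simp
  qed
  have f_deriv: "(f has_derivative f' x) (at x)" if x: "x \<noteq> 0" for x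
    using has_derivative_power[OF \<psi>p_deriv[OF x], of d] unfolding f_def[abs_def] f'_def[abs_def]
    by (simp add: mult_ac)
  have \<psi>p_cont: "continuous_on (- {0}) (\<lambda>x. \<psi> (p x))" by (rule punctured_cont[OF \<psi>p_deriv])
  have AX_cont: "continuous_on (- {0}) (\<lambda>x. A x (X x))" by (intro continuous_intros A_cont X_cont)
  have f'_gen_cont: "continuous_on (- {0}) (\<lambda>x. f' x (g x))" if "continuous_on (- {0}) g" for g
  proof -
    have 1: "continuous_on (- {0}) (\<lambda>x. (Y x \<bullet> g x) / norm x)"
      by (rule continuous_on_divide[OF continuous_on_inner[OF Y_cont that] continuous_on_norm[OF continuous_on_id]]) simp
    have 2: "continuous_on (- {0}) (\<lambda>x. (A x (X x) \<bullet> g x) / norm (X x))"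
      by (rule continuous_on_divide[OF continuous_on_inner[OF AX_cont that] continuous_on_norm[OF X_cont]]) (simp add: X0)
    show ?thesis unfolding f'_def p'_def fst_conv snd_conv
      by (rule continuous_on_mult[OF continuous_on_const continuous_on_mult[OF continuous_on_power[OF \<psi>p_cont]
        continuous_on_add[OF continuous_on_mult[OF psi_comp[OF \<psi>_cont(1)] 1] continuous_on_mult[OF psi_comp[OF \<psi>_cont(2)] 2]]]])
  qed
  define G where "G x = f' x (newton_op l (A x) (Y x))" for x
  have G_cont: "continuous_on (- {0}) G"
    unfolding G_def by (rule f'_gen_cont) (intro continuous_intros newton_cont Y_cont)
  \<comment> \<open>The Newton transformation of Y pairs positively with Y and with
    \<open>A Y\<close>, and of the two nonnegative partial derivatives of \<psi> at least one is
    positive.\<close>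
  have G_pos: "G x \<ge> 0 \<and> (Y x \<noteq> 0 \<longrightarrow> G x > 0)" if x: "x \<noteq> 0" for x
  proof (cases "Y x = 0")
    case True
    then show ?thesis by (simp add: G_def f'_def p'_def)
  next
    case False
    let ?T = "newton_op l (A x) (Y x)"
    have AXY: "A x (X x) = A x (Y x)" using A_radial[OF x] by (simp add: Y_def blinfun.bilinear_simps)
    have a: "(Y x \<bullet> ?T) / norm x > 0" "(A x (X x) \<bullet> ?T) / norm (X x) > 0"
      using newton_op_pos[OF x Y_radial[OF x] False ln] x X0[OF x] by (simp_all add: AXY inner_commute)
    have "\<psi>1 (p x) * ((Y x \<bullet> ?T) / norm x) + \<psi>2 (p x) * ((A x (X x) \<bullet> ?T) / norm (X x)) > 0"
    proof -
      have pos: "u * r + v * s > 0" if "u \<ge> 0" "v \<ge> 0" "u > 0 \<or> v > 0" "r > 0" "s > 0" for u v r s :: real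
        using that by (auto intro: add_pos_nonneg add_nonneg_pos)
      show ?thesis
        using pos[OF _ _ _ a] \<psi>_strict[OF p_pos[OF x]] \<psi>_mono[OF p_pos[OF x]] unfolding prod.collapse by blast
    qed
    moreover have "\<psi> (p x) > 0" using \<psi>_pos[OF p_pos[OF x]] by simp
    ultimately have "G x > 0" unfolding G_def f'_def p'_def fst_conv snd_conv using d by simp
    then show ?thesis by simp
  qed
  \<comment> \<open>The equation is given on the unit sphere only; f has degree 0, and the power of
    the norm compensates the degree \<open>l - k\<close> of \<open>P k / P l\<close>.\<close>
  have f_hom: "f x = norm x ^ d * P k x / P l x" if x: "x \<noteq> 0" for x
  proof -
    let ?z = "x /\<^sub>R norm x"
    have ni: "inverse (norm x) > 0" using x by simp
    have z1: "norm ?z = 1" using x by simp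
    have "P k ?z / P l ?z = (P k x * norm x ^ k) / (P l x * norm x ^ l)"
      using P_homogeneous[OF x ni] by (simp add: power_inverse divide_inverse)
    also have "\<dots> = norm x ^ d * P k x / P l x"
      using x power_add[of "norm x" d l] lk by (simp add: d_def)
    finally have "norm x ^ d * P k x / P l x = \<psi> (h ?z, norm (X ?z)) ^ d" using eq[OF z1] by (simp add: d_def)
    also have "(h ?z, norm (X ?z)) = p x"
      using h_homogeneous[OF x ni] X_homogeneous[OF x ni] by (simp add: p_def divide_inverse_commute)
    finally show ?thesis by (simp add: f_def)
  qed
  have Pl: "P l x > 0" "P k x > 0" if "x \<noteq> 0" for x using P_pos[OF that] ln kn by simp_all
  let ?B = "\<lambda>x. f x * (P (Suc l) x - q x * P l x)"
  have f_cont: "continuous_on (- {0}) f" by (rule punctured_cont[OF f_deriv])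
  have B_cont: "continuous_on (- {0}) ?B" by (intro continuous_intros f_cont P_cont q_cont)
  have Bx: "?B x = norm x ^ d * (P k x * P (Suc l) x / P l x - q x * P k x)" if x: "x \<noteq> 0" for x
    unfolding f_hom[OF x] using Pl(1)[OF x] by (simp add: field_simps)
  have idt: "I G + real (Suc l * (n choose Suc l)) * I ?B = 0"
    by (rule I_identity[OF ln f_deriv f'_gen_cont[OF continuous_on_const] _ G_cont]) (assumption | rule G_def[symmetric])+
  have "I ?B \<ge> 0"
  proof (cases "k = n")
    case False
    then have k: "k < n" using kn by simp
    have "I (\<lambda>x. norm x ^ d * (P (Suc k) x - q x * P k x)) \<le> I ?B"
    proof (rule I_mono[OF _ B_cont])
      show "continuous_on (- {0}) (\<lambda>x. norm x ^ d * (P (Suc k) x - q x * P k x))"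
        by (intro continuous_intros P_cont q_cont)
      fix x :: 'a assume x: "x \<noteq> 0"
      have "P (Suc k) x \<le> P k x * P (Suc l) x / P l x"
        using P_ratio[OF x, of l k] lk Pl(1)[OF x] by (simp add: le_divide_eq)
      then show "norm x ^ d * (P (Suc k) x - q x * P k x) \<le> ?B x"
        unfolding Bx[OF x] by (intro mult_left_mono) auto
    qed
    then show ?thesis unfolding I_minkowski[OF k] .
  next
    case True
    \<comment> \<open>For \<open>k = n\<close> the quotient \<open>P n / P (n - 1)\<close> replaces
      the vanishing \<open>P (n + 1) / P n\<close>; since \<open>l \<le> n - 1\<close>, Newton's
      inequality still compares it with \<open>P (l + 1) / P l\<close>.\<close>
    define B2 where "B2 x = norm x ^ d * (P n x * (P n x / P (n - 1) x)) + (- 1) * (norm x ^ d * (q x * P n x))" for x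
    have ne: "P (n - 1) x > 0" if "x \<noteq> 0" for x using P_pos[OF that] by simp
    have c1: "continuous_on (- {0}) (\<lambda>x. norm x ^ d * (P n x * (P n x / P (n - 1) x)))"
      by (intro continuous_intros P_cont) (use ne in force)
    have c2: "continuous_on (- {0}) (\<lambda>x. (- 1) * (norm x ^ d * (q x * P n x)))"
      by (intro continuous_intros P_cont q_cont)
    have "I B2 = I (\<lambda>x. norm x ^ d * (P n x * (P n x / P (n - 1) x))) + (- 1) * I (\<lambda>x. norm x ^ d * (q x * P n x))"
      unfolding B2_def[abs_def] by (simp only: I_add[OF c1 c2] I_cmult)
    then have "I B2 \<ge> 0" using I_heintze_karcher[of d] by simp
    also have "I B2 \<le> I ?B"
    proof (rule I_mono[OF _ B_cont])
      show "continuous_on (- {0}) B2" unfolding B2_def[abs_def] by (intro continuous_on_add c1 c2)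
      fix x :: 'a assume x: "x \<noteq> 0"
      have "P n x * P l x \<le> P (n - 1) x * P (Suc l) x"
        using P_ratio[OF x, of l "n - 1"] ln n_pos by simp
      then have "P n x / P (n - 1) x \<le> P (Suc l) x / P l x"
        using ne[OF x] Pl(1)[OF x] by (simp add: field_simps)
      then have "P n x * (P n x / P (n - 1) x) \<le> P n x * (P (Suc l) x / P l x)"
        using P_pos[OF x, of n] by (intro mult_left_mono) auto
      then have "norm x ^ d * (P n x * (P n x / P (n - 1) x) - q x * P n x) \<le>
          norm x ^ d * (P n x * P (Suc l) x / P l x - q x * P n x)"
        by (intro mult_left_mono) auto
      then show "B2 x \<le> ?B x" unfolding Bx[OF x] True B2_def by (simp add: right_diff_distrib)
    qed
    finally show ?thesis .
  qed
  then have "real (Suc l * (n choose Suc l)) * I ?B \<ge> 0" by (intro mult_nonneg_nonneg) auto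
  then have IG: "I G \<le> 0" using idt by linarith
  have G0: "G y = 0" if "1 < norm y" "norm y < 2" for y
    by (rule I_zero_imp[OF G_cont _ IG that]) (use G_pos in auto)
  \<comment> \<open>Any norm strictly between 1 and 2 would do: G vanishes inside the shell, and Y
    is homogeneous of degree 0.\<close>
  define y where "y = (3 / 2 / norm x) *\<^sub>R x"
  have ny: "norm y = 3 / 2" and y0: "y \<noteq> 0" using x by (simp_all add: y_def)
  have "G y = 0" using G0 ny by simp
  then have "Y y = 0" using G_pos[OF y0] by force
  moreover have "Y y = Y x" unfolding y_def by (rule Y_homogeneous[OF x]) (use x in simp)
  ultimately show ?thesis by simp
qed

text \<open>Y is a multiple of the gradient of \<open>h x / norm x\<close>, and the punctured space
  is connected in dimension at least 2.\<close>

theorem ball_if_Y_zero: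
  assumes "\<And>x. x \<noteq> 0 \<Longrightarrow> Y x = 0"
  obtains R where "R > 0" "\<And>x. x \<noteq> 0 \<Longrightarrow> X x = (R / norm x) *\<^sub>R x"
proof -
  have der: "((\<lambda>x. h x / norm x) has_derivative (\<lambda>v. 0)) (at x)" if x: "x \<in> - {0}" for x
  proof -
    have x: "x \<noteq> 0" using that by simp
    have "X x = q x *\<^sub>R x" using assms[OF x] by (simp add: Y_def)
    then have "(X x \<bullet> v) / norm x = h x * (inverse (norm x) * ((x \<bullet> v) / norm x) * inverse (norm x))" for v
      using x by (simp add: q_def dot_square_norm power2_eq_square field_simps)
    then show ?thesis
      using has_derivative_divide[OF h_deriv[OF x] norm_has_derivative[OF x]] x by simp
  qed
  obtain b :: 'a where b: "b \<in> Basis" using nonempty_Basis by blast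
  have con: "connected (- {0::'a})" by (rule connected_punctured_universe[OF dim2])
  have const: "h x / norm x = h b / norm b" if "x \<noteq> 0" for x
    by (rule has_derivative_zero_unique_connected[OF open_punctured con der]) (use that b nonzero_Basis in auto)
  define R where "R = h b / norm b"
  have R: "R > 0" using h_pos[of b] b nonzero_Basis by (auto simp: R_def)
  have "X x = (R / norm x) *\<^sub>R x" if x: "x \<noteq> 0" for x
  proof -
    have "X x = q x *\<^sub>R x" using assms[OF x] by (simp add: Y_def)
    also have "q x = R / norm x" using const[OF x] by (simp add: q_def R_def[symmetric] dot_square_norm power2_eq_square)
      (metis divide_divide_eq_left)
    finally show ?thesis .
  qed
  then show ?thesis using that R by blast
qed

end

section \<open>Calculus on the sphere\<close>

text \<open>Bouligand's contingent directions. A derivative \<open>at p within S\<close> is selected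
  by choice, and in these directions it is determined by the function.\<close>

definition contingent :: "'a::real_normed_vector set \<Rightarrow> 'a \<Rightarrow> 'a \<Rightarrow> bool" where
  "contingent S p v \<longleftrightarrow> (\<forall>e>0. \<exists>t>0. t < e \<and> (\<exists>x\<in>S. norm (x - (p + t *\<^sub>R v)) \<le> e * t))"

text \<open>The difference of two derivatives is linear and of smaller order along S; points of S
  close to \<open>p + t v\<close> carry this over to v after division by t.\<close>

lemma contingent_derivative_unique:
  fixes f :: "'a::real_normed_vector \<Rightarrow> 'b::real_normed_vector"
  assumes c: "contingent S p v" and D: "(f has_derivative D) (at p within S)" "(f has_derivative D') (at p within S)"
  shows "D v = D' v"
proof -
  define L where "L w = D w - D' w" for w
  have L: "((\<lambda>x. 0) has_derivative L) (at p within S)"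
    using has_derivative_diff[OF D] by (simp add: L_def[abs_def])
  then have bl: "bounded_linear L" by (rule has_derivative_bounded_linear)
  then obtain B where B: "B > 0" "\<And>w. norm (L w) \<le> norm w * B" using bounded_linear.pos_bounded by blast
  have lin: "linear L" using bl by (rule bounded_linear.linear)
  have "norm (L v) \<le> e" if "e > 0" for e
  proof -
    define a where "a = e / (norm v + 1 + B)"
    have den: "norm v + 1 + B > 0" using B by (simp add: add_nonneg_pos add_pos_pos)
    have a: "a > 0" using that den by (simp add: a_def)
    obtain d where d: "d > 0" "\<And>x. x \<in> S \<Longrightarrow> norm (x - p) < d \<Longrightarrow> norm (L (x - p)) \<le> a * norm (x - p)"
      using L a unfolding has_derivative_within_alt by auto
    define b where "b = Min {a, 1, d / (norm v + 1)}"
    have nv: "norm v + 1 > 0" by (simp add: add_nonneg_pos)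
    have b: "b > 0" "b \<le> a" "b \<le> 1" "b \<le> d / (norm v + 1)" using a d nv by (auto simp: b_def)
    obtain t x where t: "t > 0" "t < b" "x \<in> S" "norm (x - (p + t *\<^sub>R v)) \<le> b * t"
      using c b(1) unfolding contingent_def by blast
    have nx: "norm (x - p) \<le> t * (norm v + 1)"
    proof -
      have "norm (x - p) \<le> norm (x - (p + t *\<^sub>R v)) + norm (t *\<^sub>R v)"
        using norm_triangle_ineq[of "x - (p + t *\<^sub>R v)" "t *\<^sub>R v"] by simp
      also have "\<dots> \<le> 1 * t + t * norm v" using t b by (intro add_mono order_trans[OF t(4)] mult_right_mono) auto
      finally show ?thesis by (simp add: algebra_simps)
    qed
    also have "\<dots> < d" using t b nv by (meson le_divide_eq less_le_trans mult_strict_right_mono order_less_le_trans pos_less_divide_eq)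
    finally have L1: "norm (L (x - p)) \<le> a * norm (x - p)" using d(2)[OF t(3)] by simp
    have "t * norm (L v) = norm (L (x - p) - L (x - (p + t *\<^sub>R v)))"
      using t(1) by (simp add: linear_diff[OF lin, symmetric] linear_scale[OF lin])
    also have "\<dots> \<le> norm (L (x - p)) + norm (L (x - (p + t *\<^sub>R v)))" by (rule norm_triangle_ineq4)
    also have "\<dots> \<le> a * (t * (norm v + 1)) + (b * t) * B"
      using L1 nx a B t(4) by (intro add_mono order_trans[OF L1] mult_left_mono order_trans[OF B(2)] mult_right_mono) auto
    also have "\<dots> \<le> a * (t * (norm v + 1)) + (a * t) * B"
      using b t B by (intro add_left_mono mult_right_mono) auto
    also have "\<dots> = t * (a * (norm v + 1 + B))" by (simp add: algebra_simps)
    also have "a * (norm v + 1 + B) = e" using den by (simp add: a_def)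
    finally show ?thesis using t(1) by simp
  qed
  then have "norm (L v) \<le> 0" by (rule field_le_epsilon[of _ 0, simplified])
  then show ?thesis by (simp add: L_def)
qed

text \<open>The intermediate value theorem along the gradient: f changes sign between the points
  \<open>p + t v - k t g\<close> and \<open>p + t v + k t g\<close>, so it has a zero within
  \<open>e t\<close> of \<open>p + t v\<close>.\<close>

lemma contingent_level_set:
  fixes f :: "'a::euclidean_space \<Rightarrow> real"
  assumes U: "open U" "p \<in> U" and cont: "continuous_on U f" and f: "(f has_derivative (\<lambda>v. g \<bullet> v)) (at p)"
    and p: "f p = 0" and g: "g \<noteq> 0" and v: "g \<bullet> v = 0" and M: "\<And>x. x \<in> U \<Longrightarrow> f x = 0 \<Longrightarrow> x \<in> M"
  shows "contingent M p v"
  unfolding contingent_def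
proof (intro allI impI)
  fix e :: real assume e: "e > 0"
  \<comment> \<open>Makes the correction along g at most \<open>k t norm g = e t\<close>; the
    constant a below keeps the first-order error within half of the change
    \<open>k t (norm g)\<^sup>2\<close>.\<close>
  define k where "k = e / norm g"
  have k: "k > 0" using e g by (simp add: k_def)
  define c where "c = norm v + k * norm g + 1"
  have c: "c > 0" using k by (simp add: c_def add_nonneg_pos)
  define a where "a = k * (norm g)\<^sup>2 / (2 * c)"
  have a: "a > 0" using k g c by (simp add: a_def)
  obtain d where d: "d > 0" "\<And>x. norm (x - p) < d \<Longrightarrow> norm (f x - f p - g \<bullet> (x - p)) \<le> a * norm (x - p)"
    using has_derivative_remainder[OF f a] by blast
  obtain r where r: "r > 0" "ball p r \<subseteq> U" using U open_contains_ball by blast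
  define t where "t = Min {e / 2, d / (2 * c), r / (2 * c)}"
  have t: "t > 0" "t < e" "t \<le> d / (2 * c)" "t \<le> r / (2 * c)" using e d r c by (auto simp: t_def min_less_iff_disj)
  have tc: "t * c < d" "t * c < r" 
    using t(3,4) d(1) r(1) c by (auto simp: field_simps)
  define z where "z \<theta> = p + (t *\<^sub>R v + \<theta> *\<^sub>R g)" for \<theta>
  have nz: "norm (t *\<^sub>R v + \<theta> *\<^sub>R g) < t * c" if "\<bar>\<theta>\<bar> \<le> k * t" for \<theta>
  proof -
    have "norm (t *\<^sub>R v + \<theta> *\<^sub>R g) \<le> t * norm v + \<bar>\<theta>\<bar> * norm g"
      using norm_triangle_ineq[of "t *\<^sub>R v" "\<theta> *\<^sub>R g"] t(1) by simp
    also have "\<dots> \<le> t * norm v + (k * t) * norm g" using that by (intro add_left_mono mult_right_mono) auto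
    also have "\<dots> < t * c" using t(1) by (simp add: c_def algebra_simps)
    finally show ?thesis .
  qed
  have zU: "z \<theta> \<in> U" if "\<bar>\<theta>\<bar> \<le> k * t" for \<theta>
    using nz[OF that] tc(2) unfolding z_def by (intro subsetD[OF r(2)]) (simp only: in_ball_translate)
  have fz: "\<bar>f (z \<theta>) - \<theta> * (norm g)\<^sup>2\<bar> \<le> a * (t * c)" if "\<bar>\<theta>\<bar> \<le> k * t" for \<theta>
  proof -
    have "norm (z \<theta> - p) < d" using nz[OF that] tc(1) by (simp add: z_def)
    from d(2)[OF this] have "norm (f (z \<theta>) - \<theta> * (norm g)\<^sup>2) \<le> a * norm (t *\<^sub>R v + \<theta> *\<^sub>R g)"
      using p v by (simp add: z_def inner_add_right dot_square_norm)
    also have "\<dots> \<le> a * (t * c)" using nz[OF that] a by (intro mult_left_mono) auto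
    finally show ?thesis by simp
  qed
  have atc: "a * (t * c) = k * t * (norm g)\<^sup>2 / 2" using c by (simp add: a_def)
  have pos: "k * t * (norm g)\<^sup>2 > 0" using k t g by simp
  have kt: "k * t \<ge> 0" using k t by simp
  have "f (z (k * t)) \<ge> 0" "f (z (- (k * t))) \<le> 0"
  proof -
    define m where "m = k * t * (norm g)\<^sup>2"
    have "\<bar>f (z (k * t)) - m\<bar> \<le> m / 2" "\<bar>f (z (- (k * t))) + m\<bar> \<le> m / 2"
      using fz[of "k * t"] fz[of "- (k * t)"] kt unfolding atc by (simp_all add: m_def)
    moreover have "m > 0" using pos by (simp add: m_def)
    ultimately show "f (z (k * t)) \<ge> 0" "f (z (- (k * t))) \<le> 0" by linarith+
  qed
  moreover have "continuous_on {- (k * t)..k * t} (\<lambda>\<theta>. f (z \<theta>))"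
    by (rule continuous_on_compose2[OF cont]) (use zU in \<open>auto simp: z_def[abs_def] abs_le_iff intro!: continuous_intros\<close>)
  ultimately obtain \<theta> where \<theta>: "- (k * t) \<le> \<theta>" "\<theta> \<le> k * t" "f (z \<theta>) = 0"
    using IVT'[of "\<lambda>\<theta>. f (z \<theta>)" "- (k * t)" 0 "k * t"] kt by auto
  have \<theta>': "\<bar>\<theta>\<bar> \<le> k * t" using \<theta> by simp
  have "norm (z \<theta> - (p + t *\<^sub>R v)) = \<bar>\<theta>\<bar> * norm g" by (simp add: z_def)
  also have "\<dots> \<le> k * t * norm g" using \<theta>' by (intro mult_right_mono) auto
  also have "\<dots> = e * t" using g by (simp add: k_def)
  finally show "\<exists>t>0. t < e \<and> (\<exists>x\<in>M. norm (x - (p + t *\<^sub>R v)) \<le> e * t)"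
    using t M[OF zU[OF \<theta>'] \<theta>(3)] by blast
qed

lemma contingent_sphere:
  assumes z: "norm z = 1" and v: "v \<bullet> z = 0"
  shows "contingent (sphere 0 1) z (v :: 'a::euclidean_space)"
proof (rule contingent_level_set[of UNIV z "\<lambda>x. x \<bullet> x - 1" "2 *\<^sub>R z"])
  show "((\<lambda>x. x \<bullet> x - 1) has_derivative (\<lambda>v. (2 *\<^sub>R z) \<bullet> v)) (at z)"
    by (auto intro!: derivative_eq_intros simp: fun_eq_iff inner_commute)
  show "x \<in> sphere 0 1" if "x \<bullet> x - 1 = 0" for x :: 'a
    using that by (simp add: norm_eq_1)
qed (use z v in \<open>auto simp: dot_square_norm inner_commute intro!: continuous_intros\<close>)

text \<open>Tangent vectors are contingent to the sphere, so the derivatives selected in the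
  definitions can be read off from any differentiable extension.\<close>

lemma sphere_frechet_derivative:
  assumes f: "(f has_derivative D) (at z within sphere 0 1)" and z: "norm z = 1" "v \<bullet> z = 0"
  shows "frechet_derivative f (at z within sphere 0 1) v = D (v :: 'a::euclidean_space)"
proof -
  have "(f has_derivative frechet_derivative f (at z within sphere 0 1)) (at z within sphere 0 1)"
    using f differentiableI frechet_derivative_works by blast
  then show ?thesis using contingent_derivative_unique[OF contingent_sphere[OF z]] f by blast
qed

section \<open>Sphere quantities in terms of the homogeneous extension\<close>

context smooth_body_dim
begin

abbreviation u :: "'a \<Rightarrow> real" where "u \<equiv> support_fun K"

lemma support_fun_eq: assumes "z \<noteq> 0" shows "u z = h z"
  unfolding support_fun_def h_def
  by (rule cSup_eq_maximum) (use X_in[OF assms] X_max[OF assms] in auto)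

text \<open>\<open>X z\<close> is the Euclidean gradient of the extension, and Y is its part tangent
  to the sphere.\<close>

lemma sph_grad_eq: assumes z: "norm z = 1" shows "sph_grad u z = Y z"
proof -
  have z0: "z \<noteq> 0" using z by auto
  have zz: "z \<bullet> z = 1" using z by (simp add: dot_square_norm)
  have "(u has_derivative (\<lambda>v. X z \<bullet> v)) (at z)"
    by (rule has_derivative_transform_within_open[OF h_deriv[OF z0] open_punctured])
      (use z0 support_fun_eq in auto)
  then have "(u has_derivative (\<lambda>v. X z \<bullet> v)) (at z within sphere 0 1)" by (rule has_derivative_at_withinI)
  then have fd: "frechet_derivative u (at z within sphere 0 1) v = X z \<bullet> v" if "v \<in> sph_tangent z" for v
    using sphere_frechet_derivative z that by (simp add: sph_tangent_def)
  have YT: "Y z \<in> sph_tangent z" using Y_radial[OF z0] by (simp add: sph_tangent_def)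
  have Yv: "Y z \<bullet> v = X z \<bullet> v" if "v \<in> sph_tangent z" for v
  proof -
    have "z \<bullet> v = 0" using that by (simp add: sph_tangent_def inner_commute)
    then show ?thesis by (simp add: Y_def inner_diff_left)
  qed
  show ?thesis unfolding sph_grad_def
  proof (rule the_equality)
    show "Y z \<in> sph_tangent z \<and> (\<forall>v\<in>sph_tangent z. Y z \<bullet> v = frechet_derivative u (at z within sphere 0 1) v)"
      using YT Yv fd by simp
    fix g assume g: "g \<in> sph_tangent z \<and> (\<forall>v\<in>sph_tangent z. g \<bullet> v = frechet_derivative u (at z within sphere 0 1) v)"
    have dT: "g - Y z \<in> sph_tangent z" using g YT by (simp add: sph_tangent_def inner_diff_left)
    have "(g - Y z) \<bullet> (g - Y z) = 0"
      unfolding inner_diff_left[of g "Y z"] using g dT fd[OF dT] Yv[OF dT] by simp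
    then show "g = Y z" by simp
  qed
qed

lemma boundary_point_eq: assumes z: "norm z = 1" shows "boundary_point u z = X z"
proof -
  have "z \<noteq> 0" using z by auto
  then show ?thesis
    using z by (simp add: boundary_point_def sph_grad_eq support_fun_eq Y_def q_def dot_square_norm)
qed

text \<open>The derivative of Y is A minus q times the identity minus a radial term. Tangent vectors
  do not see the radial term, and q cancels against the summand \<open>u z\<close> because q and u
  agree on the unit sphere.\<close>

lemma W_form_eq:
  assumes z: "norm z = 1" and v: "v \<in> sph_tangent z" and w: "w \<in> sph_tangent z"
  shows "W_form u z v w = A z v \<bullet> w"
proof -
  have z0: "z \<noteq> 0" using z by auto
  let ?D = "\<lambda>v. A z v - (q z *\<^sub>R v + q' z v *\<^sub>R z)"
  have "(sph_grad u has_derivative ?D) (at z within sphere 0 1)"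
    by (rule has_derivative_transform_within[OF has_derivative_at_withinI[OF Y_deriv[OF z0]], of 1])
      (use z sph_grad_eq in auto)
  then have fd: "frechet_derivative (sph_grad u) (at z within sphere 0 1) v = ?D v"
    using sphere_frechet_derivative z v by (simp add: sph_tangent_def)
  have "z \<bullet> w = 0" using w by (simp add: sph_tangent_def inner_commute)
  then show ?thesis
    unfolding W_form_def sph_hessian_def sph_connection_def Let_def fd
    using z0 z by (simp add: inner_diff_left inner_add_left support_fun_eq q_def dot_square_norm)
qed

lemma P_W_eq: assumes z: "norm z = 1" shows "P_W i u z = P i z"
proof -
  have z0: "z \<noteq> 0" using z by auto
  obtain E \<mu> where E: "orthonormal_set E" "span E = {v. v \<bullet> z = 0}" "finite E" "card E = DIM('a) - 1"
    "\<And>e. e \<in> E \<Longrightarrow> A z e = \<mu> e *\<^sub>R e" "\<And>e. e \<in> E \<Longrightarrow> \<mu> e > 0" "z /\<^sub>R norm z \<notin> E"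
    "\<mu> (z /\<^sub>R norm z) = 0" "eigenbasis (A z) (insert (z /\<^sub>R norm z) E) \<mu>"
    "\<And>m. op_esym m (A z) = esym E \<mu> m"
    by (rule eigen_frame[OF z0], rule that; assumption)
  have T: "sph_tangent z = {v. v \<bullet> z = 0}" by (simp add: sph_tangent_def)
  have "subspace (sph_tangent z)" unfolding T by (auto simp: subspace_def inner_add_left)
  then have "eigenvalues_on (sph_tangent z) (W_form u z) = sorted_list_of_multiset (image_mset \<mu> (mset_set E))"
    by (rule eigenvalues_on_eq[where A="A z"])
      (use E(1,2,5) W_form_eq[OF z] T in \<open>auto intro: bounded_linear.linear[OF blinfun.bounded_linear_right]\<close>)
  then show ?thesis unfolding P_W_def
    using normalized_esym_eigenvalues[OF E(3)] E(4,10) dim_n by (simp add: P_def esym_mean_def)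
qed

text \<open>A boundary point has a supporting hyperplane, so by uniqueness it is X of an outer
  normal. Conversely X fixes the sphere of radius R, and interior points cannot attain the support
  function.\<close>

lemma frontier_sphere:
  assumes R: "R > 0" "\<And>x. x \<noteq> 0 \<Longrightarrow> X x = (R / norm x) *\<^sub>R x"
  shows "frontier K = sphere 0 R"
proof
  show "frontier K \<subseteq> sphere 0 R"
  proof
    fix p assume p: "p \<in> frontier K"
    have pK: "p \<in> K" using p K_compact by (simp add: frontier_def compact_imp_closed closure_closed)
    have ni: "p \<notin> rel_interior K"
      using p K_0 rel_interior_nonempty_interior[of K] by (auto simp: frontier_def)
    obtain a where a: "a \<noteq> 0" "\<And>x. x \<in> K \<Longrightarrow> a \<bullet> p \<le> a \<bullet> x"
    proof (rule supporting_hyperplane_rel_boundary[OF K_convex pK ni])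
      fix b assume "b \<noteq> 0" "\<And>y. y \<in> K \<Longrightarrow> b \<bullet> p \<le> b \<bullet> y"
      then show thesis by (rule that)
    qed
    have "p = X (- a)"
    proof (rule X_unique)
      show "- a \<noteq> 0" using a by simp
      show "p \<bullet> - a = h (- a)"
      proof (rule antisym)
        show "p \<bullet> - a \<le> h (- a)" using X_max[of "- a" p] a pK by (simp add: h_def)
        have "X (- a) \<in> K" using X_in[of "- a"] a by auto
        then show "h (- a) \<le> p \<bullet> - a" using a(2)[of "X (- a)"] by (simp add: h_def inner_commute)
      qed
    qed (rule pK)
    then show "p \<in> sphere 0 R" using R(1) R(2)[of "- a"] a by simp
  qed
  show "sphere 0 R \<subseteq> frontier K"
  proof
    fix z :: 'a assume z: "z \<in> sphere 0 R"
    then have z0: "z \<noteq> 0" and nz: "norm z = R" using R(1) by auto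
    have "X z = z" using R(2)[OF z0] nz R(1) by simp
    then have "z \<in> K" "z \<notin> interior K"
      using X_in[OF z0] interior_below_h[of z z] z0 by (auto simp: h_def)
    then show "z \<in> frontier K" using closure_subset by (auto simp: frontier_def)
  qed
qed

text \<open>Passes from one-variable partial derivatives to values of the Frechet derivative and
  from the root of order \<open>k - l\<close> to a power, as \<open>isotropic_rigidity\<close>
  requires.\<close>

theorem sphere_if_isotropic:
  fixes k l :: nat and \<psi> :: "real \<times> real \<Rightarrow> real"
  assumes lk: "l < k" and kn: "k \<le> n"
    and \<psi>_pos: "\<And>s t. s > 0 \<Longrightarrow> t > 0 \<Longrightarrow> \<psi> (s, t) > 0"
    and \<psi>_C1: "Ck_on 1 ({0<..} \<times> {0<..}) \<psi>"
    and \<psi>_mono1: "\<And>s t. s > 0 \<Longrightarrow> t > 0 \<Longrightarrow> deriv (\<lambda>x. \<psi> (x, t)) s \<ge> 0"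
    and \<psi>_mono2: "\<And>s t. s > 0 \<Longrightarrow> t > 0 \<Longrightarrow> deriv (\<lambda>y. \<psi> (s, y)) t \<ge> 0"
    and \<psi>_strict: "\<And>s t. s > 0 \<Longrightarrow> t > 0 \<Longrightarrow>
           deriv (\<lambda>x. \<psi> (x, t)) s > 0 \<or> deriv (\<lambda>y. \<psi> (s, y)) t > 0"
    and eq: "\<And>z. z \<in> sphere 0 1 \<Longrightarrow>
           (P_W k u z / P_W l u z) powr (1 / (real k - real l)) = \<psi> (u z, radial_fun u z)"
  shows "\<exists>R>0. frontier K = sphere 0 R"
proof -
  define \<psi>1 where "\<psi>1 p = frechet_derivative \<psi> (at p) (1, 0)" for p
  define \<psi>2 where "\<psi>2 p = frechet_derivative \<psi> (at p) (0, 1)" for p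
  have C: "\<forall>p\<in>{0<..} \<times> {0<..}. \<psi> differentiable (at p)"
    "\<And>v. continuous_on ({0<..} \<times> {0<..}) (\<lambda>p. frechet_derivative \<psi> (at p) v)"
    using \<psi>_C1 unfolding One_nat_def Ck_on.simps by blast+
  have der: "(\<psi> has_derivative (\<lambda>v. \<psi>1 (s, t) * fst v + \<psi>2 (s, t) * snd v)) (at (s, t))" if "s > 0" "t > 0" for s t
  proof -
    let ?D = "frechet_derivative \<psi> (at (s, t))"
    have D: "(\<psi> has_derivative ?D) (at (s, t))" using C(1) that by (simp add: frechet_derivative_works)
    have lin: "linear ?D" using D by (rule has_derivative_linear)
    have "?D v = \<psi>1 (s, t) * fst v + \<psi>2 (s, t) * snd v" for v
    proof -
      have "?D v = ?D (fst v *\<^sub>R (1, 0) + snd v *\<^sub>R (0, 1))" by simp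
      also have "\<dots> = fst v * ?D (1, 0) + snd v * ?D (0, 1)"
        by (simp only: linear_add[OF lin] linear_scale[OF lin] real_scaleR_def)
      finally show ?thesis by (simp add: \<psi>1_def \<psi>2_def mult.commute)
    qed
    then have "?D = (\<lambda>v. \<psi>1 (s, t) * fst v + \<psi>2 (s, t) * snd v)" by (rule ext)
    then show ?thesis using D by simp
  qed
  have d1: "deriv (\<lambda>x. \<psi> (x, t)) s = \<psi>1 (s, t)" if "s > 0" "t > 0" for s t
  proof (rule DERIV_imp_deriv)
    have "((\<lambda>x. (x, t)) has_derivative (\<lambda>h. (h, 0))) (at s)"
      by (intro has_derivative_Pair has_derivative_ident has_derivative_const)
    from has_derivative_compose[OF this der[OF that]]
    show "((\<lambda>x. \<psi> (x, t)) has_real_derivative \<psi>1 (s, t)) (at s)" by (simp add: has_field_derivative_def mult_commute_abs)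
  qed
  have d2: "deriv (\<lambda>y. \<psi> (s, y)) t = \<psi>2 (s, t)" if "s > 0" "t > 0" for s t
  proof (rule DERIV_imp_deriv)
    have "((\<lambda>y. (s, y)) has_derivative (\<lambda>h. (0, h))) (at t)"
      by (intro has_derivative_Pair has_derivative_ident has_derivative_const)
    from has_derivative_compose[OF this der[OF that]]
    show "((\<lambda>y. \<psi> (s, y)) has_real_derivative \<psi>2 (s, t)) (at t)" by (simp add: has_field_derivative_def mult_commute_abs)
  qed
  have eq': "P k z / P l z = \<psi> (h z, norm (X z)) ^ (k - l)" if z: "norm z = 1" for z :: 'a
  proof -
    have z0: "z \<noteq> 0" using z by auto
    have pos: "P k z / P l z > 0" using P_pos[OF z0, of k] P_pos[OF z0, of l] lk kn by simp
    have kl: "real k - real l = real (k - l)" "real (k - l) > 0" using lk by (simp_all add: of_nat_diff)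
    have "(P_W k u z / P_W l u z) powr (1 / (real k - real l)) = \<psi> (u z, radial_fun u z)"
      by (rule eq) (use z in simp)
    then have "(P k z / P l z) powr (1 / real (k - l)) = \<psi> (h z, norm (X z))"
      unfolding P_W_eq[OF z] support_fun_eq[OF z0] radial_fun_def boundary_point_eq[OF z] kl .
    then have "\<psi> (h z, norm (X z)) ^ (k - l) = ((P k z / P l z) powr (1 / real (k - l))) ^ (k - l)"
      by simp
    also have "\<dots> = ((P k z / P l z) powr (1 / real (k - l))) powr real (k - l)"
      by (rule powr_realpow[symmetric]) (metis pos powr_gt_zero less_irrefl)
    also have "\<dots> = (P k z / P l z) powr (1 / real (k - l) * real (k - l))" by (rule powr_powr)
    also have "1 / real (k - l) * real (k - l) = 1" using lk by simp
    also have "(P k z / P l z) powr 1 = P k z / P l z" using pos by (intro powr_one) simp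
    finally show ?thesis by (rule sym)
  qed
  have Y0: "Y x = 0" if "x \<noteq> 0" for x
    by (rule isotropic_rigidity[OF lk kn der _ _ \<psi>_pos _ _ _ eq' that])
      (use C(2) \<psi>_mono1 \<psi>_mono2 \<psi>_strict d1 d2 in \<open>auto simp: \<psi>1_def[abs_def] \<psi>2_def[abs_def]\<close>)
  obtain R where R: "R > 0" "\<And>x. x \<noteq> 0 \<Longrightarrow> X x = (R / norm x) *\<^sub>R x"
    by (rule ball_if_Y_zero[OF Y0], assumption, rule that; assumption)
  show ?thesis using frontier_sphere[OF R] R(1) by blast
qed

end

section \<open>Regularity of the inverse Gauss map\<close>

text \<open>A sum of rank-one operators over the basis, so that regularity of an operator-valued map
  follows from that of its values on single vectors. It represents L when L is linear.\<close>

definition op_of :: "('a::euclidean_space \<Rightarrow> 'b::real_normed_vector) \<Rightarrow> ('a \<Rightarrow>\<^sub>L 'b)" where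
  "op_of L = (\<Sum>b\<in>Basis. blinfun_scaleR_left (L b) o\<^sub>L blinfun_inner_left b)"

lemma op_of_apply:
  assumes "linear L"
  shows "blinfun_apply (op_of L) v = L v"
proof -
  have "blinfun_apply (op_of L) v = (\<Sum>b\<in>Basis. (v \<bullet> b) *\<^sub>R L b)"
    by (simp add: op_of_def blinfun.sum_left)
  also have "\<dots> = L (\<Sum>b\<in>Basis. (v \<bullet> b) *\<^sub>R b)"
    by (simp add: linear_sum[OF assms] linear_scale[OF assms])
  finally show ?thesis by (simp add: euclidean_representation)
qed

lemma op_of_blinfun: "op_of (blinfun_apply L) = L"
  by (rule blinfun_eqI) (simp add: op_of_apply bounded_linear.linear blinfun.bounded_linear_right)

lemma bounded_linear_rank_one:
  "bounded_linear (\<lambda>u. blinfun_scaleR_left u o\<^sub>L blinfun_inner_left b)"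
  by (rule bounded_linear_compose[OF bounded_bilinear.bounded_linear_left[OF bounded_bilinear_blinfun_compose]
        bounded_linear_blinfun_scaleR_left])

lemma op_of_has_derivative:
  assumes "\<And>b. ((\<lambda>x. L x b) has_derivative L' b) F"
  shows "((\<lambda>x. op_of (L x)) has_derivative (\<lambda>w. op_of (\<lambda>b. L' b w))) F"
  unfolding op_of_def
  by (intro has_derivative_sum bounded_linear.has_derivative[OF bounded_linear_rank_one] assms)

lemma op_of_continuous_on:
  assumes "\<And>b. continuous_on S (\<lambda>x. L x b)"
  shows "continuous_on S (\<lambda>x. op_of (L x))"
  unfolding op_of_def
  by (intro continuous_on_sum bounded_linear.continuous_on[OF bounded_linear_rank_one] assms)

text \<open>The second claim is the resolvent identity; it yields the limit once \<open>I y\<close>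
  is known to be bounded near y0.\<close>

lemma blinfun_inverse_tendsto:
  fixes B :: "'x::real_normed_vector \<Rightarrow> ('e::real_normed_vector \<Rightarrow>\<^sub>L 'e)"
  assumes V: "open V" "y0 \<in> V" and inv: "\<And>y. y \<in> V \<Longrightarrow> I y o\<^sub>L B y = id_blinfun" "\<And>y. y \<in> V \<Longrightarrow> B y o\<^sub>L I y = id_blinfun"
    and B: "(B \<longlongrightarrow> B y0) (at y0)"
  shows "(I \<longlongrightarrow> I y0) (at y0)"
    and "\<And>y. y \<in> V \<Longrightarrow> I y - I y0 = - (I y o\<^sub>L (B y - B y0) o\<^sub>L I y0)"
proof -
  show diff: "I y - I y0 = - (I y o\<^sub>L (B y - B y0) o\<^sub>L I y0)" if y: "y \<in> V" for y
  proof (rule blinfun_eqI)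
    fix v
    have 1: "I y (B y w) = w" for w using arg_cong[OF inv(1)[OF y], of "\<lambda>L. blinfun_apply L w"] by simp
    have 2: "B y0 (I y0 w) = w" for w using arg_cong[OF inv(2)[OF V(2)], of "\<lambda>L. blinfun_apply L w"] by simp
    show "blinfun_apply (I y - I y0) v = blinfun_apply (- (I y o\<^sub>L (B y - B y0) o\<^sub>L I y0)) v"
      by (simp add: blinfun.bilinear_simps 1 2)
  qed
  define c where "c = norm (I y0)"
  have c0: "c \<ge> 0" by (simp add: c_def)
  have evV: "\<forall>\<^sub>F y in at y0. y \<in> V" using V eventually_at_topological by blast
  have nB: "((\<lambda>y. norm (B y - B y0)) \<longlongrightarrow> 0) (at y0)" using B by (simp add: LIM_zero tendsto_norm_zero)
  then have ev1: "\<forall>\<^sub>F y in at y0. norm (B y - B y0) < 1 / (2 * c + 1)"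
    by (rule order_tendstoD(2)) (use c0 in simp)
  have le: "norm (I y - I y0) \<le> norm (I y) * norm (B y - B y0) * c" if "y \<in> V" for y
  proof -
    have "norm (I y - I y0) \<le> norm (I y o\<^sub>L (B y - B y0)) * c"
      unfolding diff[OF that] norm_minus_cancel c_def by (rule norm_blinfun_compose)
    also have "\<dots> \<le> (norm (I y) * norm (B y - B y0)) * c"
      by (intro mult_right_mono norm_blinfun_compose c0)
    finally show ?thesis .
  qed
  have "\<forall>\<^sub>F y in at y0. norm (I y - I y0) \<le> (2 * c) * norm (B y - B y0) * c"
    using evV ev1
  proof eventually_elim
    case (elim y)
    have "norm (I y) \<le> 2 * c"
    proof -
      have "norm (B y - B y0) * c \<le> 1 / 2"
      proof -
        have "norm (B y - B y0) * c \<le> 1 / (2 * c + 1) * c" using elim c0 by (intro mult_right_mono) auto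
        also have "\<dots> \<le> 1 / 2" using c0 by (simp add: field_simps)
        finally show ?thesis .
      qed
      then have "norm (I y) * (norm (B y - B y0) * c) \<le> norm (I y) * (1 / 2)" by (intro mult_left_mono) auto
      moreover have "norm (I y) \<le> norm (I y - I y0) + c" unfolding c_def using norm_triangle_sub[of "I y" "I y0"] by simp
      ultimately show ?thesis using le[OF elim(1)] by (simp add: mult.assoc)
    qed
    then have "norm (I y) * norm (B y - B y0) * c \<le> (2 * c) * norm (B y - B y0) * c"
      using c0 by (intro mult_right_mono) auto
    then show ?case using le[OF elim(1)] by simp
  qed
  moreover have "((\<lambda>y. (2 * c) * norm (B y - B y0) * c) \<longlongrightarrow> 0) (at y0)"
    using tendsto_mult_right_zero[OF tendsto_mult_left_zero[OF nB, of c], of "2 * c"] by (simp add: mult.assoc)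
  ultimately have "((\<lambda>y. I y - I y0) \<longlongrightarrow> 0) (at y0)" by (rule Lim_null_comparison)
  then show "(I \<longlongrightarrow> I y0) (at y0)" by (rule LIM_zero_cancel)
qed

text \<open>In the resolvent identity the increment of B is replaced by its linear part and
  \<open>I y\<close> by \<open>I y0\<close>; the errors are the remainder of B and the increment of
  I, both tending to zero.\<close>

lemma blinfun_inverse_has_derivative:
  fixes B :: "'x::real_normed_vector \<Rightarrow> ('e::real_normed_vector \<Rightarrow>\<^sub>L 'e)"
  assumes V: "open V" "y0 \<in> V" and inv: "\<And>y. y \<in> V \<Longrightarrow> I y o\<^sub>L B y = id_blinfun" "\<And>y. y \<in> V \<Longrightarrow> B y o\<^sub>L I y = id_blinfun"
    and B: "(B has_derivative B') (at y0)"
  shows "(I has_derivative (\<lambda>w. - (I y0 o\<^sub>L B' w o\<^sub>L I y0))) (at y0)"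
proof -
  have Bt: "(B \<longlongrightarrow> B y0) (at y0)" using has_derivative_continuous[OF B] by (simp add: continuous_at)
  have It: "(I \<longlongrightarrow> I y0) (at y0)" by (rule blinfun_inverse_tendsto(1)[OF V inv Bt]; assumption)
  have diff: "I y - I y0 = - (I y o\<^sub>L (B y - B y0) o\<^sub>L I y0)" if "y \<in> V" for y
    by (rule blinfun_inverse_tendsto(2)[OF V inv Bt that]; assumption)
  have bl: "bounded_linear B'" using B by (rule has_derivative_bounded_linear)
  define r where "r y = (1 / norm (y - y0)) *\<^sub>R (B y - (B y0 + B' (y - y0)))" for y
  have r: "(r \<longlongrightarrow> 0) (at y0)" using B by (simp add: has_derivative_at2 r_def[abs_def])
  obtain k where k: "\<And>w. norm (B' w) \<le> norm w * k" "k > 0" using bounded_linear.pos_bounded[OF bl] by blast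
  have lin: "bounded_linear (\<lambda>w. - (I y0 o\<^sub>L B' w o\<^sub>L I y0))"
    by (intro bounded_linear_minus bounded_linear_compose[OF bounded_bilinear.bounded_linear_left[OF bounded_bilinear_blinfun_compose]]
        bounded_linear_compose[OF bounded_bilinear.bounded_linear_right[OF bounded_bilinear_blinfun_compose] bl])
  have evV: "\<forall>\<^sub>F y in at y0. y \<in> V" using V eventually_at_topological by blast
  have "\<forall>\<^sub>F y in at y0. norm ((1 / norm (y - y0)) *\<^sub>R (I y - (I y0 + - (I y0 o\<^sub>L B' (y - y0) o\<^sub>L I y0)))) \<le>
      norm (I y) * norm (r y) * norm (I y0) + norm (I y - I y0) * k * norm (I y0)"
    using evV eventually_neq_at_within[of y0]
  proof eventually_elim
    case (elim y)
    let ?n = "norm (y - y0)"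
    have n: "?n > 0" using elim by simp
    have By: "B y - B y0 = ?n *\<^sub>R r y + B' (y - y0)" using n by (simp add: r_def algebra_simps)
    have "(1 / ?n) *\<^sub>R (I y - (I y0 + - (I y0 o\<^sub>L B' (y - y0) o\<^sub>L I y0))) =
        (1 / ?n) *\<^sub>R (- (I y o\<^sub>L (?n *\<^sub>R r y + B' (y - y0)) o\<^sub>L I y0) + (I y0 o\<^sub>L B' (y - y0) o\<^sub>L I y0))"
    proof -
      have "I y - (I y0 + - (I y0 o\<^sub>L B' (y - y0) o\<^sub>L I y0)) = (I y - I y0) + (I y0 o\<^sub>L B' (y - y0) o\<^sub>L I y0)" by simp
      then show ?thesis unfolding diff[OF elim(1)] By by simp
    qed
    also have "\<dots> = - (I y o\<^sub>L r y o\<^sub>L I y0) - ((I y - I y0) o\<^sub>L ((1 / ?n) *\<^sub>R B' (y - y0)) o\<^sub>L I y0)"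
      using n by (intro blinfun_eqI) (simp add: blinfun.bilinear_simps scaleR_diff_right scaleR_add_right)
    also have "norm \<dots> \<le> norm (I y o\<^sub>L r y o\<^sub>L I y0) + norm ((I y - I y0) o\<^sub>L ((1 / ?n) *\<^sub>R B' (y - y0)) o\<^sub>L I y0)"
      using norm_triangle_ineq4[of "- (I y o\<^sub>L r y o\<^sub>L I y0)"] by simp
    also have "\<dots> \<le> norm (I y) * norm (r y) * norm (I y0) + norm (I y - I y0) * k * norm (I y0)"
    proof (rule add_mono)
      show "norm (I y o\<^sub>L r y o\<^sub>L I y0) \<le> norm (I y) * norm (r y) * norm (I y0)"
        by (intro order_trans[OF norm_blinfun_compose] mult_right_mono norm_blinfun_compose) simp
      have "norm ((1 / ?n) *\<^sub>R B' (y - y0)) \<le> k" using k(1)[of "y - y0"] n by (simp add: divide_le_eq mult.commute)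
      then show "norm ((I y - I y0) o\<^sub>L ((1 / ?n) *\<^sub>R B' (y - y0)) o\<^sub>L I y0) \<le> norm (I y - I y0) * k * norm (I y0)"
        by (intro order_trans[OF norm_blinfun_compose] mult_right_mono order_trans[OF norm_blinfun_compose] mult_left_mono) auto
    qed
    finally show ?case .
  qed
  moreover have "((\<lambda>y. norm (I y) * norm (r y) * norm (I y0) + norm (I y - I y0) * k * norm (I y0)) \<longlongrightarrow>
      norm (I y0) * norm (0 :: 'e \<Rightarrow>\<^sub>L 'e) * norm (I y0) + norm (I y0 - I y0) * k * norm (I y0)) (at y0)"
    by (intro tendsto_intros It r)
  then have "((\<lambda>y. norm (I y) * norm (r y) * norm (I y0) + norm (I y - I y0) * k * norm (I y0)) \<longlongrightarrow> 0) (at y0)"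
    by (simp only: norm_zero mult_zero_left mult_zero_right diff_self add_0_left)
  ultimately have "((\<lambda>y. (1 / norm (y - y0)) *\<^sub>R (I y - (I y0 + - (I y0 o\<^sub>L B' (y - y0) o\<^sub>L I y0)))) \<longlongrightarrow> 0) (at y0)"
    by (rule Lim_null_comparison)
  then show ?thesis unfolding has_derivative_at2 by (rule conjI[OF lin])
qed

text \<open>The inverse function theorem gives the derivative of G as the inverse of
  \<open>D (G y)\<close>; differentiating operator inversion along G gives the next order. The
  inverse will carry the gradient of the support function, whose own second derivatives are
  wanted.\<close>

theorem local_inverse_C2:
  fixes \<Phi> :: "'e::euclidean_space \<Rightarrow> 'e" and D :: "'e \<Rightarrow> 'e \<Rightarrow> 'e" and D2 :: "'e \<Rightarrow> 'e \<Rightarrow> 'e \<Rightarrow> 'e"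
  assumes U: "open U" "x0 \<in> U" and D: "\<And>x. x \<in> U \<Longrightarrow> (\<Phi> has_derivative D x) (at x)"
    and D2: "\<And>x v. x \<in> U \<Longrightarrow> ((\<lambda>x. D x v) has_derivative D2 x v) (at x)"
    and D2c: "\<And>v w. continuous_on U (\<lambda>x. D2 x v w)"
    and ker: "\<And>v. D x0 v = 0 \<Longrightarrow> v = 0"
  obtains U' V G and G1 :: "'e \<Rightarrow> ('e \<Rightarrow>\<^sub>L 'e)" and G2 :: "'e \<Rightarrow> 'e \<Rightarrow> ('e \<Rightarrow>\<^sub>L 'e)" where
    "open U'" "U' \<subseteq> U" "x0 \<in> U'" "inj_on \<Phi> U'" "open V" "\<Phi> x0 \<in> V"
    "\<And>y. y \<in> V \<Longrightarrow> G y \<in> U'" "\<And>y. y \<in> V \<Longrightarrow> \<Phi> (G y) = y"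
    "\<And>y. y \<in> V \<Longrightarrow> (G has_derivative G1 y) (at y)" "\<And>y. y \<in> V \<Longrightarrow> (G1 has_derivative G2 y) (at y)"
    "\<And>w. continuous_on V (\<lambda>y. G2 y w)" "\<And>y w. y \<in> V \<Longrightarrow> D (G y) (G1 y w) = w"
proof -
  define B where "B x = op_of (D x)" for x
  define B1 where "B1 x w = op_of (\<lambda>b. D2 x b w)" for x w
  have lin: "linear (D x)" if "x \<in> U" for x using D[OF that] by (rule has_derivative_linear)
  have BD: "blinfun_apply (B x) = D x" if "x \<in> U" for x
    by (rule ext) (simp add: B_def op_of_apply[OF lin[OF that]])
  have Bder: "(B has_derivative B1 x) (at x)" if "x \<in> U" for x
    unfolding B_def[abs_def] B1_def by (rule op_of_has_derivative[OF D2[OF that]])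
  have Bc: "continuous_on U B"
    using Bder by (meson continuous_at_imp_continuous_on has_derivative_continuous)
  have derB: "(\<Phi> has_derivative blinfun_apply (B x)) (at x)" if "x \<in> U" for x
    using D[OF that] BD[OF that] by simp
  have inj: "inj (D x0)"
    unfolding linear_injective_0[OF lin[OF U(2)]] using ker by blast
  obtain g where g: "linear g" "g \<circ> D x0 = id"
    using linear_injective_left_inverse[OF lin[OF U(2)] inj] by blast
  have "op_of g o\<^sub>L B x0 = id_blinfun"
  proof (rule blinfun_eqI)
    fix v
    show "blinfun_apply (op_of g o\<^sub>L B x0) v = blinfun_apply id_blinfun v"
      using g(2) by (simp add: op_of_apply[OF g(1)] BD[OF U(2)] fun_eq_iff)
  qed
  from inverse_function_theorem[OF U(1) derB Bc U(2) this]
  obtain U' V G g' where IFT: "open U'" "U' \<subseteq> U" "x0 \<in> U'" "open V" "\<Phi> x0 \<in> V" "homeomorphism U' V \<Phi> G"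
    "\<And>y. y \<in> V \<Longrightarrow> (G has_derivative (g' y)) (at y)"
    "\<And>y. y \<in> V \<Longrightarrow> g' y = inv (blinfun_apply (B (G y)))"
    "\<And>y. y \<in> V \<Longrightarrow> bij (blinfun_apply (B (G y)))"
    by metis
  have GU: "G y \<in> U'" "\<Phi> (G y) = y" if "y \<in> V" for y
    using IFT(6) that unfolding homeomorphism_def by auto
  then have GU2: "G y \<in> U" if "y \<in> V" for y using IFT(2) that by blast
  have injU: "inj_on \<Phi> U'" using IFT(6) unfolding homeomorphism_def by (metis inj_on_inverseI)
  define G1 where "G1 y = op_of (g' y)" for y
  have G1: "blinfun_apply (G1 y) = g' y" if "y \<in> V" for y
    by (rule ext) (simp add: G1_def op_of_apply has_derivative_linear[OF IFT(7)[OF that]])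
  have inv1: "G1 y o\<^sub>L B (G y) = id_blinfun" if y: "y \<in> V" for y
    by (rule blinfun_eqI) (simp add: G1[OF y] IFT(8)[OF y] inv_f_f[OF bij_is_inj[OF IFT(9)[OF y]]])
  have inv2: "B (G y) o\<^sub>L G1 y = id_blinfun" if y: "y \<in> V" for y
    by (rule blinfun_eqI) (simp add: G1[OF y] IFT(8)[OF y] surj_f_inv_f[OF bij_is_surj[OF IFT(9)[OF y]]])
  have Gder: "(G has_derivative blinfun_apply (G1 y)) (at y)" if "y \<in> V" for y
    using IFT(7)[OF that] G1[OF that] by simp
  define G2 where "G2 y w = - (G1 y o\<^sub>L B1 (G y) (G1 y w) o\<^sub>L G1 y)" for y w
  have G1der: "(G1 has_derivative G2 y) (at y)" if y: "y \<in> V" for y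
  proof -
    have BG: "((\<lambda>y. B (G y)) has_derivative (\<lambda>w. B1 (G y) (G1 y w))) (at y)"
      by (rule has_derivative_compose[OF Gder[OF y] Bder[OF GU2[OF y]]])
    have "(G1 has_derivative (\<lambda>w. - (G1 y o\<^sub>L B1 (G y) (G1 y w) o\<^sub>L G1 y))) (at y)"
      by (rule blinfun_inverse_has_derivative[OF IFT(4) y inv1 inv2 BG]; assumption)
    then show ?thesis unfolding G2_def[abs_def] .
  qed
  have Gc: "continuous_on V G" and G1c: "continuous_on V G1"
    using Gder G1der by (meson continuous_at_imp_continuous_on has_derivative_continuous)+
  have lin2: "linear (D2 x b)" if "x \<in> U" for x b using D2[OF that] by (rule has_derivative_linear)
  have B1c: "continuous_on V (\<lambda>y. B1 (G y) (G1 y w))" for w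
    unfolding B1_def
  proof (rule op_of_continuous_on)
    fix b
    have "continuous_on V (\<lambda>y. op_of (D2 (G y) b))"
      by (rule op_of_continuous_on, rule continuous_on_compose2[OF D2c Gc]) (use GU2 in auto)
    then have "continuous_on V (\<lambda>y. blinfun_apply (op_of (D2 (G y) b)) (blinfun_apply (G1 y) w))"
      by (intro continuous_intros G1c)
    then show "continuous_on V (\<lambda>y. D2 (G y) b (blinfun_apply (G1 y) w))"
      by (rule continuous_on_eq) (simp add: op_of_apply lin2 GU2)
  qed
  have G2c: "continuous_on V (\<lambda>y. G2 y w)" for w
    unfolding G2_def
    by (intro continuous_on_minus bounded_bilinear.continuous_on[OF bounded_bilinear_blinfun_compose] G1c B1c)
  have DG: "D (G y) (G1 y w) = w" if y: "y \<in> V" for y w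
    using arg_cong[OF inv2[OF y], of "\<lambda>L. blinfun_apply L w"] BD[OF GU2[OF y]] by simp
  show ?thesis
    by (rule that[of U' V G G1 G2]) (assumption | rule IFT(1,2,3) injU IFT(4,5) GU Gder G1der G2c DG)+
qed

text \<open>Three orders of \<open>Ck_on\<close> are spent: one for the gradient and two for its
  continuous derivatives.\<close>

lemma smooth_on_gradient:
  fixes f :: "'a::euclidean_space \<Rightarrow> real"
  assumes "smooth_on U f"
  obtains g :: "'a \<Rightarrow> 'a" and Dg :: "'a \<Rightarrow> 'a \<Rightarrow> 'a" and D2g :: "'a \<Rightarrow> 'a \<Rightarrow> 'a \<Rightarrow> 'a" where
    "\<And>x. x \<in> U \<Longrightarrow> (f has_derivative (\<lambda>v. g x \<bullet> v)) (at x)"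
    "\<And>x. x \<in> U \<Longrightarrow> (g has_derivative Dg x) (at x)"
    "\<And>x v. x \<in> U \<Longrightarrow> ((\<lambda>x. Dg x v) has_derivative D2g x v) (at x)"
    "\<And>v w. continuous_on U (\<lambda>x. D2g x v w)"
proof -
  have "Ck_on (Suc (Suc (Suc 0))) U f" using assms unfolding smooth_on_def by blast
  then have C: "\<And>x. x \<in> U \<Longrightarrow> f differentiable (at x)"
    "\<And>b x. x \<in> U \<Longrightarrow> (\<lambda>x. frechet_derivative f (at x) b) differentiable (at x)"
    "\<And>b v x. x \<in> U \<Longrightarrow> (\<lambda>x. frechet_derivative (\<lambda>x. frechet_derivative f (at x) b) (at x) v) differentiable (at x)"
    "\<And>b v w. continuous_on U (\<lambda>x. frechet_derivative (\<lambda>x. frechet_derivative (\<lambda>x. frechet_derivative f (at x) b) (at x) v) (at x) w)"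
    unfolding Ck_on.simps by blast+
  define f1 where "f1 x b = frechet_derivative f (at x) b" for x b
  define f2 where "f2 x b v = frechet_derivative (\<lambda>x. f1 x b) (at x) v" for x b v
  define f3 where "f3 x b v w = frechet_derivative (\<lambda>x. f2 x b v) (at x) w" for x b v w
  have d1: "(f has_derivative f1 x) (at x)" if "x \<in> U" for x
    using C(1)[OF that] by (simp add: f1_def[abs_def] frechet_derivative_works)
  have d2: "((\<lambda>x. f1 x b) has_derivative f2 x b) (at x)" if "x \<in> U" for x b
    using C(2)[OF that, of b] by (simp add: f1_def f2_def[abs_def] frechet_derivative_works)
  have d3: "((\<lambda>x. f2 x b v) has_derivative f3 x b v) (at x)" if "x \<in> U" for x b v
    using C(3)[OF that, of b v] by (simp add: f1_def f2_def f3_def[abs_def] frechet_derivative_works)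
  have c3: "continuous_on U (\<lambda>x. f3 x b v w)" for b v w
    using C(4)[of b v w] by (simp add: f1_def f2_def f3_def)
  show ?thesis
  proof
    show "(f has_derivative (\<lambda>v. (\<Sum>b\<in>Basis. f1 x b *\<^sub>R b) \<bullet> v)) (at x)" if x: "x \<in> U" for x
    proof -
      have lin: "linear (f1 x)" using d1[OF x] by (rule has_derivative_linear)
      have "f1 x v = (\<Sum>b\<in>Basis. f1 x b *\<^sub>R b) \<bullet> v" for v
      proof -
        have "f1 x v = f1 x (\<Sum>b\<in>Basis. (v \<bullet> b) *\<^sub>R b)" by (simp add: euclidean_representation)
        also have "\<dots> = (\<Sum>b\<in>Basis. f1 x b *\<^sub>R b) \<bullet> v"
          by (simp add: linear_sum[OF lin] linear_scale[OF lin] inner_sum_left inner_commute[of v] mult.commute)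
        finally show ?thesis .
      qed
      then have "f1 x = (\<lambda>v. (\<Sum>b\<in>Basis. f1 x b *\<^sub>R b) \<bullet> v)" by (rule ext)
      then show ?thesis by (rule has_derivative_eq_rhs[OF d1[OF x]])
    qed
    show "((\<lambda>x. \<Sum>b\<in>Basis. f1 x b *\<^sub>R b) has_derivative (\<lambda>v. \<Sum>b\<in>Basis. f2 x b v *\<^sub>R b)) (at x)" if "x \<in> U" for x
      by (intro has_derivative_sum has_derivative_scaleR_left d2 that)
    show "((\<lambda>x. \<Sum>b\<in>Basis. f2 x b v *\<^sub>R b) has_derivative (\<lambda>w. \<Sum>b\<in>Basis. f3 x b v w *\<^sub>R b)) (at x)"
      if "x \<in> U" for x v
      by (intro has_derivative_sum has_derivative_scaleR_left d3 that)
    show "continuous_on U (\<lambda>x. \<Sum>b\<in>Basis. f3 x b v w *\<^sub>R b)" for v w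
      by (intro continuous_on_sum continuous_on_scaleR c3 continuous_on_const)
  qed
qed

section \<open>Normals and curvature from a local defining function\<close>

locale convex_body =
  fixes K :: "'a::euclidean_space set"
  assumes K_convex: "convex K" and K_compact: "compact K" and K_0: "0 \<in> interior K"
begin

lemma frontier_in_K: "x \<in> frontier K \<Longrightarrow> x \<in> K"
  using K_compact by (simp add: frontier_def compact_imp_closed closure_closed)

lemma supporting_normal:
  assumes p: "p \<in> frontier K"
  obtains \<nu> where "norm \<nu> = 1" "\<And>y. y \<in> K \<Longrightarrow> \<nu> \<bullet> (y - p) \<le> 0"
proof -
  have ni: "p \<notin> rel_interior K"
    using p K_0 rel_interior_nonempty_interior[of K] by (auto simp: frontier_def)
  show ?thesis
  proof (rule supporting_hyperplane_rel_boundary[OF K_convex frontier_in_K[OF p] ni])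
    fix a assume a: "a \<noteq> 0" "\<And>y. y \<in> K \<Longrightarrow> a \<bullet> p \<le> a \<bullet> y"
    show thesis
    proof (rule that)
      show "norm (- (a /\<^sub>R norm a)) = 1" using a(1) by simp
      show "- (a /\<^sub>R norm a) \<bullet> (y - p) \<le> 0" if "y \<in> K" for y
        using a that by (simp add: inner_diff_right field_simps)
    qed
  qed
qed

lemma normal_pos:
  assumes "norm \<nu> = 1" "\<And>y. y \<in> K \<Longrightarrow> \<nu> \<bullet> (y - p) \<le> 0"
  shows "\<nu> \<bullet> p > 0"
proof -
  obtain r where r: "r > 0" "cball 0 r \<subseteq> K" using K_0 mem_interior_cball by blast
  have "r *\<^sub>R \<nu> \<in> K" using r assms(1) by (intro subsetD[OF r(2)]) simp
  from assms(2)[OF this] have "r \<le> \<nu> \<bullet> p" using assms(1) by (simp add: inner_diff_right dot_square_norm)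
  then show ?thesis using r by simp
qed

text \<open>All tangent directions are contingent to the boundary, so the supporting inequality
  gives \<open>\<nu> \<bullet> v \<le> 0\<close> for each of them; taking for v the tangential part
  of \<nu> shows that this part is zero.\<close>

lemma normal_parallel:
  assumes U: "open U" "p \<in> U" and cont: "continuous_on U f" and f: "(f has_derivative (\<lambda>v. g \<bullet> v)) (at p)"
    and p: "f p = 0" and g: "g \<noteq> 0" and M: "\<And>x. x \<in> U \<Longrightarrow> f x = 0 \<Longrightarrow> x \<in> frontier K"
    and \<nu>: "\<And>y. y \<in> K \<Longrightarrow> \<nu> \<bullet> (y - p) \<le> 0"
  shows "\<nu> = ((\<nu> \<bullet> g) / (g \<bullet> g)) *\<^sub>R g"
proof -
  have le: "\<nu> \<bullet> v \<le> 0" if v: "g \<bullet> v = 0" for v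
  proof (rule field_le_epsilon)
    fix e :: real assume e: "e > 0"
    define a where "a = e / (norm \<nu> + 1)"
    have n1: "norm \<nu> + 1 > 0" by (simp add: add_nonneg_pos)
    have a: "a > 0" using e n1 by (simp add: a_def)
    obtain t x where t: "t > 0" "x \<in> frontier K" "norm (x - (p + t *\<^sub>R v)) \<le> a * t"
      using contingent_level_set[OF U cont f p g v M] a unfolding contingent_def by blast
    have "\<nu> \<bullet> (t *\<^sub>R v) = \<nu> \<bullet> (x - p) - \<nu> \<bullet> (x - (p + t *\<^sub>R v))" by (simp add: inner_diff_right inner_add_right)
    also have "\<dots> \<le> 0 + norm \<nu> * (a * t)"
    proof -
      have "- (\<nu> \<bullet> (x - (p + t *\<^sub>R v))) \<le> norm \<nu> * norm (x - (p + t *\<^sub>R v))"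
        using norm_cauchy_schwarz[of "- \<nu>" "x - (p + t *\<^sub>R v)"] by simp
      also have "\<dots> \<le> norm \<nu> * (a * t)" using t(3) by (intro mult_left_mono) auto
      finally show ?thesis using \<nu>[OF frontier_in_K[OF t(2)]] by simp
    qed
    finally have "t * (\<nu> \<bullet> v) \<le> t * (norm \<nu> * a)" by (simp add: mult_ac)
    then have "\<nu> \<bullet> v \<le> norm \<nu> * a" using t(1) by simp
    also have "\<dots> \<le> (norm \<nu> + 1) * a" using a by (intro mult_right_mono) auto
    also have "\<dots> = e" using n1 by (simp add: a_def)
    finally show "\<nu> \<bullet> v \<le> 0 + e" by simp
  qed
  define w where "w = \<nu> - ((\<nu> \<bullet> g) / (g \<bullet> g)) *\<^sub>R g"
  have gw: "g \<bullet> w = 0" using g by (simp add: w_def inner_diff_right inner_commute)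
  have "\<nu> \<bullet> w = w \<bullet> w" using gw by (simp add: w_def inner_diff_left inner_diff_right inner_commute)
  then have "w \<bullet> w \<le> 0" using le[OF gw] by simp
  then have "w \<bullet> w = 0" using inner_ge_zero[of w] by linarith
  then have "w = 0" by simp
  then show ?thesis by (simp add: w_def)
qed

end

text \<open>Since \<open>0\<close> is interior to \<open>K\<close>, the condition \<open>g x \<bullet> x > 0\<close> says that the gradient \<open>g\<close> points outwards.\<close>

locale defining_chart = convex_body K for K :: "'a::euclidean_space set" +
  fixes U :: "'a set" and f :: "'a \<Rightarrow> real" and g :: "'a \<Rightarrow> 'a" and Dg :: "'a \<Rightarrow> 'a \<Rightarrow> 'a"
    and D2g :: "'a \<Rightarrow> 'a \<Rightarrow> 'a \<Rightarrow> 'a"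
  assumes open_U: "open U"
    and f_deriv: "x \<in> U \<Longrightarrow> (f has_derivative (\<lambda>v. g x \<bullet> v)) (at x)"
    and g_deriv: "x \<in> U \<Longrightarrow> (g has_derivative Dg x) (at x)"
    and Dg_deriv: "x \<in> U \<Longrightarrow> ((\<lambda>x. Dg x v) has_derivative D2g x v) (at x)"
    and D2g_cont: "continuous_on U (\<lambda>x. D2g x v w)"
    and level: "x \<in> U \<Longrightarrow> f x = 0 \<longleftrightarrow> x \<in> frontier K"
    and g_outward: "x \<in> U \<Longrightarrow> g x \<bullet> x > 0"
begin

lemma g_nonzero: "x \<in> U \<Longrightarrow> g x \<noteq> 0"
  using g_outward by fastforce

lemma f_cont: "continuous_on U f" and g_cont: "continuous_on U g" and Dg_cont: "continuous_on U (\<lambda>x. Dg x v)"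
  using f_deriv g_deriv Dg_deriv by (meson continuous_at_imp_continuous_on has_derivative_continuous)+

lemma tangent_contingent:
  "x \<in> U \<Longrightarrow> x \<in> frontier K \<Longrightarrow> g x \<bullet> v = 0 \<Longrightarrow> contingent (frontier K) x v"
  by (rule contingent_level_set[OF open_U _ f_cont f_deriv]) (auto simp: level g_nonzero)

text \<open>\<open>normal_parallel\<close> leaves a multiple of g, whose sign is fixed because \<nu>
  and \<open>g x\<close> both have positive inner product with x.\<close>

lemma normal_unique:
  assumes x: "x \<in> U" "x \<in> frontier K" and \<nu>: "norm \<nu> = 1" "\<And>y. y \<in> K \<Longrightarrow> \<nu> \<bullet> (y - x) \<le> 0"
  shows "\<nu> = g x /\<^sub>R norm (g x)"
proof -
  define c where "c = (\<nu> \<bullet> g x) / (g x \<bullet> g x)"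
  have \<nu>c: "\<nu> = c *\<^sub>R g x"
    unfolding c_def
    by (rule normal_parallel[OF open_U x(1) f_cont f_deriv[OF x(1)] _ g_nonzero[OF x(1)] _ \<nu>(2)])
      (use level x in auto)
  have "\<nu> \<bullet> x > 0" using normal_pos[OF \<nu>] .
  then have "c > 0" using g_outward[OF x(1)] unfolding \<nu>c by (simp add: zero_less_mult_iff)
  then have "c * norm (g x) = 1" using \<nu>(1) unfolding \<nu>c by simp
  then have "c = inverse (norm (g x))" using g_nonzero[OF x(1)] by (simp add: field_simps)
  then show ?thesis using \<nu>c by simp
qed

lemma g_supports:
  assumes x: "x \<in> U" "x \<in> frontier K" and y: "y \<in> K"
  shows "g x \<bullet> (y - x) \<le> 0"
proof -
  obtain \<nu> where \<nu>: "norm \<nu> = 1" "\<And>y. y \<in> K \<Longrightarrow> \<nu> \<bullet> (y - x) \<le> 0" using supporting_normal[OF x(2)] by blast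
  have "(g x /\<^sub>R norm (g x)) \<bullet> (y - x) \<le> 0" using \<nu>(2)[OF y] normal_unique[OF x \<nu>] by simp
  then have "inverse (norm (g x)) * (g x \<bullet> (y - x)) \<le> 0" by simp
  then show ?thesis using g_nonzero[OF x(1)] by (simp add: mult_le_0_iff)
qed

lemma outer_normal_eq:
  assumes x: "x \<in> U" "x \<in> frontier K"
  shows "outer_unit_normal K x = g x /\<^sub>R norm (g x)"
  unfolding outer_unit_normal_def
proof (rule the_equality)
  show "norm (g x /\<^sub>R norm (g x)) = 1 \<and> (\<forall>y\<in>K. (g x /\<^sub>R norm (g x)) \<bullet> (y - x) \<le> 0)"
    using g_nonzero[OF x(1)] g_supports[OF x] by (simp add: mult_le_0_iff)
  show "\<nu> = g x /\<^sub>R norm (g x)" if "norm \<nu> = 1 \<and> (\<forall>y\<in>K. \<nu> \<bullet> (y - x) \<le> 0)" for \<nu>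
    using normal_unique[OF x] that by blast
qed

lemma Dg_sym: "x \<in> U \<Longrightarrow> Dg x v \<bullet> w = Dg x w \<bullet> v"
  using symmetric_second_derivative[OF open_U _ f_deriv g_deriv] by blast

lemma Dg_linear: "x \<in> U \<Longrightarrow> linear (Dg x)"
  using g_deriv has_derivative_linear by blast

text \<open>The supporting inequalities at two boundary points add up to
  \<open>(g x - g p) \<bullet> (x - p) \<ge> 0\<close>. For x close to \<open>p + t v\<close> the
  left side is \<open>t\<^sup>2 * (Dg p v \<bullet> v)\<close> up to smaller terms.\<close>

lemma Dg_nonneg:
  assumes p: "p \<in> U" "p \<in> frontier K" and v: "g p \<bullet> v = 0"
  shows "Dg p v \<bullet> v \<ge> 0"
proof (rule ccontr)
  assume "\<not> Dg p v \<bullet> v \<ge> 0"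
  define \<delta> where "\<delta> = - (Dg p v \<bullet> v)"
  have \<delta>: "\<delta> > 0" using \<open>\<not> Dg p v \<bullet> v \<ge> 0\<close> by (simp add: \<delta>_def)
  have bl: "bounded_linear (Dg p)" using g_deriv[OF p(1)] by (rule has_derivative_bounded_linear)
  have lin: "linear (Dg p)" using bl by (rule bounded_linear.linear)
  obtain B where B: "B > 0" "\<And>w. norm (Dg p w) \<le> norm w * B" using bounded_linear.pos_bounded[OF bl] by blast
  define c where "c = norm v + 1"
  have c: "c > 0" by (simp add: c_def add_nonneg_pos)
  define a where "a = \<delta> / (4 * c\<^sup>2)"
  have a: "a > 0" using \<delta> c by (simp add: a_def)
  obtain d where d: "d > 0" "\<And>x. norm (x - p) < d \<Longrightarrow> norm (g x - g p - Dg p (x - p)) \<le> a * norm (x - p)"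
    using has_derivative_remainder[OF g_deriv[OF p(1)] a] by blast
  obtain r where r: "r > 0" "ball p r \<subseteq> U" using open_U p(1) open_contains_ball by blast
  define m where "m = norm (Dg p v) + B * c + 1"
  have m: "m > 0" using B c by (simp add: m_def add_nonneg_pos add_pos_pos)
  \<comment> \<open>The bound by \<open>\<delta> / (4 * m)\<close> and the choice of a each absorb a
    quarter of \<open>\<delta> * t\<^sup>2\<close>; the last two entries keep x in U and where the
    expansion of g holds.\<close>
  define e where "e = Min {1, \<delta> / (4 * m), d / (2 * c), r / (2 * c)}"
  have e: "e > 0" "e \<le> 1" "e \<le> \<delta> / (4 * m)" "e \<le> d / (2 * c)" "e \<le> r / (2 * c)"
    using \<delta> m d r c by (auto simp: e_def)
  obtain t x where t: "t > 0" "t < e" "x \<in> frontier K" "norm (x - (p + t *\<^sub>R v)) \<le> e * t"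
    using tangent_contingent[OF p v] e(1) unfolding contingent_def by blast
  define \<rho> where "\<rho> = x - (p + t *\<^sub>R v)"
  have \<rho>: "norm \<rho> \<le> e * t" using t(4) by (simp add: \<rho>_def)
  have xp: "x - p = t *\<^sub>R v + \<rho>" by (simp add: \<rho>_def)
  have nx: "norm (x - p) \<le> t * c"
  proof -
    have "norm (x - p) \<le> t * norm v + norm \<rho>" unfolding xp using norm_triangle_ineq[of "t *\<^sub>R v" \<rho>] t(1) by simp
    also have "\<dots> \<le> t * norm v + 1 * t" using \<rho> e t by (intro add_left_mono order_trans[OF \<rho>] mult_right_mono) auto
    finally show ?thesis by (simp add: c_def algebra_simps)
  qed
  have tc: "t * c < d" "t * c < r"
  proof -
    have "t * c < e * c" using t c by simp
    moreover have "e * c \<le> d / 2" "e * c \<le> r / 2" using e(4,5) c by (simp_all add: field_simps)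
    ultimately show "t * c < d" "t * c < r" using d r by linarith+
  qed
  have xU: "x \<in> U" using nx tc(2) by (intro subsetD[OF r(2)]) (simp add: dist_norm norm_minus_commute)
  define \<sigma> where "\<sigma> = g x - g p - Dg p (x - p)"
  have \<sigma>: "norm \<sigma> \<le> a * (t * c)"
    using d(2)[of x] nx tc(1) a unfolding \<sigma>_def by (meson le_less_trans mult_left_mono less_imp_le order_trans)
  have mono: "(g x - g p) \<bullet> (x - p) \<ge> 0"
    using g_supports[OF xU t(3) frontier_in_K[OF p(2)]] g_supports[OF p frontier_in_K[OF t(3)]]
    by (simp add: inner_diff_left inner_diff_right)
  have "(g x - g p) \<bullet> (x - p) = (Dg p (x - p) + \<sigma>) \<bullet> (x - p)" by (simp add: \<sigma>_def)
  also have "\<dots> = - \<delta> * t\<^sup>2 + (t * (Dg p v \<bullet> \<rho>) + Dg p \<rho> \<bullet> (x - p) + \<sigma> \<bullet> (x - p))"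
    by (simp add: xp linear_add[OF lin] linear_scale[OF lin] inner_add_left inner_add_right \<delta>_def power2_eq_square algebra_simps)
  also have "t * (Dg p v \<bullet> \<rho>) + Dg p \<rho> \<bullet> (x - p) + \<sigma> \<bullet> (x - p) \<le>
     t * (norm (Dg p v) * (e * t)) + (e * t * B) * (t * c) + a * (t * c) * (t * c)"
  proof (intro add_mono)
    have "Dg p v \<bullet> \<rho> \<le> norm (Dg p v) * norm \<rho>" by (rule norm_cauchy_schwarz)
    also have "\<dots> \<le> norm (Dg p v) * (e * t)" using \<rho> by (intro mult_left_mono) auto
    finally show "t * (Dg p v \<bullet> \<rho>) \<le> t * (norm (Dg p v) * (e * t))" using t by simp
    have "Dg p \<rho> \<bullet> (x - p) \<le> norm (Dg p \<rho>) * norm (x - p)" by (rule norm_cauchy_schwarz)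
    also have "\<dots> \<le> (e * t * B) * (t * c)"
    proof (rule mult_mono)
      show "norm (Dg p \<rho>) \<le> e * t * B" using B \<rho> by (intro order_trans[OF B(2)] mult_right_mono) auto
    qed (use nx e t B in auto)
    finally show "Dg p \<rho> \<bullet> (x - p) \<le> (e * t * B) * (t * c)" .
    have "\<sigma> \<bullet> (x - p) \<le> norm \<sigma> * norm (x - p)" by (rule norm_cauchy_schwarz)
    also have "\<dots> \<le> a * (t * c) * (t * c)" using \<sigma> nx a t c by (intro mult_mono) auto
    finally show "\<sigma> \<bullet> (x - p) \<le> a * (t * c) * (t * c)" .
  qed
  also have "t * (norm (Dg p v) * (e * t)) + (e * t * B) * (t * c) + a * (t * c) * (t * c) =
      t\<^sup>2 * (e * (norm (Dg p v) + B * c) + a * c\<^sup>2)"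
    by (simp add: power2_eq_square algebra_simps)
  also have "\<dots> \<le> t\<^sup>2 * (\<delta> / 4 + \<delta> / 4)"
  proof (intro mult_left_mono add_mono)
    have "e * (norm (Dg p v) + B * c) \<le> e * m" using e by (intro mult_left_mono) (auto simp: m_def)
    also have "\<dots> \<le> \<delta> / 4" using e(3) m by (simp add: field_simps)
    finally show "e * (norm (Dg p v) + B * c) \<le> \<delta> / 4" .
    show "a * c\<^sup>2 \<le> \<delta> / 4" using c by (simp add: a_def)
  qed simp
  finally have "(g x - g p) \<bullet> (x - p) \<le> - (\<delta> * t\<^sup>2) / 2" by (simp add: algebra_simps)
  moreover have "\<delta> * t\<^sup>2 > 0" using \<delta> t by simp
  ultimately show False using mono by linarith
qed

text \<open>Gauss curvature is the product of the eigenvalues of the shape operator L. They are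
  nonnegative by \<open>Dg_nonneg\<close>, so a positive product makes each of them
  positive.\<close>

lemma Dg_pos:
  assumes p: "p \<in> U" "p \<in> frontier K" and curv: "gauss_curvature (frontier K) (outer_unit_normal K) p > 0"
    and v: "g p \<bullet> v = 0" "v \<noteq> 0"
  shows "Dg p v \<bullet> v > 0"
proof -
  define c where "c = norm (g p)"
  have c: "c > 0" using g_nonzero[OF p(1)] by (simp add: c_def)
  define N where "N x = g x /\<^sub>R norm (g x)" for x
  define T where "T = {v. v \<bullet> outer_unit_normal K p = 0}"
  have Np: "outer_unit_normal K p = N p" using outer_normal_eq[OF p] by (simp add: N_def)
  have T: "w \<in> T \<longleftrightarrow> g p \<bullet> w = 0" for w
    using c by (simp add: T_def Np N_def c_def inner_commute)
  have NN: "N p \<bullet> N p = 1" using unit_inner[OF g_nonzero[OF p(1)]] by (simp add: N_def)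
  \<comment> \<open>Differentiating the normalized gradient also produces a multiple of
    \<open>g p\<close>, which tangent vectors do not see; L is the tangential part that
    remains.\<close>
  define L where "L v = (1 / c) *\<^sub>R (Dg p v - (Dg p v \<bullet> N p) *\<^sub>R N p)" for v
  note lin = Dg_linear[OF p(1)]
  have linL: "linear L"
    by (rule linearI) (simp_all add: L_def linear_add[OF lin] linear_scale[OF lin] inner_add_left scaleR_add_left algebra_simps)
  have subT: "subspace T" by (auto simp: T_def subspace_def inner_add_left)
  have LT: "L w \<in> T" for w by (simp add: T_def Np L_def inner_diff_left NN)
  have Lw: "L w \<bullet> w' = (Dg p w \<bullet> w') / c" if "w' \<in> T" for w w'
  proof -
    have "N p \<bullet> w' = 0" using that by (simp add: T_def Np inner_commute)
    then show ?thesis by (simp add: L_def inner_diff_left)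
  qed
  have symL: "L w \<bullet> w' = w \<bullet> L w'" if "w \<in> T" "w' \<in> T" for w w'
    using Lw[OF that(2), of w] Lw[OF that(1), of w'] Dg_sym[OF p(1), of w w'] by (simp add: inner_commute)
  obtain E \<mu> where E: "orthonormal_set E" "E \<subseteq> T" "span E = T" "card E = dim T" "\<And>e. e \<in> E \<Longrightarrow> L e = \<mu> e *\<^sub>R e"
    by (rule spectral_theorem[OF subT linL LT symL], assumption+, rule that; assumption)
  have "\<exists>D. (N has_derivative D) (at p) \<and> (\<forall>v w. g p \<bullet> w = 0 \<longrightarrow> D v \<bullet> w = (Dg p v \<bullet> w) / c)"
  proof -
    have "((\<lambda>x. inverse (norm (g x))) has_derivative
        (\<lambda>v. - (inverse (norm (g p)) * ((g p \<bullet> Dg p v) / norm (g p)) * inverse (norm (g p))))) (at p)"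
      by (rule Deriv.has_derivative_inverse[OF _ has_derivative_compose[OF g_deriv[OF p(1)] norm_has_derivative[OF g_nonzero[OF p(1)]]]])
        (use c in \<open>simp add: c_def\<close>)
    from has_derivative_scaleR[OF this g_deriv[OF p(1)]]
    have "(N has_derivative (\<lambda>v. inverse (norm (g p)) *\<^sub>R Dg p v +
        (- (inverse (norm (g p)) * ((g p \<bullet> Dg p v) / norm (g p)) * inverse (norm (g p)))) *\<^sub>R g p)) (at p)"
      by (simp add: N_def[abs_def])
    then show ?thesis
      by (intro exI conjI) (assumption, simp add: inner_add_left inner_diff_left c_def divide_inverse_commute)
  qed
  then obtain D where D: "(N has_derivative D) (at p)" "\<And>v w. g p \<bullet> w = 0 \<Longrightarrow> D v \<bullet> w = (Dg p v \<bullet> w) / c" by blast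
  obtain r where r: "r > 0" "ball p r \<subseteq> U" using open_U p(1) open_contains_ball by blast
  have \<nu>D: "(outer_unit_normal K has_derivative D) (at p within frontier K)"
  proof (rule has_derivative_transform_within[OF has_derivative_at_withinI[OF D(1)] r(1) p(2)])
    fix x assume "x \<in> frontier K" "dist x p < r"
    then have "x \<in> U" using r(2) by (auto simp: dist_commute)
    then show "N x = outer_unit_normal K x" using outer_normal_eq \<open>x \<in> frontier K\<close> by (simp add: N_def)
  qed
  have B: "second_fundamental_form (frontier K) (outer_unit_normal K) p v w = L v \<bullet> w" if "v \<in> T" "w \<in> T" for v w
  proof -
    have fd: "(outer_unit_normal K has_derivative frechet_derivative (outer_unit_normal K) (at p within frontier K)) (at p within frontier K)"
      using \<nu>D differentiableI frechet_derivative_works by blast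
    have "frechet_derivative (outer_unit_normal K) (at p within frontier K) v = D v"
      by (rule contingent_derivative_unique[OF tangent_contingent[OF p] fd \<nu>D]) (use that T in simp)
    then show ?thesis unfolding second_fundamental_form_def using D(2)[of w v] Lw[OF that(2), of v] that T by simp
  qed
  have fin: "finite E" by (rule orthonormal_set_finite[OF E(1)])
  have "gauss_curvature (frontier K) (outer_unit_normal K) p = prod_list (sorted_list_of_multiset (image_mset \<mu> (mset_set E)))"
    unfolding gauss_curvature_def T_def[symmetric]
    by (simp only: eigenvalues_on_eq[OF subT linL E(1,3,5) B])
  also have "\<dots> = (\<Prod>e\<in>E. \<mu> e)"
    by (metis mset_sorted_list_of_multiset prod_mset_prod_list prod_unfold_prod_mset)
  finally have prod: "(\<Prod>e\<in>E. \<mu> e) > 0" using curv by simp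
  have \<mu>: "\<mu> e > 0" if e: "e \<in> E" for e
  proof -
    have eT: "e \<in> T" using E(2) e by blast
    have "\<mu> e = L e \<bullet> e" using E(5)[OF e] orthonormal_set_inner[OF E(1) e e] by simp
    also have "\<dots> \<ge> 0" using Lw[OF eT, of e] Dg_nonneg[OF p, of e] eT T c by simp
    finally have "\<mu> e \<ge> 0" .
    moreover have "\<mu> e \<noteq> 0" using prod fin e by (metis less_irrefl prod_zero)
    ultimately show ?thesis by simp
  qed
  have vT: "v \<in> T" using v T by simp
  have exp: "v = (\<Sum>e\<in>E. (v \<bullet> e) *\<^sub>R e)" by (rule orthonormal_expansion[OF E(1)]) (use vT E(3) in simp)
  have "L v = (\<Sum>e\<in>E. (v \<bullet> e) *\<^sub>R (\<mu> e *\<^sub>R e))"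
  proof -
    have "L v = L (\<Sum>e\<in>E. (v \<bullet> e) *\<^sub>R e)" using exp by simp
    also have "\<dots> = (\<Sum>e\<in>E. (v \<bullet> e) *\<^sub>R L e)" by (simp add: linear_sum[OF linL] linear_scale[OF linL])
    finally show ?thesis using E(5) by simp
  qed
  then have Lv: "L v \<bullet> v = (\<Sum>e\<in>E. \<mu> e * (v \<bullet> e)\<^sup>2)"
    by (simp add: inner_sum_right inner_commute[of _ v] power2_eq_square mult_ac)
  obtain e where e: "e \<in> E" "v \<bullet> e \<noteq> 0"
  proof (rule ccontr)
    assume "\<not> thesis"
    then have "(\<Sum>e\<in>E. (v \<bullet> e) *\<^sub>R e) = 0" using that by (intro sum.neutral) auto
    then show False using exp v(2) by simp
  qed
  have "L v \<bullet> v > 0" unfolding Lv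
    by (rule sum_pos2[OF fin e(1)]) (use \<mu> e in \<open>auto simp: less_imp_le\<close>)
  then show ?thesis using Lw[OF vT, of v] c by (simp add: zero_less_divide_iff)
qed

end

text \<open>The sign s turns the gradient outwards at p, and U is the part of the chart where it
  stays so. At p it has a nonzero inner product with p, being parallel to an outer normal.\<close>

lemma (in convex_body) chart_exists:
  assumes hyp: "smooth_closed_hypersurface (frontier K)" and p: "p \<in> frontier K"
  obtains U f g Dg D2g where "defining_chart K U f g Dg D2g" "p \<in> U"
proof -
  obtain U0 f0 where U0: "open U0" "p \<in> U0" "smooth_on U0 f0"
      "\<forall>x\<in>U0. frechet_derivative f0 (at x) \<noteq> (\<lambda>v. 0)" "frontier K \<inter> U0 = {x \<in> U0. f0 x = (0::real)}"
    using hyp p unfolding smooth_closed_hypersurface_def by meson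
  obtain g0 Dg0 D2g0 where d: "\<And>x. x \<in> U0 \<Longrightarrow> (f0 has_derivative (\<lambda>v. g0 x \<bullet> v)) (at x)"
    "\<And>x. x \<in> U0 \<Longrightarrow> (g0 has_derivative Dg0 x) (at x)"
    "\<And>x v. x \<in> U0 \<Longrightarrow> ((\<lambda>x. Dg0 x v) has_derivative D2g0 x v) (at x)"
    "\<And>v w. continuous_on U0 (\<lambda>x. D2g0 x v w)"
    by (rule smooth_on_gradient[OF U0(3)], rule that; assumption)
  have g0: "g0 x \<noteq> 0" if "x \<in> U0" for x
    using U0(4) that frechet_derivative_at[OF d(1)[OF that]] by auto
  have lev: "f0 x = 0 \<longleftrightarrow> x \<in> frontier K" if "x \<in> U0" for x using U0(5) that by blast
  have cont: "continuous_on U0 f0" "continuous_on U0 g0"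
    using d(1,2) by (meson continuous_at_imp_continuous_on has_derivative_continuous)+
  obtain \<nu> where \<nu>: "norm \<nu> = 1" "\<And>y. y \<in> K \<Longrightarrow> \<nu> \<bullet> (y - p) \<le> 0" using supporting_normal[OF p] by blast
  have "\<nu> = ((\<nu> \<bullet> g0 p) / (g0 p \<bullet> g0 p)) *\<^sub>R g0 p"
    by (rule normal_parallel[OF U0(1,2) cont(1) d(1)[OF U0(2)] _ g0[OF U0(2)] _ \<nu>(2)]) (use lev U0(2) p in auto)
  then have "g0 p \<bullet> p \<noteq> 0" using normal_pos[OF \<nu>] by (metis inner_scaleR_left less_irrefl mult_zero_right)
  define s where "s = sgn (g0 p \<bullet> p)"
  have s: "s \<noteq> 0" "s * (g0 p \<bullet> p) > 0" using \<open>g0 p \<bullet> p \<noteq> 0\<close> by (auto simp: s_def sgn_if)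
  define U where "U = {x \<in> U0. s * (g0 x \<bullet> x) > 0}"
  have oU: "open U"
  proof -
    have "continuous_on U0 (\<lambda>x. s * (g0 x \<bullet> x))" by (intro continuous_intros cont)
    then have "open (U0 \<inter> (\<lambda>x. s * (g0 x \<bullet> x)) -` {0<..})" using U0(1) by (intro continuous_open_preimage) auto
    also have "U0 \<inter> (\<lambda>x. s * (g0 x \<bullet> x)) -` {0<..} = U" by (auto simp: U_def)
    finally show ?thesis .
  qed
  have "defining_chart K U (\<lambda>x. s * f0 x) (\<lambda>x. s *\<^sub>R g0 x) (\<lambda>x v. s *\<^sub>R Dg0 x v) (\<lambda>x v w. s *\<^sub>R D2g0 x v w)"
  proof
    show "((\<lambda>x. s * f0 x) has_derivative (\<lambda>v. (s *\<^sub>R g0 x) \<bullet> v)) (at x)" if "x \<in> U" for x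
      using has_derivative_mult_right[OF d(1), of x s] that by (simp add: U_def)
    show "((\<lambda>x. s *\<^sub>R g0 x) has_derivative (\<lambda>v. s *\<^sub>R Dg0 x v)) (at x)" if "x \<in> U" for x
      using has_derivative_scaleR_right[OF d(2), of x s] that by (simp add: U_def)
    show "((\<lambda>x. s *\<^sub>R Dg0 x v) has_derivative (\<lambda>w. s *\<^sub>R D2g0 x v w)) (at x)" if "x \<in> U" for x v
      using has_derivative_scaleR_right[OF d(3), of x s] that by (simp add: U_def)
    show "continuous_on U (\<lambda>x. s *\<^sub>R D2g0 x v w)" for v w
      by (rule continuous_on_subset[of U0]) (auto simp: U_def intro!: continuous_intros d(4))
    show "s * f0 x = 0 \<longleftrightarrow> x \<in> frontier K" if "x \<in> U" for x using lev s that by (auto simp: U_def)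
    show "(s *\<^sub>R g0 x) \<bullet> x > 0" if "x \<in> U" for x using that by (simp add: U_def)
  qed (rule oU)
  moreover have "p \<in> U" using U0(2) s by (simp add: U_def)
  ultimately show ?thesis using that by blast
qed

section \<open>Support points and their smooth dependence on the normal\<close>

context convex_body
begin

definition maximizer :: "'a \<Rightarrow> 'a \<Rightarrow> bool" where
  "maximizer y p \<longleftrightarrow> p \<in> K \<and> (\<forall>x\<in>K. x \<bullet> y \<le> p \<bullet> y)"

text \<open>Chosen among the maximizers; that there is just one for each nonzero y comes out of the
  injectivity of the charts.\<close>

definition support_point :: "'a \<Rightarrow> 'a" where
  "support_point y = (SOME p. maximizer y p)"

lemma maximizer_support_point: "maximizer y (support_point y)"
  unfolding support_point_def
proof (rule someI_ex)
  have "K \<noteq> {}" using K_0 interior_subset by blast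
  moreover have "continuous_on K (\<lambda>x. x \<bullet> y)" by (intro continuous_intros)
  ultimately obtain p where "p \<in> K" "\<forall>x\<in>K. x \<bullet> y \<le> p \<bullet> y"
    using continuous_attains_sup[OF K_compact] by blast
  then show "\<exists>p. maximizer y p" unfolding maximizer_def by blast
qed

lemma maximizer_frontier:
  assumes p: "maximizer y p" and y: "y \<noteq> 0"
  shows "p \<in> frontier K"
proof -
  have "p \<notin> interior K"
  proof
    assume "p \<in> interior K"
    then obtain e where e: "e > 0" "cball p e \<subseteq> K" unfolding mem_interior_cball by blast
    have "p + (e / norm y) *\<^sub>R y \<in> K" using e y by (intro subsetD[OF e(2)]) (simp add: dist_norm)
    then have "(p + (e / norm y) *\<^sub>R y) \<bullet> y \<le> p \<bullet> y" using p unfolding maximizer_def by blast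
    then have "(e / norm y) * (y \<bullet> y) \<le> 0" by (simp add: inner_add_left)
    moreover have "(e / norm y) * (y \<bullet> y) > 0" using e y by simp
    ultimately show False by linarith
  qed
  moreover have "p \<in> closure K" using p closure_subset unfolding maximizer_def by blast
  ultimately show ?thesis by (simp add: frontier_def)
qed

lemma maximizer_segment:
  assumes p: "maximizer y p" and q: "maximizer y q" and t: "0 \<le> t" "t \<le> 1"
  shows "maximizer y (p + t *\<^sub>R (q - p))"
proof -
  have pq: "p \<in> K" "q \<in> K" using p q by (simp_all add: maximizer_def)
  have "p \<bullet> y = q \<bullet> y" using p q pq unfolding maximizer_def by (intro antisym) blast+
  then have "(p + t *\<^sub>R (q - p)) \<bullet> y = p \<bullet> y" by (simp add: inner_add_left inner_diff_left)
  moreover have "(1 - t) *\<^sub>R p + t *\<^sub>R q \<in> K" using K_convex pq t by (simp add: convex_alt)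
  then have "p + t *\<^sub>R (q - p) \<in> K" by (simp add: algebra_simps)
  ultimately show ?thesis using p by (simp add: maximizer_def)
qed

end

context defining_chart
begin

lemma maximizer_gradient:
  assumes x: "x \<in> U" and m: "maximizer y x" and y: "y \<noteq> 0"
  shows "(norm y / norm (g x)) *\<^sub>R g x = y"
proof -
  have fx: "x \<in> frontier K" by (rule maximizer_frontier[OF m y])
  have "y /\<^sub>R norm y = g x /\<^sub>R norm (g x)"
  proof (rule normal_unique[OF x fx])
    show "norm (y /\<^sub>R norm y) = 1" using y by simp
    fix z assume "z \<in> K"
    then have "z \<bullet> y \<le> x \<bullet> y" using m unfolding maximizer_def by blast
    then have "y \<bullet> (z - x) \<le> 0" by (simp add: inner_diff_right inner_commute)
    then show "(y /\<^sub>R norm y) \<bullet> (z - x) \<le> 0" by (simp add: mult_nonneg_nonpos)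
  qed
  then have "norm y *\<^sub>R (y /\<^sub>R norm y) = norm y *\<^sub>R (g x /\<^sub>R norm (g x))" by (rule arg_cong)
  then show ?thesis using y by (simp add: divide_inverse)
qed

lemma maximizer_if_gradient:
  assumes x: "x \<in> U" "f x = 0" and s: "s > 0"
  shows "maximizer (s *\<^sub>R g x) x"
proof -
  have fx: "x \<in> frontier K" using level x by blast
  have "z \<bullet> (s *\<^sub>R g x) \<le> x \<bullet> (s *\<^sub>R g x)" if "z \<in> K" for z
    using g_supports[OF x(1) fx that] s by (simp add: inner_diff_right inner_commute)
  then show ?thesis unfolding maximizer_def using frontier_in_K[OF fx] by blast
qed

text \<open>The boundary point with outer normal direction \<open>y\<close> is the first component of the preimage of
  \<open>(y, 0)\<close>.\<close>

definition gauss_chart :: "'a \<times> real \<Rightarrow> 'a \<times> real" where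
  "gauss_chart q = (snd q *\<^sub>R g (fst q), f (fst q))"

definition gauss_chart_D :: "'a \<times> real \<Rightarrow> 'a \<times> real \<Rightarrow> 'a \<times> real" where
  "gauss_chart_D q v = (snd q *\<^sub>R Dg (fst q) (fst v) + snd v *\<^sub>R g (fst q), g (fst q) \<bullet> fst v)"

definition gauss_chart_D2 :: "'a \<times> real \<Rightarrow> 'a \<times> real \<Rightarrow> 'a \<times> real \<Rightarrow> 'a \<times> real" where
  "gauss_chart_D2 q v w = (snd q *\<^sub>R D2g (fst q) (fst v) (fst w) + snd w *\<^sub>R Dg (fst q) (fst v)
     + snd v *\<^sub>R Dg (fst q) (fst w), Dg (fst q) (fst w) \<bullet> fst v)"

lemma gauss_chart_derivs:
  assumes "fst q \<in> U"
  shows "(gauss_chart has_derivative gauss_chart_D q) (at q)"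
    and "((\<lambda>q. gauss_chart_D q v) has_derivative gauss_chart_D2 q v) (at q)"
proof -
  have F: "(fst has_derivative fst) (at q)" and S: "(snd has_derivative snd) (at q)"
    by (rule bounded_linear_imp_has_derivative[OF bounded_linear_fst], rule bounded_linear_imp_has_derivative[OF bounded_linear_snd])
  note fd = has_derivative_compose[OF F f_deriv[OF assms]] and gd = has_derivative_compose[OF F g_deriv[OF assms]]
    and Dd = has_derivative_compose[OF F Dg_deriv[OF assms]]
  show "(gauss_chart has_derivative gauss_chart_D q) (at q)"
    unfolding gauss_chart_def[abs_def] gauss_chart_D_def[abs_def]
    by (rule has_derivative_Pair[OF has_derivative_scaleR[OF S gd] fd])
  have "((\<lambda>q. gauss_chart_D q v) has_derivative (\<lambda>w. ((snd q *\<^sub>R D2g (fst q) (fst v) (fst w) + snd w *\<^sub>R Dg (fst q) (fst v))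
     + snd v *\<^sub>R Dg (fst q) (fst w), Dg (fst q) (fst w) \<bullet> fst v))) (at q)"
    unfolding gauss_chart_D_def
    by (rule has_derivative_Pair[OF has_derivative_add[OF has_derivative_scaleR[OF S Dd] has_derivative_scaleR_right[OF gd]]
          has_derivative_inner_left[OF gd]])
  then show "((\<lambda>q. gauss_chart_D q v) has_derivative gauss_chart_D2 q v) (at q)"
    unfolding gauss_chart_D2_def[abs_def] .
qed

lemma gauss_chart_D2_cont: "continuous_on (U \<times> {0<..}) (\<lambda>q. gauss_chart_D2 q v w)"
proof -
  have F: "continuous_on (U \<times> {0<..}) fst" and S: "continuous_on (U \<times> {0<..}) snd"
    by (intro continuous_intros)+
  have sub: "fst ` (U \<times> {0<..}) \<subseteq> U" by auto
  show ?thesis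
    unfolding gauss_chart_D2_def
    by (intro continuous_intros S continuous_on_compose2[OF D2g_cont F sub] continuous_on_compose2[OF Dg_cont F sub])
qed

text \<open>A second maximizer would make the whole segment consist of maximizers, against the injectivity of
  the chart map near its start.\<close>

lemma maximizer_unique:
  assumes U': "open U'" "U' \<subseteq> U \<times> {0<..}" "inj_on gauss_chart U'" and x: "(x, s) \<in> U'" and y: "y \<noteq> 0"
    and gx: "gauss_chart (x, s) = (y, 0)" and q: "maximizer y q"
  shows "q = x"
proof (rule ccontr)
  assume qx: "q \<noteq> x"
  have xU: "x \<in> U" "s > 0" using U'(2) x by auto
  have sg: "s *\<^sub>R g x = y" "f x = 0" using gx by (simp_all add: gauss_chart_def)
  have mx: "maximizer y x" using maximizer_if_gradient[OF xU(1) sg(2) xU(2)] sg(1) by simp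
  have s: "s = norm y / norm (g x)" using sg(1)[symmetric] xU g_nonzero[OF xU(1)] by simp
  define c where "c t = x + t *\<^sub>R (q - x)" for t :: real
  define b where "b t = (c t, norm y / norm (g (c t)))" for t
  have b0: "b 0 = (x, s)" by (simp add: b_def c_def s)
  have gx': "isCont g x" using g_deriv[OF xU(1)] by (rule has_derivative_continuous)
  have cc: "isCont c 0" unfolding c_def by (intro continuous_intros)
  have gc: "isCont (\<lambda>t. g (c t)) 0" by (rule isCont_o2[OF cc]) (simp add: c_def gx')
  have "isCont (\<lambda>t. norm y / norm (g (c t))) 0"
    by (rule isCont_divide[OF continuous_const continuous_norm[OF gc]]) (simp add: c_def g_nonzero[OF xU(1)])
  then have "isCont b 0" unfolding b_def by (rule continuous_Pair[OF cc])
  then have "(b \<longlongrightarrow> b 0) (at 0)" by (simp add: isCont_def)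
  then have "\<forall>\<^sub>F t in at 0. b t \<in> U'" by (rule topological_tendstoD[OF _ U'(1)]) (simp add: b0 x)
  then obtain d where d: "d > 0" "\<And>t. t \<noteq> 0 \<Longrightarrow> dist t 0 < d \<Longrightarrow> b t \<in> U'" unfolding eventually_at by blast
  define t where "t = min 1 (d / 2)"
  have t: "t > 0" "t \<le> 1" "t < d" using d(1) by (auto simp: t_def)
  have bt: "b t \<in> U'" using d(2)[of t] t by (simp add: dist_real_def)
  have ct: "c t \<in> U" using bt U'(2) by (auto simp: b_def)
  have mt: "maximizer y (c t)" unfolding c_def by (rule maximizer_segment[OF mx q]) (use t in simp_all)
  have "gauss_chart (b t) = (y, 0)"
    using maximizer_gradient[OF ct mt y] level[OF ct] maximizer_frontier[OF mt y] by (simp add: gauss_chart_def b_def)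
  then have "b t = (x, s)" using inj_onD[OF U'(3) _ bt x] gx by simp
  then show False using qx t(1) by (simp add: b_def c_def)
qed

text \<open>The second component makes \<open>fst v\<close> tangential; pairing the first one with
  \<open>fst v\<close> removes the gradient term, and \<open>Dg_pos\<close> forces
  \<open>fst v = 0\<close>.\<close>

lemma gauss_chart_kernel:
  assumes p: "p \<in> U" "p \<in> frontier K" and curv: "gauss_curvature (frontier K) (outer_unit_normal K) p > 0"
    and s: "s > 0" and v: "gauss_chart_D (p, s) v = 0"
  shows "v = 0"
proof -
  have 1: "s *\<^sub>R Dg p (fst v) + snd v *\<^sub>R g p = 0" and 2: "g p \<bullet> fst v = 0"
    using v by (simp_all add: gauss_chart_D_def zero_prod_def)
  have "(s *\<^sub>R Dg p (fst v) + snd v *\<^sub>R g p) \<bullet> fst v = 0" unfolding 1 by simp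
  then have "s * (Dg p (fst v) \<bullet> fst v) = 0" by (simp add: inner_add_left 2)
  then have "Dg p (fst v) \<bullet> fst v = 0" using s by simp
  then have f0: "fst v = 0" using Dg_pos[OF p curv 2] by force
  have "Dg p 0 = 0" using Dg_linear[OF p(1)] by (rule linear_0)
  then have "snd v = 0" using 1 g_nonzero[OF p(1)] by (simp add: f0)
  then show ?thesis using f0 by (simp add: prod_eq_iff)
qed

text \<open>On the slice of pairs \<open>(y, 0)\<close> the inverse of \<open>gauss_chart\<close>
  returns the support point together with its multiplier, so the support point inherits two
  derivatives.\<close>

lemma local_support_point:
  assumes p: "p \<in> U" "maximizer y0 p" and y0: "y0 \<noteq> 0"
    and curv: "\<And>x. x \<in> frontier K \<Longrightarrow> gauss_curvature (frontier K) (outer_unit_normal K) x > 0"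
  obtains V and \<xi>1 :: "'a \<Rightarrow> ('a \<Rightarrow>\<^sub>L 'a)" and \<xi>2 :: "'a \<Rightarrow> 'a \<Rightarrow> ('a \<Rightarrow>\<^sub>L 'a)" where
    "open V" "y0 \<in> V"
    "\<And>y. y \<in> V \<Longrightarrow> (support_point has_derivative \<xi>1 y) (at y)"
    "\<And>y. y \<in> V \<Longrightarrow> (\<xi>1 has_derivative \<xi>2 y) (at y)" "\<And>w. continuous_on V (\<lambda>y. \<xi>2 y w)"
    "\<And>y v. y \<in> V \<Longrightarrow> v \<noteq> 0 \<Longrightarrow> v \<bullet> y = 0 \<Longrightarrow> \<xi>1 y v \<bullet> v > 0"
proof -
  have pf: "p \<in> frontier K" by (rule maximizer_frontier[OF p(2) y0])
  define s0 where "s0 = norm y0 / norm (g p)"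
  have s0: "s0 > 0" using y0 g_nonzero[OF p(1)] by (simp add: s0_def)
  have c0: "gauss_chart (p, s0) = (y0, 0)"
    using maximizer_gradient[OF p y0] level[OF p(1)] pf by (simp add: gauss_chart_def s0_def)
  have oW: "open (U \<times> {0::real<..})" by (intro open_Times open_U open_greaterThan)
  have pW: "(p, s0) \<in> U \<times> {0<..}" using p(1) s0 by simp
  have D1: "(gauss_chart has_derivative gauss_chart_D q) (at q)" if "q \<in> U \<times> {0<..}" for q
    by (rule gauss_chart_derivs(1)) (use that in auto)
  have D2: "((\<lambda>q. gauss_chart_D q v) has_derivative gauss_chart_D2 q v) (at q)" if "q \<in> U \<times> {0<..}" for q v
    by (rule gauss_chart_derivs(2)) (use that in auto)
  obtain U' V and G :: "'a \<times> real \<Rightarrow> 'a \<times> real" and G1 :: "'a \<times> real \<Rightarrow> (('a \<times> real) \<Rightarrow>\<^sub>L ('a \<times> real))" 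
      and G2 :: "'a \<times> real \<Rightarrow> 'a \<times> real \<Rightarrow> (('a \<times> real) \<Rightarrow>\<^sub>L ('a \<times> real))" where
    U': "open U'" "U' \<subseteq> U \<times> {0<..}" "(p, s0) \<in> U'" "inj_on gauss_chart U'" and V: "open V" "gauss_chart (p, s0) \<in> V"
    and G: "\<And>y. y \<in> V \<Longrightarrow> G y \<in> U'" "\<And>y. y \<in> V \<Longrightarrow> gauss_chart (G y) = y"
    and G1: "\<And>y. y \<in> V \<Longrightarrow> (G has_derivative blinfun_apply (G1 y)) (at y)" and G2: "\<And>y. y \<in> V \<Longrightarrow> (G1 has_derivative G2 y) (at y)"
    and G2c: "\<And>w. continuous_on V (\<lambda>y. G2 y w)" and DG: "\<And>y w. y \<in> V \<Longrightarrow> gauss_chart_D (G y) (blinfun_apply (G1 y) w) = w"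
    by (rule local_inverse_C2[OF oW pW D1 D2 gauss_chart_D2_cont gauss_chart_kernel[OF p(1) pf curv[OF pf] s0]],
        assumption+, rule that; assumption)
  define j :: "'a \<Rightarrow> 'a \<times> real" where "j y = (y, 0)" for y
  have jb: "bounded_linear j" unfolding j_def by (intro bounded_linear_Pair bounded_linear_ident bounded_linear_zero)
  have jd: "(j has_derivative j) F" for F by (rule bounded_linear_imp_has_derivative[OF jb])
  define V' where "V' = j -` V \<inter> - {0}"
  have V': "j y \<in> V" "y \<noteq> 0" if "y \<in> V'" for y using that by (auto simp: V'_def)
  have oV': "open V'"
    unfolding V'_def
    by (rule open_Int[OF open_vimage[OF V(1) linear_continuous_on[OF jb]]]) (rule open_Compl[OF closed_singleton])
  have y0V: "y0 \<in> V'" using V(2) c0 y0 by (simp add: V'_def j_def)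
  have G': "fst (G (j y)) \<in> U" "snd (G (j y)) > 0" "f (fst (G (j y))) = 0"
    "snd (G (j y)) *\<^sub>R g (fst (G (j y))) = y" if y: "y \<in> V'" for y
  proof -
    have "G (j y) \<in> U \<times> {0<..}" using G(1)[OF V'(1)[OF y]] U'(2) by blast
    then show "fst (G (j y)) \<in> U" "snd (G (j y)) > 0" by auto
    show "f (fst (G (j y))) = 0" "snd (G (j y)) *\<^sub>R g (fst (G (j y))) = y"
      using G(2)[OF V'(1)[OF y]] by (simp_all add: gauss_chart_def j_def)
  qed
  have sp: "support_point y = fst (G (j y))" if y: "y \<in> V'" for y
  proof (rule maximizer_unique[OF U'(1,2,4) _ V'(2)[OF y] _ maximizer_support_point])
    show "(fst (G (j y)), snd (G (j y))) \<in> U'" using G(1)[OF V'(1)[OF y]] by simp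
    show "gauss_chart (fst (G (j y)), snd (G (j y))) = (y, 0)" using G(2)[OF V'(1)[OF y]] by (simp add: j_def)
  qed
  define P where "P L = Blinfun fst o\<^sub>L L o\<^sub>L Blinfun j" for L :: "('a \<times> real) \<Rightarrow>\<^sub>L ('a \<times> real)"
  have P_apply: "blinfun_apply (P L) v = fst (blinfun_apply L (j v))" for L v
    by (simp add: P_def bounded_linear_Blinfun_apply[OF bounded_linear_fst] bounded_linear_Blinfun_apply[OF jb])
  have Pb: "bounded_linear P"
    unfolding P_def
    by (rule bounded_linear_compose[OF bounded_bilinear.bounded_linear_left[OF bounded_bilinear_blinfun_compose]
          bounded_bilinear.bounded_linear_right[OF bounded_bilinear_blinfun_compose]])
  show thesis
  proof (rule that[of V' "\<lambda>y. P (G1 (j y))" "\<lambda>y w. P (G2 (j y) (j w))"])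
    show "(support_point has_derivative P (G1 (j y))) (at y)" if y: "y \<in> V'" for y
    proof -
      have "((\<lambda>y. fst (G (j y))) has_derivative (\<lambda>v. fst (G1 (j y) (j v)))) (at y)"
        by (rule bounded_linear.has_derivative[OF bounded_linear_fst has_derivative_compose[OF jd G1[OF V'(1)[OF y]]]])
      then have "(support_point has_derivative (\<lambda>v. fst (G1 (j y) (j v)))) (at y)"
        by (rule has_derivative_transform_within_open[OF _ oV' y]) (simp add: sp)
      then show ?thesis by (simp add: P_apply[abs_def])
    qed
    show "((\<lambda>y. P (G1 (j y))) has_derivative (\<lambda>w. P (G2 (j y) (j w)))) (at y)" if y: "y \<in> V'" for y
      by (rule bounded_linear.has_derivative[OF Pb has_derivative_compose[OF jd G2[OF V'(1)[OF y]]]])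
    show "continuous_on V' (\<lambda>y. P (G2 (j y) (j w)))" for w
      by (rule bounded_linear.continuous_on[OF Pb], rule continuous_on_compose2[OF G2c linear_continuous_on[OF jb]])
        (use V' in auto)
    \<comment> \<open>Differentiating \<open>s *\<^sub>R g x = y\<close> and \<open>f x = 0\<close>
      along v gives \<open>v = s *\<^sub>R Dg x w + \<tau> *\<^sub>R g x\<close> with w tangential,
      so \<open>w \<bullet> v\<close> is s times the positive form
      \<open>Dg x w \<bullet> w\<close>.\<close>
    show "P (G1 (j y)) v \<bullet> v > 0" if y: "y \<in> V'" and v: "v \<noteq> 0" "v \<bullet> y = 0" for y v
    proof -
      define x where "x = fst (G (j y))"
      define s where "s = snd (G (j y))"
      define w where "w = fst (G1 (j y) (j v))"
      define \<tau> where "\<tau> = snd (G1 (j y) (j v))"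
      have x: "x \<in> U" "s > 0" "f x = 0" "s *\<^sub>R g x = y" using G'[OF y] by (simp_all add: x_def s_def)
      have xf: "x \<in> frontier K" using level[OF x(1)] x(3) by simp
      have eq: "s *\<^sub>R Dg x w + \<tau> *\<^sub>R g x = v" and gw: "g x \<bullet> w = 0"
        using DG[OF V'(1)[OF y], of "j v"] by (simp_all add: gauss_chart_D_def j_def x_def s_def w_def \<tau>_def)
      have "s * (g x \<bullet> v) = 0" using v(2) by (simp add: x(4)[symmetric] inner_commute)
      then have gv: "g x \<bullet> v = 0" using x(2) by simp
      have w0: "w \<noteq> 0"
      proof
        assume "w = 0"
        then have "v = \<tau> *\<^sub>R g x" using eq linear_0[OF Dg_linear[OF x(1)]] by simp
        then have "v \<bullet> v = \<tau> * (g x \<bullet> v)" by (metis inner_scaleR_left)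
        then show False using gv v(1) by simp
      qed
      have "w \<bullet> v = w \<bullet> (s *\<^sub>R Dg x w + \<tau> *\<^sub>R g x)" using eq by simp
      also have "\<dots> = s * (Dg x w \<bullet> w)" using gw by (simp add: inner_add_right inner_commute)
      also have "\<dots> > 0" using Dg_pos[OF x(1) xf curv[OF xf] gw w0] x(2) by simp
      finally show ?thesis by (simp add: P_apply w_def)
    qed
  qed (fact oV' y0V)+
qed

end

text \<open>The charts provide derivatives near each direction; A and H are selected globally as
  Frechet derivatives, and uniqueness of derivatives identifies them with the local ones.\<close>

theorem smooth_body_exists:
  fixes M K :: "'a::euclidean_space set"
  assumes M: "smooth_strictly_convex M K" and dim: "DIM('a) \<ge> 2"
  obtains X A H where "smooth_body K X A H"
proof -
  interpret convex_body K
    using M by unfold_locales (simp_all add: smooth_strictly_convex_def)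
  have hyp: "smooth_closed_hypersurface (frontier K)"
    and curv: "\<And>x. x \<in> frontier K \<Longrightarrow> gauss_curvature (frontier K) (outer_unit_normal K) x > 0"
    using M by (auto simp: smooth_strictly_convex_def)
  define A where "A y = op_of (frechet_derivative support_point (at y))" for y
  define H where "H y = frechet_derivative A (at y)" for y
  have loc: "\<exists>V. open V \<and> y0 \<in> V \<and> (\<forall>y\<in>V. (support_point has_derivative A y) (at y) \<and> (A has_derivative H y) (at y) \<and>
      (\<forall>v. v \<noteq> 0 \<longrightarrow> v \<bullet> y = 0 \<longrightarrow> A y v \<bullet> v > 0)) \<and> (\<forall>w. continuous_on V (\<lambda>y. H y w))" if y0: "y0 \<noteq> 0" for y0
  proof -
    have p: "support_point y0 \<in> frontier K" by (rule maximizer_frontier[OF maximizer_support_point y0])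
    obtain U f g Dg D2g where ch: "defining_chart K U f g Dg D2g" "support_point y0 \<in> U"
      by (rule chart_exists[OF hyp p])
    obtain V \<xi>1 \<xi>2 where V: "open V" "y0 \<in> V"
      and d1: "\<And>y. y \<in> V \<Longrightarrow> (support_point has_derivative blinfun_apply (\<xi>1 y)) (at y)"
      and d2: "\<And>y. y \<in> V \<Longrightarrow> (\<xi>1 has_derivative \<xi>2 y) (at y)" and c: "\<And>w. continuous_on V (\<lambda>y. \<xi>2 y w)"
      and pos: "\<And>y v. y \<in> V \<Longrightarrow> v \<noteq> 0 \<Longrightarrow> v \<bullet> y = 0 \<Longrightarrow> blinfun_apply (\<xi>1 y) v \<bullet> v > 0"
      by (rule defining_chart.local_support_point[OF ch maximizer_support_point y0 curv], assumption, rule that; assumption)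
    have A: "A y = \<xi>1 y" if "y \<in> V" for y
      unfolding A_def frechet_derivative_at[OF d1[OF that], symmetric] by (rule op_of_blinfun)
    have dA: "(A has_derivative \<xi>2 y) (at y)" if "y \<in> V" for y
      by (rule has_derivative_transform_within_open[OF d2[OF that] V(1) that]) (simp add: A)
    have H: "H y = \<xi>2 y" if "y \<in> V" for y
      unfolding H_def by (rule frechet_derivative_at[OF dA[OF that], symmetric])
    have "continuous_on V (\<lambda>y. H y w)" for w
      by (rule continuous_on_eq[OF c[of w]]) (simp add: H)
    then show ?thesis using V d1 dA pos by (intro exI[of _ V]) (simp add: A H)
  qed
  have "smooth_body K support_point A H"
  proof
    show "DIM('a) \<ge> 2" by (rule dim)
    show "support_point y \<in> K" for y using maximizer_support_point[of y] by (simp add: maximizer_def)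
    show "(support_point has_derivative A y) (at y)" "(A has_derivative H y) (at y)" if "y \<noteq> 0" for y
      using loc[OF that] by blast+
    show "A y v \<bullet> v > 0" if "y \<noteq> 0" "v \<noteq> 0" "v \<bullet> y = 0" for y v
      using loc[OF that(1)] that(2,3) by blast
    show "x \<bullet> y \<le> support_point y \<bullet> y" if "x \<in> K" for x y
      using maximizer_support_point[of y] that by (simp add: maximizer_def)
    show "continuous_on (- {0}) (\<lambda>y. H y b)" for b
    proof (rule continuous_at_imp_continuous_on, rule ballI)
      fix y :: 'a assume "y \<in> - {0}"
      then obtain V where "open V" "y \<in> V" "continuous_on V (\<lambda>y. H y b)" using loc[of y] by auto
      then show "isCont (\<lambda>y. H y b) y" by (simp add: continuous_on_eq_continuous_at)
    qed
  qed (fact K_convex K_compact K_0)+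
  then show thesis by (rule that)
qed

theorem theorem1p3:
  fixes M K :: "'a::euclidean_space set"
    and n k l :: nat
    and \<psi> :: "real \<times> real \<Rightarrow> real"
    and u :: "'a \<Rightarrow> real"
  assumes dim: "DIM('a) = n + 1" and n: "n \<ge> 2"
    and lk: "l < k" and kn: "k \<le> n"
    and \<psi>_pos: "\<And>s t. s > 0 \<Longrightarrow> t > 0 \<Longrightarrow> \<psi> (s, t) > 0"
    and \<psi>_C1: "Ck_on 1 ({0<..} \<times> {0<..}) \<psi>"
    and \<psi>_mono1: "\<And>s t. s > 0 \<Longrightarrow> t > 0 \<Longrightarrow> deriv (\<lambda>x. \<psi> (x, t)) s \<ge> 0"
    and \<psi>_mono2: "\<And>s t. s > 0 \<Longrightarrow> t > 0 \<Longrightarrow> deriv (\<lambda>y. \<psi> (s, y)) t \<ge> 0"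
    and \<psi>_strict: "\<And>s t. s > 0 \<Longrightarrow> t > 0 \<Longrightarrow>
           deriv (\<lambda>x. \<psi> (x, t)) s > 0 \<or> deriv (\<lambda>y. \<psi> (s, y)) t > 0"
    and MK: "smooth_strictly_convex M K"
    and u: "u = support_fun K"
    and eq: "\<And>z. z \<in> sphere 0 1 \<Longrightarrow>
           (P_W k u z / P_W l u z) powr (1 / (real k - real l)) = \<psi> (u z, radial_fun u z)"
  shows "\<exists>R>0. M = sphere 0 R"
proof -
  obtain X A H where "smooth_body K X A H"
    by (rule smooth_body_exists[OF MK]) (use dim n in simp)
  then interpret smooth_body_dim K X A H n
    by (rule smooth_body_dim.intro) (unfold_locales, use dim in simp)
  have "M = frontier K" using MK by (simp add: smooth_strictly_convex_def)
  then show ?thesis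
    using sphere_if_isotropic[OF lk kn \<psi>_pos \<psi>_C1 \<psi>_mono1 \<psi>_mono2 \<psi>_strict eq[unfolded u]] by simp
qed

end
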